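(* Let $\mathcal D$ be a triangulated category with small coproducts and let $P$ be an object of $\mathcal D$. The following conditions are equivalent: 1) $P$ is compact in $\mathcal D$. 2) $P$ satisfies: 2.1) $P$ is perfect in $\mathcal D$. 2.2) $P$ is compact in the full subcategory $\mathrm{Sum}(\{P[n]\}_{n\in\mathbf Z})$ of $\mathcal D$ formed by small coproducts of shifts of $P$. 2.3) $\mathrm{Tria}(P)^\perp$ is closed under small coproducts. 3) $P$ satisfies: 3.1) $P$ is compact in $\mathrm{Tria}(P)$. 3.2) $\mathrm{Tria}(P)^\perp$ is closed under small coproducts. 4) $P$ satisfies: 4.1) $P$ is superperfect in $\mathcal D$. 4.2) $P$ is compact in $\mathrm{Sum}(\{P[n]\}_{n\in\mathbf Z})$.
   Context: $\mathrm{Tria}(P)$ is the smallest full triangulated subcategory of $\mathcal D$ containing $P$ and closed under small coproducts. For a class $\mathcal Q$, $\mathcal Q^\perp$ is the full subcategory of objects $M$ with $\mathcal D(Q,M)=0$ for all $Q\in\mathcal Q$. An object $P$ of a category $\mathcal C$ with the relevant coproducts is compact in $\mathcal C$ if $\mathcal C(P,?)$ preserves small coproducts. An object $P$ of $\mathcal D$ is perfect (respectively, superperfect) if for every countable (respectively, small) family of morphisms $M_i\to N_i$, $i\in I$, of $\mathcal D$ such that the coproducts exist, the map $\mathcal D(P,\coprod_I M_i)\to\mathcal D(P,\coprod_I N_i)$ is surjective provided every map $\mathcal D(P,M_i)\to\mathcal D(P,N_i)$ is surjective. Shifts are taken in both directions. *)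

theory Defs
  imports "HOL-Algebra.Free_Abelian_Groups"
begin

unbundle cardinal_syntax

text \<open>
  Smallness is relative to an uncountable regular cardinal \<open>\<kappa>\<close>: a set is small iff it has fewer than
  \<open>\<kappa>\<close> elements. The small sets of a Grothendieck universe are the case of an inaccessible \<open>\<kappa>\<close>.
  Every small set is equipotent to a subset of the type \<open>'k\<close> carrying \<open>\<kappa>\<close>, so small families are
  indexed by subsets of \<open>'k\<close>.
\<close>

definition universe_cardinal :: "'k rel \<Rightarrow> bool"
  where "universe_cardinal \<kappa> \<longleftrightarrow> Card_order \<kappa> \<and> regularCard \<kappa> \<and> natLeq <o \<kappa>"

definition small :: "'k rel \<Rightarrow> 'a set \<Rightarrow> bool"
  where "small \<kappa> A \<longleftrightarrow> |A| <o \<kappa>"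

record ('o, 'm) preadd_data =
  Obj :: "'o set"
  Arr :: "'m set"
  Dom :: "'m \<Rightarrow> 'o"
  Cod :: "'m \<Rightarrow> 'o"
  Ident :: "'o \<Rightarrow> 'm"
  Comp :: "'m \<Rightarrow> 'm \<Rightarrow> 'm"  (infixr "\<odot>\<index>" 70)
  Zero :: "'o \<Rightarrow> 'o \<Rightarrow> 'm"
  Plus :: "'m \<Rightarrow> 'm \<Rightarrow> 'm"

definition Hom :: "('o, 'm, 'z) preadd_data_scheme \<Rightarrow> 'o \<Rightarrow> 'o \<Rightarrow> 'm set"
  where "Hom C X Y = {f \<in> Arr C. Dom C f = X \<and> Cod C f = Y}"

definition hom_group :: "('o, 'm, 'z) preadd_data_scheme \<Rightarrow> 'o \<Rightarrow> 'o \<Rightarrow> 'm monoid"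
  where "hom_group C X Y = \<lparr>carrier = Hom C X Y, monoid.mult = Plus C, one = Zero C X Y\<rparr>"

definition Minus :: "('o, 'm, 'z) preadd_data_scheme \<Rightarrow> 'm \<Rightarrow> 'm"
  where "Minus C f = inv\<^bsub>hom_group C (Dom C f) (Cod C f)\<^esub> f"

locale preadditive_category =
  fixes C :: "('o, 'm, 'z) preadd_data_scheme" (structure)
  assumes arr_obj: "f \<in> Arr C \<Longrightarrow> Dom C f \<in> Obj C \<and> Cod C f \<in> Obj C"
    and ident_hom: "X \<in> Obj C \<Longrightarrow> Ident C X \<in> Hom C X X"
    and comp_hom: "\<lbrakk>f \<in> Hom C X Y; g \<in> Hom C Y Z\<rbrakk> \<Longrightarrow> g \<odot> f \<in> Hom C X Z"
    and comp_ident: "f \<in> Hom C X Y \<Longrightarrow> f \<odot> Ident C X = f"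
    and ident_comp: "f \<in> Hom C X Y \<Longrightarrow> Ident C Y \<odot> f = f"
    and comp_assoc: "\<lbrakk>f \<in> Hom C W X; g \<in> Hom C X Y; h \<in> Hom C Y Z\<rbrakk>
                      \<Longrightarrow> (h \<odot> g) \<odot> f = h \<odot> (g \<odot> f)"
    and hom_comm_group: "\<lbrakk>X \<in> Obj C; Y \<in> Obj C\<rbrakk> \<Longrightarrow> comm_group (hom_group C X Y)"
    and comp_plus: "\<lbrakk>f \<in> Hom C X Y; f' \<in> Hom C X Y; g \<in> Hom C Y Z\<rbrakk>
                      \<Longrightarrow> g \<odot> Plus C f f' = Plus C (g \<odot> f) (g \<odot> f')"
    and plus_comp: "\<lbrakk>f \<in> Hom C X Y; g \<in> Hom C Y Z; g' \<in> Hom C Y Z\<rbrakk>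
                      \<Longrightarrow> Plus C g g' \<odot> f = Plus C (g \<odot> f) (g' \<odot> f)"

definition zero_object :: "('o, 'm, 'z) preadd_data_scheme \<Rightarrow> 'o \<Rightarrow> bool"
  where "zero_object C Z \<longleftrightarrow> Z \<in> Obj C \<and>
    (\<forall>X\<in>Obj C. (\<exists>!f. f \<in> Hom C Z X) \<and> (\<exists>!f. f \<in> Hom C X Z))"

definition biproduct ::
    "('o, 'm, 'z) preadd_data_scheme \<Rightarrow> 'o \<Rightarrow> 'o \<Rightarrow> 'o \<Rightarrow> 'm \<Rightarrow> 'm \<Rightarrow> 'm \<Rightarrow> 'm \<Rightarrow> bool"
  where "biproduct C X Y B i j p q \<longleftrightarrow> B \<in> Obj C \<and>
    i \<in> Hom C X B \<and> j \<in> Hom C Y B \<and> p \<in> Hom C B X \<and> q \<in> Hom C B Y \<and>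
    p \<odot>\<^bsub>C\<^esub> i = Ident C X \<and> q \<odot>\<^bsub>C\<^esub> j = Ident C Y \<and>
    p \<odot>\<^bsub>C\<^esub> j = Zero C Y X \<and> q \<odot>\<^bsub>C\<^esub> i = Zero C X Y \<and>
    Plus C (i \<odot>\<^bsub>C\<^esub> p) (j \<odot>\<^bsub>C\<^esub> q) = Ident C B"

locale additive_category = preadditive_category +
  assumes ex_zero_object: "\<exists>Z. zero_object C Z"
    and ex_biproduct: "\<lbrakk>X \<in> Obj C; Y \<in> Obj C\<rbrakk> \<Longrightarrow> \<exists>B i j p q. biproduct C X Y B i j p q"

definition isomorphism :: "('o, 'm, 'z) preadd_data_scheme \<Rightarrow> 'm \<Rightarrow> 'o \<Rightarrow> 'o \<Rightarrow> bool"
  where "isomorphism C f X Y \<longleftrightarrow> X \<in> Obj C \<and> Y \<in> Obj C \<and> f \<in> Hom C X Y \<and>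
    (\<exists>g\<in>Hom C Y X. g \<odot>\<^bsub>C\<^esub> f = Ident C X \<and> f \<odot>\<^bsub>C\<^esub> g = Ident C Y)"

definition isomorphic :: "('o, 'm, 'z) preadd_data_scheme \<Rightarrow> 'o \<Rightarrow> 'o \<Rightarrow> bool"
  where "isomorphic C X Y \<longleftrightarrow> (\<exists>f. isomorphism C f X Y)"

definition full_subcategory ::
    "('o, 'm, 'z) preadd_data_scheme \<Rightarrow> 'o set \<Rightarrow> ('o, 'm, 'z) preadd_data_scheme"
  where "full_subcategory C S =
    C\<lparr>Obj := S, Arr := {f \<in> Arr C. Dom C f \<in> S \<and> Cod C f \<in> S}\<rparr>"

definition locally_small :: "'k rel \<Rightarrow> ('o, 'm, 'z) preadd_data_scheme \<Rightarrow> bool"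
  where "locally_small \<kappa> C \<longleftrightarrow> (\<forall>X\<in>Obj C. \<forall>Y\<in>Obj C. small \<kappa> (Hom C X Y))"

definition is_coproduct ::
    "('o, 'm, 'z) preadd_data_scheme \<Rightarrow> 'i set \<Rightarrow> ('i \<Rightarrow> 'o) \<Rightarrow> 'o \<Rightarrow> ('i \<Rightarrow> 'm) \<Rightarrow> bool"
  where "is_coproduct C I M S \<iota> \<longleftrightarrow> S \<in> Obj C \<and>
    (\<forall>i\<in>I. M i \<in> Obj C \<and> \<iota> i \<in> Hom C (M i) S) \<and>
    (\<forall>X\<in>Obj C. \<forall>\<phi>. (\<forall>i\<in>I. \<phi> i \<in> Hom C (M i) X) \<longrightarrow>
       (\<exists>!h. h \<in> Hom C S X \<and> (\<forall>i\<in>I. h \<odot>\<^bsub>C\<^esub> \<iota> i = \<phi> i)))"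

definition has_small_coproducts :: "'k rel \<Rightarrow> ('o, 'm, 'z) preadd_data_scheme \<Rightarrow> bool"
  where "has_small_coproducts \<kappa> C \<longleftrightarrow> (\<forall>(I :: 'k set) M. small \<kappa> I \<and> (\<forall>i\<in>I. M i \<in> Obj C) \<longrightarrow>
    (\<exists>S \<iota>. is_coproduct C I M S \<iota>))"

definition closed_under_small_coproducts ::
    "'k rel \<Rightarrow> ('o, 'm, 'z) preadd_data_scheme \<Rightarrow> 'o set \<Rightarrow> bool"
  where "closed_under_small_coproducts \<kappa> C U \<longleftrightarrow>
    (\<forall>(I :: 'k set) M S \<iota>. small \<kappa> I \<and> (\<forall>i\<in>I. M i \<in> U) \<and> is_coproduct C I M S \<iota> \<longrightarrow> S \<in> U)"

definition Sum_of :: "'k rel \<Rightarrow> ('o, 'm, 'z) preadd_data_scheme \<Rightarrow> 'o set \<Rightarrow> 'o set"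
  where "Sum_of \<kappa> C Q = {S. \<exists>(I :: 'k set) M \<iota>.
    small \<kappa> I \<and> (\<forall>i\<in>I. M i \<in> Q) \<and> is_coproduct C I M S \<iota>}"

text \<open>The canonical map \<open>\<Oplus>\<^sub>i C(P, M\<^sub>i) \<rightarrow> C(P, S)\<close>; elements of the direct sum are the finitely supported
  families.\<close>

definition coproduct_comparison ::
    "('o, 'm, 'z) preadd_data_scheme \<Rightarrow> 'o \<Rightarrow> 'i set \<Rightarrow> 'o \<Rightarrow> ('i \<Rightarrow> 'm) \<Rightarrow> ('i \<Rightarrow> 'm) \<Rightarrow> 'm"
  where "coproduct_comparison C P I S \<iota> \<phi> = gfinprod (hom_group C P S) (\<lambda>i. \<iota> i \<odot>\<^bsub>C\<^esub> \<phi> i) I"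

definition compact_object :: "'k rel \<Rightarrow> ('o, 'm, 'z) preadd_data_scheme \<Rightarrow> 'o \<Rightarrow> bool"
  where "compact_object \<kappa> C P \<longleftrightarrow> P \<in> Obj C \<and>
    (\<forall>(I :: 'k set) M S \<iota>. small \<kappa> I \<and> is_coproduct C I M S \<iota> \<longrightarrow>
       bij_betw (coproduct_comparison C P I S \<iota>)
         (carrier (sum_group I (\<lambda>i. hom_group C P (M i)))) (Hom C P S))"

text \<open>In the next definition \<open>h\<close> is the morphism \<open>\<Coprod>\<^sub>i f\<^sub>i\<close> induced on the coproducts.\<close>

definition preserves_coproduct_surjections ::
    "('o, 'm, 'z) preadd_data_scheme \<Rightarrow> 'o \<Rightarrow> 'i set \<Rightarrow> bool"
  where "preserves_coproduct_surjections C P I \<longleftrightarrow>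
    (\<forall>M N f S \<iota> S' \<iota>' h.
       (\<forall>i\<in>I. f i \<in> Hom C (M i) (N i)) \<and>
       is_coproduct C I M S \<iota> \<and> is_coproduct C I N S' \<iota>' \<and>
       h \<in> Hom C S S' \<and> (\<forall>i\<in>I. h \<odot>\<^bsub>C\<^esub> \<iota> i = \<iota>' i \<odot>\<^bsub>C\<^esub> f i) \<and>
       (\<forall>i\<in>I. (\<lambda>u. f i \<odot>\<^bsub>C\<^esub> u) ` Hom C P (M i) = Hom C P (N i)) \<longrightarrow>
       (\<lambda>u. h \<odot>\<^bsub>C\<^esub> u) ` Hom C P S = Hom C P S')"

text \<open>Up to reindexing, the countable families are those indexed by the subsets of \<open>nat\<close>.\<close>

definition perfect :: "('o, 'm, 'z) preadd_data_scheme \<Rightarrow> 'o \<Rightarrow> bool"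
  where "perfect C P \<longleftrightarrow> P \<in> Obj C \<and> (\<forall>I :: nat set. preserves_coproduct_surjections C P I)"

definition superperfect :: "'k rel \<Rightarrow> ('o, 'm, 'z) preadd_data_scheme \<Rightarrow> 'o \<Rightarrow> bool"
  where "superperfect \<kappa> C P \<longleftrightarrow> P \<in> Obj C \<and>
    (\<forall>I :: 'k set. small \<kappa> I \<longrightarrow> preserves_coproduct_surjections C P I)"

text \<open>A triple \<open>(f, g, h)\<close> in \<open>Tri\<close> stands for the distinguished triangle
  \<open>X \<rightarrow> Y \<rightarrow> Z \<rightarrow> X[1]\<close>; the objects are recovered from the morphisms.\<close>

record ('o, 'm) tri_data = "('o, 'm) preadd_data" +
  ShO :: "'o \<Rightarrow> 'o"
  ShM :: "'m \<Rightarrow> 'm"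
  Tri :: "('m \<times> 'm \<times> 'm) set"

definition candidate_triangle ::
    "('o, 'm, 'z) tri_data_scheme \<Rightarrow> 'o \<Rightarrow> 'o \<Rightarrow> 'o \<Rightarrow> 'm \<Rightarrow> 'm \<Rightarrow> 'm \<Rightarrow> bool"
  where "candidate_triangle D X Y Z f g h \<longleftrightarrow>
    f \<in> Hom D X Y \<and> g \<in> Hom D Y Z \<and> h \<in> Hom D Z (ShO D X)"

definition distinguished ::
    "('o, 'm, 'z) tri_data_scheme \<Rightarrow> 'o \<Rightarrow> 'o \<Rightarrow> 'o \<Rightarrow> 'm \<Rightarrow> 'm \<Rightarrow> 'm \<Rightarrow> bool"
  where "distinguished D X Y Z f g h \<longleftrightarrow> candidate_triangle D X Y Z f g h \<and> (f, g, h) \<in> Tri D"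

text \<open>The shift is an additive autoequivalence, not necessarily a strict automorphism.\<close>

locale triangulated_category = additive_category D
  for D :: "('o, 'm, 'z) tri_data_scheme" (structure) +
  assumes shift_obj: "X \<in> Obj D \<Longrightarrow> ShO D X \<in> Obj D"
    and shift_ident: "X \<in> Obj D \<Longrightarrow> ShM D (Ident D X) = Ident D (ShO D X)"
    and shift_comp: "\<lbrakk>f \<in> Hom D X Y; g \<in> Hom D Y Z\<rbrakk> \<Longrightarrow> ShM D (g \<odot> f) = ShM D g \<odot> ShM D f"
    and shift_plus: "\<lbrakk>f \<in> Hom D X Y; f' \<in> Hom D X Y\<rbrakk>
                      \<Longrightarrow> ShM D (Plus D f f') = Plus D (ShM D f) (ShM D f')"
    and shift_fully_faithful: "\<lbrakk>X \<in> Obj D; Y \<in> Obj D\<rbrakk>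
                      \<Longrightarrow> bij_betw (ShM D) (Hom D X Y) (Hom D (ShO D X) (ShO D Y))"
    and shift_ess_surj: "Y \<in> Obj D \<Longrightarrow> \<exists>X\<in>Obj D. isomorphic D (ShO D X) Y"
    and tri_candidate: "(f, g, h) \<in> Tri D \<Longrightarrow> \<exists>X Y Z. candidate_triangle D X Y Z f g h"
    and tri_iso: "\<lbrakk>distinguished D X Y Z f g h; candidate_triangle D X' Y' Z' f' g' h';
                   isomorphism D a X X'; isomorphism D b Y Y'; isomorphism D c Z Z';
                   b \<odot> f = f' \<odot> a; c \<odot> g = g' \<odot> b; ShM D a \<odot> h = h' \<odot> c\<rbrakk>
                  \<Longrightarrow> distinguished D X' Y' Z' f' g' h'"
    and tri_ident: "\<lbrakk>X \<in> Obj D; zero_object D Z\<rbrakk>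
                  \<Longrightarrow> distinguished D X X Z (Ident D X) (Zero D X Z) (Zero D Z (ShO D X))"
    and tri_cone: "f \<in> Hom D X Y \<Longrightarrow> \<exists>Z g h. distinguished D X Y Z f g h"
    and tri_rotate: "candidate_triangle D X Y Z f g h
                  \<Longrightarrow> distinguished D X Y Z f g h
                      \<longleftrightarrow> distinguished D Y Z (ShO D X) g h (Minus D (ShM D f))"
    and tri_fill: "\<lbrakk>distinguished D X Y Z f g h; distinguished D X' Y' Z' f' g' h';
                   a \<in> Hom D X X'; b \<in> Hom D Y Y'; b \<odot> f = f' \<odot> a\<rbrakk>
                  \<Longrightarrow> \<exists>c\<in>Hom D Z Z'. c \<odot> g = g' \<odot> b \<and> ShM D a \<odot> h = h' \<odot> c"
    and tri_octahedron: "\<lbrakk>distinguished D X Y Z' f i i'; distinguished D Y Z X' g j j';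
                   distinguished D X Z Y' (g \<odot> f) k k'\<rbrakk>
                  \<Longrightarrow> \<exists>u v. distinguished D Z' Y' X' u v (ShM D i \<odot> j') \<and>
                        u \<odot> i = k \<odot> g \<and> k' \<odot> u = i' \<and>
                        v \<odot> k = j \<and> j' \<odot> v = ShM D f \<odot> k'"

text \<open>The objects isomorphic to \<open>P[n]\<close> for some integer \<open>n\<close>. As the shift is only an equivalence,
  \<open>P[-n]\<close> is determined up to isomorphism, by \<open>P[-n][n] \<cong> P\<close>.\<close>

definition shifts :: "('o, 'm, 'z) tri_data_scheme \<Rightarrow> 'o \<Rightarrow> 'o set"
  where "shifts D P = {Q \<in> Obj D. \<exists>n::nat.
    isomorphic D Q ((ShO D ^^ n) P) \<or> isomorphic D ((ShO D ^^ n) Q) P}"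

text \<open>Full subcategories of \<open>D\<close> are given by their classes of objects. Triangulated subcategories are
  strict, i.e. closed under isomorphism.\<close>

definition triangulated_subcategory :: "('o, 'm, 'z) tri_data_scheme \<Rightarrow> 'o set \<Rightarrow> bool"
  where "triangulated_subcategory D U \<longleftrightarrow> U \<subseteq> Obj D \<and>
    (\<forall>Z. zero_object D Z \<longrightarrow> Z \<in> U) \<and>
    (\<forall>X Y. isomorphic D X Y \<and> X \<in> U \<longrightarrow> Y \<in> U) \<and>
    (\<forall>X\<in>Obj D. ShO D X \<in> U \<longleftrightarrow> X \<in> U) \<and>
    (\<forall>X Y Z f g h. distinguished D X Y Z f g h \<and> X \<in> U \<and> Y \<in> U \<longrightarrow> Z \<in> U)"

definition Tria :: "'k rel \<Rightarrow> ('o, 'm, 'z) tri_data_scheme \<Rightarrow> 'o \<Rightarrow> 'o set"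
  where "Tria \<kappa> D P =
    \<Inter>{U. triangulated_subcategory D U \<and> closed_under_small_coproducts \<kappa> D U \<and> P \<in> U}"

definition perp :: "('o, 'm, 'z) preadd_data_scheme \<Rightarrow> 'o set \<Rightarrow> 'o set"
  where "perp C Q = {M \<in> Obj C. \<forall>X\<in>Q. Hom C X M = {Zero C X M}}"

end

theory Submission
  imports Defs
begin

text \<open>
  For every coproduct the comparison map \<open>\<Oplus>\<^sub>i D(P, M\<^sub>i) \<rightarrow> D(P, \<Coprod>\<^sub>i M\<^sub>i)\<close> is injective, because a coproduct in a
  preadditive category has projections. So \<open>P\<close> is compact iff every morphism \<open>P \<rightarrow> \<Coprod>\<^sub>i M\<^sub>i\<close> is a finite sum of
  morphisms through summands (\<open>compact_object_iff_finitary\<close>). The same holds for compactness in a full subcategory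
  closed under small coproducts (\<open>compact_object_full_iff_finitary\<close>), with the summands restricted to it. All the
  conditions thus become statements about one predicate, \<open>finitary\<close>.

  If \<open>P\<close> is compact, it is compact in every full subcategory closed under coproducts that contains it, and finite sums
  lift along coproducts of surjections, so \<open>P\<close> is superperfect. All shifts of \<open>P\<close> are compact too, and
  \<open>Tria(P)\<^sup>\<bottom>\<close> is detected by them (\<open>perp_Tria\<close>), so it is closed under small coproducts.

  The converse implications rest on covers: as \<open>D\<close> is locally small, each object \<open>M\<close> is the target of a morphism from
  a coproduct \<open>T\<close> of shifts of \<open>P\<close> that is surjective on \<open>D(Q, ?)\<close> for every shift \<open>Q\<close> (\<open>ex_cover\<close>). If \<open>P\<close> is
  superperfect, a morphism \<open>P \<rightarrow> \<Coprod>\<^sub>i M\<^sub>i\<close> lifts to the coproduct of the covers, where compactness in \<open>Sum\<close> makes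
  it a finite sum. A perfect object allows the same argument for countable families.

  If \<open>P\<close> is compact in \<open>Tria(P)\<close>, iterated covers produce for each \<open>M\<close> a triangle \<open>X \<rightarrow> M \<rightarrow> Y \<rightarrow> X[1]\<close> with \<open>X\<close> in
  \<open>Tria(P)\<close> and \<open>Y\<close> in \<open>Tria(P)\<^sup>\<bottom>\<close> (\<open>approximation_triangle\<close>). As \<open>\<Coprod>\<^sub>i Y\<^sub>i\<close> is orthogonal to \<open>P\<close>, morphisms
  \<open>P \<rightarrow> \<Coprod>\<^sub>i M\<^sub>i\<close> lift to \<open>\<Coprod>\<^sub>i X\<^sub>i\<close>.

  If \<open>P\<close> is only perfect and compact in \<open>Sum\<close>, it is known to be compact for countable coproducts. One then repeatedly
  passes from \<open>M\<close> to the cone of a cover, which kills all morphisms from shifts of \<open>P\<close>; the homotopy colimit of this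
  sequence is in \<open>Tria(P)\<^sup>\<bottom>\<close>. Taking coproducts over a small family keeps it there, so a morphism
  \<open>P \<rightarrow> \<Coprod>\<^sub>i M\<^sub>i\<close> becomes zero after finitely many steps, and each step undone contributes only morphisms through
  coproducts of shifts (\<open>countably_finitary_imp_finitary\<close>).
\<close>

section \<open>Preadditive categories\<close>

lemma hom_group_simps [simp]:
  "carrier (hom_group C X Y) = Hom C X Y"
  "monoid.mult (hom_group C X Y) = Plus C"
  "one (hom_group C X Y) = Zero C X Y"
  by (simp_all add: hom_group_def)

context preadditive_category
begin

lemma hom_obj:
  assumes "f \<in> Hom C X Y"
  shows "X \<in> Obj C" "Y \<in> Obj C"
  using assms arr_obj by (auto simp: Hom_def)

lemma hom_comm_group': "f \<in> Hom C X Y \<Longrightarrow> comm_group (hom_group C X Y)"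
  using hom_comm_group hom_obj by blast

lemma zero_hom: "X \<in> Obj C \<Longrightarrow> Y \<in> Obj C \<Longrightarrow> Zero C X Y \<in> Hom C X Y"
  using monoid.one_closed[OF group.is_monoid[OF comm_group.axioms(2)[OF hom_comm_group]]] by simp

lemma plus_hom: "f \<in> Hom C X Y \<Longrightarrow> g \<in> Hom C X Y \<Longrightarrow> Plus C f g \<in> Hom C X Y"
  using monoid.m_closed[OF group.is_monoid[OF comm_group.axioms(2)[OF hom_comm_group']]] by force

lemma minus_eq_inv: "f \<in> Hom C X Y \<Longrightarrow> Minus C f = inv\<^bsub>hom_group C X Y\<^esub> f"
  by (auto simp: Minus_def Hom_def)

lemma minus_hom: "f \<in> Hom C X Y \<Longrightarrow> Minus C f \<in> Hom C X Y"
  using group.inv_closed[OF comm_group.axioms(2)[OF hom_comm_group'], of f X Y f]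
  by (simp add: minus_eq_inv)

lemma plus_assoc:
  "\<lbrakk>f \<in> Hom C X Y; g \<in> Hom C X Y; h \<in> Hom C X Y\<rbrakk>
    \<Longrightarrow> Plus C (Plus C f g) h = Plus C f (Plus C g h)"
  using monoid.m_assoc[OF group.is_monoid[OF comm_group.axioms(2)[OF hom_comm_group']], of f X Y f g h]
  by simp

lemma plus_commute:
  "\<lbrakk>f \<in> Hom C X Y; g \<in> Hom C X Y\<rbrakk> \<Longrightarrow> Plus C f g = Plus C g f"
  using comm_monoid.m_comm[OF comm_group.axioms(1)[OF hom_comm_group'], of f X Y f g] by simp

lemma zero_plus: "f \<in> Hom C X Y \<Longrightarrow> Plus C (Zero C X Y) f = f"
  using monoid.l_one[OF group.is_monoid[OF comm_group.axioms(2)[OF hom_comm_group']], of f X Y f]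
  by simp

lemma plus_zero: "f \<in> Hom C X Y \<Longrightarrow> Plus C f (Zero C X Y) = f"
  using monoid.r_one[OF group.is_monoid[OF comm_group.axioms(2)[OF hom_comm_group']], of f X Y f]
  by simp

lemma plus_minus: "f \<in> Hom C X Y \<Longrightarrow> Plus C f (Minus C f) = Zero C X Y"
  using group.r_inv[OF comm_group.axioms(2)[OF hom_comm_group'], of f X Y f]
  by (simp add: minus_eq_inv)

lemma plus_eq_self_imp_zero:
  assumes "f \<in> Hom C X Y" "g \<in> Hom C X Y" "Plus C f g = f"
  shows "g = Zero C X Y"
proof -
  have "Zero C X Y = Plus C (Plus C f g) (Minus C f)"
    using assms by (simp add: plus_minus)
  also have "\<dots> = Plus C (Plus C g f) (Minus C f)"
    using assms plus_commute by simp
  also have "\<dots> = g"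
    using assms minus_hom by (simp add: plus_assoc plus_minus plus_zero)
  finally show ?thesis ..
qed

lemma eq_if_plus_minus_zero:
  assumes f: "f \<in> Hom C X Y" and g: "g \<in> Hom C X Y" and 0: "Plus C f (Minus C g) = Zero C X Y"
  shows "f = g"
proof -
  have "f = Plus C f (Plus C g (Minus C g))"
    using f g by (simp add: plus_minus plus_zero)
  also have "\<dots> = Plus C (Plus C f (Minus C g)) g"
    using f g minus_hom[OF g] by (simp add: plus_assoc plus_commute)
  also have "\<dots> = g"
    using g 0 by (simp add: zero_plus)
  finally show ?thesis .
qed

lemma minus_zero: "X \<in> Obj C \<Longrightarrow> Y \<in> Obj C \<Longrightarrow> Minus C (Zero C X Y) = Zero C X Y"
  using plus_minus[of "Zero C X Y"] zero_plus[OF minus_hom] zero_hom by metis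

lemma minus_minus: "f \<in> Hom C X Y \<Longrightarrow> Minus C (Minus C f) = f"
  using group.inv_inv[OF comm_group.axioms(2)[OF hom_comm_group'], of f X Y f]
    minus_eq_inv[OF minus_hom]
  by (simp add: minus_eq_inv)

lemma comp_zero:
  assumes g: "g \<in> Hom C Y Z" and X: "X \<in> Obj C"
  shows "g \<odot> Zero C X Y = Zero C X Z"
proof -
  have z: "Zero C X Y \<in> Hom C X Y" using zero_hom X hom_obj g by blast
  have "Plus C (g \<odot> Zero C X Y) (g \<odot> Zero C X Y) = g \<odot> Zero C X Y"
    using comp_plus[OF z z g] zero_plus[OF z] by simp
  then show ?thesis using plus_eq_self_imp_zero comp_hom[OF z g] by blast
qed

lemma zero_comp:
  assumes f: "f \<in> Hom C X Y" and Z: "Z \<in> Obj C"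
  shows "Zero C Y Z \<odot> f = Zero C X Z"
proof -
  have z: "Zero C Y Z \<in> Hom C Y Z" using zero_hom Z hom_obj f by blast
  have "Plus C (Zero C Y Z \<odot> f) (Zero C Y Z \<odot> f) = Zero C Y Z \<odot> f"
    using plus_comp[OF f z z] zero_plus[OF z] by simp
  then show ?thesis using plus_eq_self_imp_zero comp_hom[OF f z] by blast
qed

lemma minus_unique:
  assumes "f \<in> Hom C X Y" "g \<in> Hom C X Y" "Plus C f g = Zero C X Y"
  shows "g = Minus C f"
proof -
  have "Minus C f = Plus C (Minus C f) (Plus C f g)"
    using assms plus_zero[OF minus_hom] by simp
  also have "\<dots> = Plus C (Plus C f (Minus C f)) g"
    using assms minus_hom[of f X Y] plus_assoc plus_commute by metis
  also have "\<dots> = g" using assms plus_minus zero_plus by simp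
  finally show ?thesis ..
qed

lemma comp_minus:
  assumes f: "f \<in> Hom C X Y" and g: "g \<in> Hom C Y Z"
  shows "g \<odot> Minus C f = Minus C (g \<odot> f)"
proof (rule minus_unique)
  show "Plus C (g \<odot> f) (g \<odot> Minus C f) = Zero C X Z"
    using comp_plus[OF f minus_hom[OF f] g] plus_minus[OF f] comp_zero[OF g] hom_obj[OF f] by simp
qed (use f g minus_hom comp_hom in blast)+

lemma minus_comp:
  assumes f: "f \<in> Hom C X Y" and g: "g \<in> Hom C Y Z"
  shows "Minus C g \<odot> f = Minus C (g \<odot> f)"
proof (rule minus_unique)
  show "Plus C (g \<odot> f) (Minus C g \<odot> f) = Zero C X Z"
    using plus_comp[OF f g minus_hom[OF g]] plus_minus[OF g] zero_comp[OF f] hom_obj[OF g] by simp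
qed (use f g minus_hom comp_hom in blast)+

lemma sub_comp:
  "\<lbrakk>f \<in> Hom C X Y; g \<in> Hom C Y Z; g' \<in> Hom C Y Z\<rbrakk>
    \<Longrightarrow> Plus C g (Minus C g') \<odot> f = Plus C (g \<odot> f) (Minus C (g' \<odot> f))"
  by (simp add: plus_comp minus_comp minus_hom)

lemma comp_sub:
  "\<lbrakk>f \<in> Hom C X Y; f' \<in> Hom C X Y; g \<in> Hom C Y Z\<rbrakk>
    \<Longrightarrow> g \<odot> Plus C f (Minus C f') = Plus C (g \<odot> f) (Minus C (g \<odot> f'))"
  by (simp add: comp_plus comp_minus minus_hom)

lemma sub_zero: "f \<in> Hom C X Y \<Longrightarrow> Plus C f (Minus C (Zero C X Y)) = f"
  using minus_zero plus_zero hom_obj by metis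

lemma isomorphismE:
  assumes "isomorphism C f X Y"
  obtains g where "f \<in> Hom C X Y" "g \<in> Hom C Y X" "g \<odot> f = Ident C X" "f \<odot> g = Ident C Y"
  using assms by (auto simp: isomorphism_def)

lemma isomorphismI:
  assumes "f \<in> Hom C X Y" "g \<in> Hom C Y X" "g \<odot> f = Ident C X" "f \<odot> g = Ident C Y"
  shows "isomorphism C f X Y"
  using assms hom_obj by (auto simp: isomorphism_def)

lemma isomorphicE:
  assumes "isomorphic C X Y"
  obtains f g where "f \<in> Hom C X Y" "g \<in> Hom C Y X" "g \<odot> f = Ident C X" "f \<odot> g = Ident C Y"
  using assms by (auto simp: isomorphic_def elim: isomorphismE)

lemma isomorphicI:
  assumes "f \<in> Hom C X Y" "g \<in> Hom C Y X" "g \<odot> f = Ident C X" "f \<odot> g = Ident C Y"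
  shows "isomorphic C X Y"
  using isomorphismI[OF assms] by (auto simp: isomorphic_def)

lemma isomorphic_obj: "isomorphic C X Y \<Longrightarrow> X \<in> Obj C \<and> Y \<in> Obj C"
  by (auto simp: isomorphic_def isomorphism_def)

lemma isomorphic_refl: "X \<in> Obj C \<Longrightarrow> isomorphic C X X"
  by (rule isomorphicI[of "Ident C X" X X "Ident C X"]) (auto intro: ident_hom comp_ident)

lemma isomorphic_sym: "isomorphic C X Y \<Longrightarrow> isomorphic C Y X"
  by (meson isomorphicE isomorphicI)

lemma cancel_left:
  assumes "a \<in> Hom C W X" "f \<in> Hom C X Y" "g \<in> Hom C Y X" "g \<odot> f = Ident C X"
  shows "g \<odot> (f \<odot> a) = a"
  using assms comp_assoc[of a W X f Y g X] ident_comp by simp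

lemma cancel_right:
  assumes "a \<in> Hom C Y Z" "f \<in> Hom C X Y" "g \<in> Hom C Y X" "f \<odot> g = Ident C Y"
  shows "(a \<odot> f) \<odot> g = a"
  using assms comp_assoc[of g Y X f Y a Z] comp_ident by simp

lemma isomorphic_trans:
  assumes "isomorphic C X Y" "isomorphic C Y Z"
  shows "isomorphic C X Z"
proof -
  obtain f g where f: "f \<in> Hom C X Y" "g \<in> Hom C Y X" "g \<odot> f = Ident C X" "f \<odot> g = Ident C Y"
    using assms(1) by (rule isomorphicE)
  obtain f' g' where f': "f' \<in> Hom C Y Z" "g' \<in> Hom C Z Y" "g' \<odot> f' = Ident C Y" "f' \<odot> g' = Ident C Z"
    using assms(2) by (rule isomorphicE)
  have "(g \<odot> g') \<odot> (f' \<odot> f) = g \<odot> (g' \<odot> (f' \<odot> f))"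
    by (rule comp_assoc[OF comp_hom[OF f(1) f'(1)] f'(2) f(2)])
  moreover have "(f' \<odot> f) \<odot> (g \<odot> g') = f' \<odot> (f \<odot> (g \<odot> g'))"
    by (rule comp_assoc[OF comp_hom[OF f'(2) f(2)] f(1) f'(1)])
  ultimately show ?thesis
    using f f' cancel_left[OF f(1) f'(1-3)] cancel_left[OF f'(2) f(2,1,4)]
    by (intro isomorphicI[OF comp_hom[OF f(1) f'(1)] comp_hom[OF f'(2) f(2)]]) auto
qed

end

section \<open>Coproducts\<close>

context preadditive_category
begin

lemma coproduct_obj: "is_coproduct C I M S \<iota> \<Longrightarrow> S \<in> Obj C"
  by (simp add: is_coproduct_def)

lemma coproduct_summand_obj: "is_coproduct C I M S \<iota> \<Longrightarrow> i \<in> I \<Longrightarrow> M i \<in> Obj C"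
  by (simp add: is_coproduct_def)

lemma coproduct_inj: "is_coproduct C I M S \<iota> \<Longrightarrow> i \<in> I \<Longrightarrow> \<iota> i \<in> Hom C (M i) S"
  by (simp add: is_coproduct_def)

lemma coproduct_copair:
  assumes "is_coproduct C I M S \<iota>" "X \<in> Obj C" "\<And>i. i \<in> I \<Longrightarrow> \<phi> i \<in> Hom C (M i) X"
  obtains h where "h \<in> Hom C S X" "\<And>i. i \<in> I \<Longrightarrow> h \<odot> \<iota> i = \<phi> i"
proof -
  have "\<exists>!h. h \<in> Hom C S X \<and> (\<forall>i\<in>I. h \<odot> \<iota> i = \<phi> i)"
    using assms by (simp add: is_coproduct_def)
  then obtain h where "h \<in> Hom C S X \<and> (\<forall>i\<in>I. h \<odot> \<iota> i = \<phi> i)"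
    by (rule ex1E)
  then show thesis by (intro that[of h]) simp_all
qed

lemma coproduct_eqI:
  assumes "is_coproduct C I M S \<iota>" "h \<in> Hom C S X" "h' \<in> Hom C S X"
    "\<And>i. i \<in> I \<Longrightarrow> h \<odot> \<iota> i = h' \<odot> \<iota> i"
  shows "h = h'"
proof -
  have "\<forall>i\<in>I. h' \<odot> \<iota> i \<in> Hom C (M i) X"
    using comp_hom[OF coproduct_inj[OF assms(1)] assms(3)] by blast
  then have "\<exists>!k. k \<in> Hom C S X \<and> (\<forall>i\<in>I. k \<odot> \<iota> i = h' \<odot> \<iota> i)"
    using assms(1) hom_obj[OF assms(3)] by (simp add: is_coproduct_def)
  then show ?thesis by (rule ex1E) (metis assms(2-4))
qed

lemma coproductI:
  assumes "S \<in> Obj C" "\<And>i. i \<in> I \<Longrightarrow> \<iota> i \<in> Hom C (M i) S"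
    and "\<And>X \<phi>. X \<in> Obj C \<Longrightarrow> (\<And>i. i \<in> I \<Longrightarrow> \<phi> i \<in> Hom C (M i) X)
           \<Longrightarrow> \<exists>h\<in>Hom C S X. \<forall>i\<in>I. h \<odot> \<iota> i = \<phi> i"
    and "\<And>X h h'. h \<in> Hom C S X \<Longrightarrow> h' \<in> Hom C S X \<Longrightarrow> (\<And>i. i \<in> I \<Longrightarrow> h \<odot> \<iota> i = h' \<odot> \<iota> i)
           \<Longrightarrow> h = h'"
  shows "is_coproduct C I M S \<iota>"
  unfolding is_coproduct_def
proof (intro conjI ballI allI impI)
  fix X \<phi> assume X: "X \<in> Obj C" and \<phi>: "\<forall>i\<in>I. \<phi> i \<in> Hom C (M i) X"
  then obtain h where "h \<in> Hom C S X" "\<forall>i\<in>I. h \<odot> \<iota> i = \<phi> i"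
    using assms(3)[OF X, of \<phi>] by blast
  then show "\<exists>!h. h \<in> Hom C S X \<and> (\<forall>i\<in>I. h \<odot> \<iota> i = \<phi> i)"
    using assms(4) by (intro ex1I[of _ h]) auto
qed (use assms(1,2) hom_obj in auto)

lemma coproduct_projections:
  assumes S: "is_coproduct C I M S \<iota>"
  obtains \<pi> where "\<And>j. j \<in> I \<Longrightarrow> \<pi> j \<in> Hom C S (M j)"
    and "\<And>j. j \<in> I \<Longrightarrow> \<pi> j \<odot> \<iota> j = Ident C (M j)"
    and "\<And>i j. i \<in> I \<Longrightarrow> j \<in> I \<Longrightarrow> i \<noteq> j \<Longrightarrow> \<pi> j \<odot> \<iota> i = Zero C (M i) (M j)"
proof -
  have "\<exists>p. p \<in> Hom C S (M j) \<and> p \<odot> \<iota> j = Ident C (M j)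
          \<and> (\<forall>i\<in>I. i \<noteq> j \<longrightarrow> p \<odot> \<iota> i = Zero C (M i) (M j))" if j: "j \<in> I" for j
  proof -
    obtain p where "p \<in> Hom C S (M j)"
      "\<And>i. i \<in> I \<Longrightarrow> p \<odot> \<iota> i = (if i = j then Ident C (M j) else Zero C (M i) (M j))"
      by (rule coproduct_copair[OF S, of "M j" "\<lambda>i. if i = j then Ident C (M j) else Zero C (M i) (M j)"])
        (use j coproduct_summand_obj[OF S] zero_hom ident_hom in auto)
    then show ?thesis using j by auto
  qed
  then have "\<forall>j\<in>I. \<exists>p. p \<in> Hom C S (M j) \<and> p \<odot> \<iota> j = Ident C (M j)
          \<and> (\<forall>i\<in>I. i \<noteq> j \<longrightarrow> p \<odot> \<iota> i = Zero C (M i) (M j))" by blast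
  then obtain \<pi> where "\<forall>j\<in>I. \<pi> j \<in> Hom C S (M j) \<and> \<pi> j \<odot> \<iota> j = Ident C (M j)
          \<and> (\<forall>i\<in>I. i \<noteq> j \<longrightarrow> \<pi> j \<odot> \<iota> i = Zero C (M i) (M j))"
    by (rule bchoice[THEN exE])
  then show thesis by (intro that) auto
qed

lemma coproduct_cong:
  assumes "is_coproduct C I M S \<iota>" "\<And>i. i \<in> I \<Longrightarrow> M' i = M i" "\<And>i. i \<in> I \<Longrightarrow> \<iota>' i = \<iota> i"
  shows "is_coproduct C I M' S \<iota>'"
  using assms by (auto simp: is_coproduct_def)

lemma coproduct_reindex:
  assumes \<sigma>: "bij_betw \<sigma> J I"
  shows "is_coproduct C J (M \<circ> \<sigma>) S (\<iota> \<circ> \<sigma>) \<longleftrightarrow> is_coproduct C I M S \<iota>"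
proof -
  have im: "I = \<sigma> ` J" using \<sigma> by (simp add: bij_betw_def)
  let ?\<tau> = "inv_into J \<sigma>"
  have \<tau>: "\<And>j. j \<in> J \<Longrightarrow> ?\<tau> (\<sigma> j) = j"
    using \<sigma> by (simp add: bij_betw_def inv_into_f_f)
  have "(\<forall>\<phi>. (\<forall>j\<in>J. \<phi> j \<in> Hom C (M (\<sigma> j)) X) \<longrightarrow> (\<exists>!h. h \<in> Hom C S X \<and> (\<forall>j\<in>J. h \<odot> \<iota> (\<sigma> j) = \<phi> j)))
     \<longleftrightarrow> (\<forall>\<phi>. (\<forall>i\<in>I. \<phi> i \<in> Hom C (M i) X) \<longrightarrow> (\<exists>!h. h \<in> Hom C S X \<and> (\<forall>i\<in>I. h \<odot> \<iota> i = \<phi> i)))"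
    (is "(\<forall>\<phi>. ?L \<phi>) \<longleftrightarrow> (\<forall>\<phi>. ?R \<phi>)") for X
  proof
    assume "\<forall>\<phi>. ?L \<phi>"
    then have "?L (\<phi> \<circ> \<sigma>)" for \<phi> by blast
    then show "\<forall>\<phi>. ?R \<phi>" by (simp add: im)
  next
    assume "\<forall>\<phi>. ?R \<phi>"
    then have "?R (\<phi> \<circ> ?\<tau>)" for \<phi> by blast
    then show "\<forall>\<phi>. ?L \<phi>" by (simp add: im \<tau>)
  qed
  then show ?thesis unfolding is_coproduct_def by (simp add: im)
qed

lemma coproduct_singleton: "X \<in> Obj C \<Longrightarrow> is_coproduct C {i} (\<lambda>_. X) X (\<lambda>_. Ident C X)"
  by (rule coproductI) (auto intro: ident_hom simp: comp_ident)

lemma coproduct_change_summands: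
  assumes S: "is_coproduct C I M S \<iota>"
    and a: "\<And>i. i \<in> I \<Longrightarrow> isomorphism C (a i) (M' i) (M i)"
  shows "is_coproduct C I M' S (\<lambda>i. \<iota> i \<odot> a i)"
proof -
  have "\<forall>i\<in>I. \<exists>b. a i \<in> Hom C (M' i) (M i) \<and> b \<in> Hom C (M i) (M' i)
          \<and> b \<odot> a i = Ident C (M' i) \<and> a i \<odot> b = Ident C (M i)"
    using a by (meson isomorphismE)
  then obtain b where *: "\<forall>i\<in>I. a i \<in> Hom C (M' i) (M i) \<and> b i \<in> Hom C (M i) (M' i)
          \<and> b i \<odot> a i = Ident C (M' i) \<and> a i \<odot> b i = Ident C (M i)"
    by (rule bchoice[THEN exE])
  note \<iota> = coproduct_inj[OF S]
  show ?thesis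
  proof (rule coproductI)
    fix X \<phi> assume X: "X \<in> Obj C" and \<phi>: "\<And>i. i \<in> I \<Longrightarrow> \<phi> i \<in> Hom C (M' i) X"
    obtain h where h: "h \<in> Hom C S X" "\<And>i. i \<in> I \<Longrightarrow> h \<odot> \<iota> i = \<phi> i \<odot> b i"
      by (rule coproduct_copair[OF S X, of "\<lambda>i. \<phi> i \<odot> b i"]) (use comp_hom[OF _ \<phi>] * in \<open>auto intro: sym\<close>)
    have "h \<odot> (\<iota> i \<odot> a i) = \<phi> i" if i: "i \<in> I" for i
    proof -
      have "h \<odot> (\<iota> i \<odot> a i) = (\<phi> i \<odot> b i) \<odot> a i"
        using comp_assoc[of "a i" _ _ "\<iota> i" S h X] h i * \<iota>[OF i] by auto
      then show ?thesis using cancel_right[OF \<phi>[OF i], of "b i" "M i" "a i"] * i by auto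
    qed
    then show "\<exists>h\<in>Hom C S X. \<forall>i\<in>I. h \<odot> (\<iota> i \<odot> a i) = \<phi> i" using h by blast
  next
    fix X h h' assume h: "h \<in> Hom C S X" "h' \<in> Hom C S X"
      and eq: "\<And>i. i \<in> I \<Longrightarrow> h \<odot> (\<iota> i \<odot> a i) = h' \<odot> (\<iota> i \<odot> a i)"
    show "h = h'"
    proof (rule coproduct_eqI[OF S h])
      fix i assume i: "i \<in> I"
      have "(k \<odot> (\<iota> i \<odot> a i)) \<odot> b i = k \<odot> \<iota> i" if "k \<in> Hom C S X" for k
        using comp_assoc[of "a i" _ _ "\<iota> i" S k X] that i * \<iota>[OF i]
          cancel_right[OF comp_hom[OF \<iota>[OF i] that], of "a i" "M' i" "b i"] by auto
      then show "h \<odot> \<iota> i = h' \<odot> \<iota> i" using h eq[OF i] by metis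
    qed
  qed (use * comp_hom[OF _ \<iota>] coproduct_obj[OF S] in auto)
qed

lemma coproduct_change_vertex:
  assumes S: "is_coproduct C I M S \<iota>" and b: "isomorphism C b S S'"
  shows "is_coproduct C I M S' (\<lambda>i. b \<odot> \<iota> i)"
proof -
  obtain c where bc: "b \<in> Hom C S S'" "c \<in> Hom C S' S" "c \<odot> b = Ident C S" "b \<odot> c = Ident C S'"
    using b by (rule isomorphismE)
  note \<iota> = coproduct_inj[OF S]
  have eq: "k \<odot> (b \<odot> \<iota> i) = (k \<odot> b) \<odot> \<iota> i" if "k \<in> Hom C S' X" "i \<in> I" for k X i
    using comp_assoc[OF \<iota>[OF that(2)] bc(1) that(1)] by simp
  show ?thesis
  proof (rule coproductI)
    fix X \<phi> assume X: "X \<in> Obj C" and \<phi>: "\<And>i. i \<in> I \<Longrightarrow> \<phi> i \<in> Hom C (M i) X"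
    obtain h where h: "h \<in> Hom C S X" "\<And>i. i \<in> I \<Longrightarrow> h \<odot> \<iota> i = \<phi> i"
      using coproduct_copair[OF S X \<phi>] by blast
    have "(h \<odot> c) \<odot> (b \<odot> \<iota> i) = \<phi> i" if i: "i \<in> I" for i
      using eq[OF comp_hom[OF bc(2) h(1)] i] cancel_right[OF h(1) bc(2,1,3)] h(2)[OF i] by simp
    then show "\<exists>h\<in>Hom C S' X. \<forall>i\<in>I. h \<odot> (b \<odot> \<iota> i) = \<phi> i"
      using comp_hom[OF bc(2) h(1)] by blast
  next
    fix X h h' assume h: "h \<in> Hom C S' X" "h' \<in> Hom C S' X"
      and "\<And>i. i \<in> I \<Longrightarrow> h \<odot> (b \<odot> \<iota> i) = h' \<odot> (b \<odot> \<iota> i)"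
    then have "h \<odot> b = h' \<odot> b"
      by (intro coproduct_eqI[OF S comp_hom[OF bc(1) h(1)] comp_hom[OF bc(1) h(2)]]) (simp add: eq)
    then show "h = h'" using cancel_right[OF h(1) bc(1,2,4)] cancel_right[OF h(2) bc(1,2,4)] by metis
  qed (use hom_obj[OF bc(1)] comp_hom[OF \<iota> bc(1)] in auto)
qed

lemma coproduct_unique:
  assumes S: "is_coproduct C I M S \<iota>" and S': "is_coproduct C I M S' \<iota>'"
  obtains b where "isomorphism C b S S'" "\<And>i. i \<in> I \<Longrightarrow> b \<odot> \<iota> i = \<iota>' i"
proof -
  obtain b where b: "b \<in> Hom C S S'" "\<And>i. i \<in> I \<Longrightarrow> b \<odot> \<iota> i = \<iota>' i"
    using coproduct_copair[OF S coproduct_obj[OF S'] coproduct_inj[OF S']] by blast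
  obtain c where c: "c \<in> Hom C S' S" "\<And>i. i \<in> I \<Longrightarrow> c \<odot> \<iota>' i = \<iota> i"
    using coproduct_copair[OF S' coproduct_obj[OF S] coproduct_inj[OF S]] by blast
  have "c \<odot> b = Ident C S"
  proof (rule coproduct_eqI[OF S comp_hom[OF b(1) c(1)] ident_hom[OF coproduct_obj[OF S]]])
    fix i assume i: "i \<in> I"
    show "(c \<odot> b) \<odot> \<iota> i = Ident C S \<odot> \<iota> i"
      using comp_assoc[OF coproduct_inj[OF S i] b(1) c(1)] b(2)[OF i] c(2)[OF i]
        ident_comp[OF coproduct_inj[OF S i]] by simp
  qed
  moreover have "b \<odot> c = Ident C S'"
  proof (rule coproduct_eqI[OF S' comp_hom[OF c(1) b(1)] ident_hom[OF coproduct_obj[OF S']]])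
    fix i assume i: "i \<in> I"
    show "(b \<odot> c) \<odot> \<iota>' i = Ident C S' \<odot> \<iota>' i"
      using comp_assoc[OF coproduct_inj[OF S' i] c(1) b(1)] b(2)[OF i] c(2)[OF i]
        ident_comp[OF coproduct_inj[OF S' i]] by simp
  qed
  ultimately show thesis using that b isomorphismI[OF b(1) c(1)] by blast
qed

text \<open>Coproducts are associative. This lemma and the next read the associativity in its two
  directions; together they allow the exchange of two iterated coproducts.\<close>

lemma coproduct_of_coproducts:
  assumes N: "is_coproduct C I N S \<iota>"
    and M: "\<And>i. i \<in> I \<Longrightarrow> is_coproduct C (K i) (M i) (N i) (\<rho> i)"
  shows "is_coproduct C (Sigma I K) (\<lambda>(i, k). M i k) S (\<lambda>(i, k). \<iota> i \<odot> \<rho> i k)"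
proof (rule coproductI, goal_cases)
  case 1 show ?case using coproduct_obj[OF N] .
next
  case (2 p) then show ?case
    using comp_hom[OF coproduct_inj[OF M] coproduct_inj[OF N]] by (auto simp: split_beta)
next
  case (3 X \<phi>)
  have "\<exists>h. h \<in> Hom C (N i) X \<and> (\<forall>k\<in>K i. h \<odot> \<rho> i k = \<phi> (i, k))" if i: "i \<in> I" for i
    by (rule coproduct_copair[OF M[OF i] 3(1), of "\<lambda>k. \<phi> (i, k)"]) (use 3(2) i in auto)
  then have "\<forall>i\<in>I. \<exists>h. h \<in> Hom C (N i) X \<and> (\<forall>k\<in>K i. h \<odot> \<rho> i k = \<phi> (i, k))" ..
  then obtain h where "\<forall>i\<in>I. h i \<in> Hom C (N i) X \<and> (\<forall>k\<in>K i. h i \<odot> \<rho> i k = \<phi> (i, k))"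
    by (rule bchoice[THEN exE])
  then have h: "\<And>i. i \<in> I \<Longrightarrow> h i \<in> Hom C (N i) X"
    "\<And>i k. i \<in> I \<Longrightarrow> k \<in> K i \<Longrightarrow> h i \<odot> \<rho> i k = \<phi> (i, k)" by simp_all
  obtain g where g: "g \<in> Hom C S X" "\<And>i. i \<in> I \<Longrightarrow> g \<odot> \<iota> i = h i"
    using coproduct_copair[OF N 3(1) h(1)] by blast
  have "g \<odot> (\<iota> i \<odot> \<rho> i k) = \<phi> (i, k)" if "i \<in> I" "k \<in> K i" for i k
    using comp_assoc[OF coproduct_inj[OF M] coproduct_inj[OF N] g(1)] that g(2) h(2) by simp
  then show ?case by (intro bexI[OF _ g(1)]) auto
next
  case (4 X h h')
  show ?case
  proof (rule coproduct_eqI[OF N 4(1,2)])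
    fix i assume i: "i \<in> I"
    note \<iota>i = coproduct_inj[OF N i]
    show "h \<odot> \<iota> i = h' \<odot> \<iota> i"
    proof (rule coproduct_eqI[OF M[OF i] comp_hom[OF \<iota>i 4(1)] comp_hom[OF \<iota>i 4(2)]])
      fix k assume k: "k \<in> K i"
      then show "(h \<odot> \<iota> i) \<odot> \<rho> i k = (h' \<odot> \<iota> i) \<odot> \<rho> i k"
        using comp_assoc[OF coproduct_inj[OF M[OF i] k] \<iota>i] 4 i k by force
    qed
  qed
qed

lemma coproduct_regroup:
  assumes S: "is_coproduct C (Sigma I K) (\<lambda>(i, k). M i k) S \<mu>"
    and M: "\<And>i. i \<in> I \<Longrightarrow> is_coproduct C (K i) (M i) (N i) (\<rho> i)"
  obtains \<iota> where "is_coproduct C I N S \<iota>" "\<And>i k. i \<in> I \<Longrightarrow> k \<in> K i \<Longrightarrow> \<iota> i \<odot> \<rho> i k = \<mu> (i, k)"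
proof -
  have \<mu>: "\<mu> (i, k) \<in> Hom C (M i k) S" if "i \<in> I" "k \<in> K i" for i k
    using coproduct_inj[OF S, of "(i, k)"] that by simp
  have "\<exists>h. h \<in> Hom C (N i) S \<and> (\<forall>k\<in>K i. h \<odot> \<rho> i k = \<mu> (i, k))" if i: "i \<in> I" for i
    by (rule coproduct_copair[OF M[OF i] coproduct_obj[OF S], of "\<lambda>k. \<mu> (i, k)"]) (use \<mu> i in auto)
  then have "\<forall>i\<in>I. \<exists>h. h \<in> Hom C (N i) S \<and> (\<forall>k\<in>K i. h \<odot> \<rho> i k = \<mu> (i, k))" ..
  then obtain \<iota> where "\<forall>i\<in>I. \<iota> i \<in> Hom C (N i) S \<and> (\<forall>k\<in>K i. \<iota> i \<odot> \<rho> i k = \<mu> (i, k))"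
    by (rule bchoice[THEN exE])
  then have \<iota>: "\<And>i. i \<in> I \<Longrightarrow> \<iota> i \<in> Hom C (N i) S"
    "\<And>i k. i \<in> I \<Longrightarrow> k \<in> K i \<Longrightarrow> \<iota> i \<odot> \<rho> i k = \<mu> (i, k)" by simp_all
  have "is_coproduct C I N S \<iota>"
  proof (rule coproductI, goal_cases)
    case 1 show ?case using coproduct_obj[OF S] .
  next
    case (2 i) then show ?case using \<iota>(1) by blast
  next
    case (3 X \<phi>)
    obtain h where h: "h \<in> Hom C S X" "\<And>p. p \<in> Sigma I K \<Longrightarrow> h \<odot> \<mu> p = (case p of (i, k) \<Rightarrow> \<phi> i \<odot> \<rho> i k)"
      by (rule coproduct_copair[OF S 3(1), of "\<lambda>(i, k). \<phi> i \<odot> \<rho> i k"])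
        (use comp_hom[OF coproduct_inj[OF M] 3(2)] in \<open>auto simp: split_beta\<close>)
    have "h \<odot> \<iota> i = \<phi> i" if i: "i \<in> I" for i
    proof (rule coproduct_eqI[OF M[OF i] comp_hom[OF \<iota>(1)[OF i] h(1)] 3(2)[OF i]])
      fix k assume k: "k \<in> K i"
      show "(h \<odot> \<iota> i) \<odot> \<rho> i k = \<phi> i \<odot> \<rho> i k"
        using comp_assoc[OF coproduct_inj[OF M[OF i] k] \<iota>(1)[OF i] h(1)] \<iota>(2)[OF i k] h(2)[of "(i, k)"] i k
        by simp
    qed
    then show ?case using h(1) by blast
  next
    case (4 X h h')
    show ?case
    proof (rule coproduct_eqI[OF S 4(1,2)])
      fix p assume p: "p \<in> Sigma I K"
      then obtain i k where ik: "p = (i, k)" "i \<in> I" "k \<in> K i" by blast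
      show "h \<odot> \<mu> p = h' \<odot> \<mu> p"
        using comp_assoc[OF coproduct_inj[OF M[OF ik(2)] ik(3)] \<iota>(1)[OF ik(2)]] 4 ik \<iota>(2) by metis
    qed
  qed
  then show thesis using that \<iota>(2) by blast
qed

lemma coproduct_exchange:
  assumes N: "is_coproduct C I N S \<iota>"
    and M: "\<And>i. i \<in> I \<Longrightarrow> is_coproduct C K (M i) (N i) (\<rho> i)"
    and L: "\<And>k. k \<in> K \<Longrightarrow> is_coproduct C I (\<lambda>i. M i k) (L k) (\<mu> k)"
  obtains \<nu> where "is_coproduct C K L S \<nu>"
    "\<And>i k. i \<in> I \<Longrightarrow> k \<in> K \<Longrightarrow> \<nu> k \<odot> \<mu> k i = \<iota> i \<odot> \<rho> i k"
proof -
  have swap: "bij_betw prod.swap (K \<times> I) (I \<times> K)" by (auto simp: bij_betw_def)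
  have S: "is_coproduct C (K \<times> I) (\<lambda>(k, i). M i k) S (\<lambda>(k, i). \<iota> i \<odot> \<rho> i k)"
    using coproduct_reindex[OF swap, of "\<lambda>(i, k). M i k" S "\<lambda>(i, k). \<iota> i \<odot> \<rho> i k"]
      coproduct_of_coproducts[where K = "\<lambda>_. K", OF N M]
    by (simp add: comp_def split_def)
  show thesis
    by (rule coproduct_regroup[where K = "\<lambda>_. I", OF S L]) (auto intro: that)
qed

end

section \<open>Morphisms that factor through finitely many summands\<close>

text \<open>The image of the comparison map, described inductively: closure under composition,
  reindexing and the shift is then an induction on the number of summands, without a choice of
  finitely supported families.\<close>

inductive_set finite_sums ::
    "('o, 'm, 'z) preadd_data_scheme \<Rightarrow> 'o \<Rightarrow> 'i set \<Rightarrow> ('i \<Rightarrow> 'o) \<Rightarrow> 'o \<Rightarrow> ('i \<Rightarrow> 'm) \<Rightarrow> 'm set"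
  for C P I M S \<iota>
  where
    zero: "Zero C P S \<in> finite_sums C P I M S \<iota>"
  | plus: "\<lbrakk>u \<in> finite_sums C P I M S \<iota>; i \<in> I; \<phi> \<in> Hom C P (M i)\<rbrakk>
      \<Longrightarrow> Plus C u (\<iota> i \<odot>\<^bsub>C\<^esub> \<phi>) \<in> finite_sums C P I M S \<iota>"

text \<open>One index set at a time, and of any type: the proof needs countable families by
  themselves and restricts the summands to several classes of objects.\<close>

definition finitary ::
    "('o, 'm, 'z) preadd_data_scheme \<Rightarrow> 'o set \<Rightarrow> 'i set \<Rightarrow> 'o \<Rightarrow> bool"
  where "finitary C U I P \<longleftrightarrow> (\<forall>M S \<iota>. (\<forall>i\<in>I. M i \<in> U) \<and> is_coproduct C I M S \<iota> \<longrightarrow>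
    Hom C P S \<subseteq> finite_sums C P I M S \<iota>)"

lemma finitaryD:
  assumes "finitary C U I P" "is_coproduct C I M S \<iota>" "\<And>i. i \<in> I \<Longrightarrow> M i \<in> U" "u \<in> Hom C P S"
  shows "u \<in> finite_sums C P I M S \<iota>"
  using assms by (auto simp: finitary_def)

lemma finitary_mono: "finitary C U I P \<Longrightarrow> V \<subseteq> U \<Longrightarrow> finitary C V I P"
  unfolding finitary_def by (meson subsetD)

context preadditive_category
begin

lemma finite_sums_hom:
  assumes S: "is_coproduct C I M S \<iota>" and P: "P \<in> Obj C" and u: "u \<in> finite_sums C P I M S \<iota>"
  shows "u \<in> Hom C P S"
  using u
proof induction
  case zero show ?case using zero_hom[OF P coproduct_obj[OF S]] .
next
  case (plus u i \<phi>)
  then show ?case using plus_hom[OF plus.IH comp_hom[OF plus.hyps(3) coproduct_inj[OF S plus.hyps(2)]]] by simp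
qed

lemma finite_sums_plus:
  assumes S: "is_coproduct C I M S \<iota>" and P: "P \<in> Obj C"
    and u: "u \<in> finite_sums C P I M S \<iota>" and v: "v \<in> finite_sums C P I M S \<iota>"
  shows "Plus C u v \<in> finite_sums C P I M S \<iota>"
  using v
proof induction
  case zero show ?case using plus_zero[OF finite_sums_hom[OF S P u]] u by simp
next
  case (plus v i \<phi>)
  have "Plus C u (Plus C v (\<iota> i \<odot> \<phi>)) = Plus C (Plus C u v) (\<iota> i \<odot> \<phi>)"
    using plus_assoc[OF finite_sums_hom[OF S P u] finite_sums_hom[OF S P plus.hyps(1)]
        comp_hom[OF plus.hyps(3) coproduct_inj[OF S plus.hyps(2)]]] by simp
  then show ?case using finite_sums.plus[OF plus.IH plus.hyps(2,3)] by simp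
qed

lemma finite_sums_inj:
  assumes S: "is_coproduct C I M S \<iota>" and i: "i \<in> I" and \<phi>: "\<phi> \<in> Hom C P (M i)"
  shows "\<iota> i \<odot> \<phi> \<in> finite_sums C P I M S \<iota>"
  using finite_sums.plus[where M = M, OF finite_sums.zero i \<phi>, of S \<iota>]
    zero_plus[OF comp_hom[OF \<phi> coproduct_inj[OF S i]]] by simp

lemma finite_sums_map:
  assumes S: "is_coproduct C I M S \<iota>" and S': "is_coproduct C J N S' \<iota>'"
    and g: "g \<in> Hom C S S'"
    and gi: "\<And>i \<phi>. i \<in> I \<Longrightarrow> \<phi> \<in> Hom C P (M i) \<Longrightarrow> g \<odot> (\<iota> i \<odot> \<phi>) \<in> finite_sums C P J N S' \<iota>'"
    and P: "P \<in> Obj C" and u: "u \<in> finite_sums C P I M S \<iota>"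
  shows "g \<odot> u \<in> finite_sums C P J N S' \<iota>'"
  using u
proof induction
  case zero show ?case using comp_zero[OF g P] finite_sums.zero by simp
next
  case (plus u i \<phi>)
  then show ?case
    using comp_plus[OF finite_sums_hom[OF S P plus.hyps(1)] comp_hom[OF plus.hyps(3) coproduct_inj[OF S plus.hyps(2)]] g]
      finite_sums_plus[OF S' P plus.IH gi[OF plus.hyps(2,3)]] by simp
qed

lemma finite_sums_comp:
  assumes S: "is_coproduct C I M S \<iota>" and u: "u \<in> finite_sums C P I M S \<iota>" and e: "e \<in> Hom C Q P"
  shows "u \<odot> e \<in> finite_sums C Q I M S \<iota>"
  using u
proof induction
  case zero show ?case using zero_comp[OF e coproduct_obj[OF S]] finite_sums.zero by simp
next
  case (plus u i \<phi>)
  note \<iota> = coproduct_inj[OF S plus.hyps(2)]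
  have "Plus C u (\<iota> i \<odot> \<phi>) \<odot> e = Plus C (u \<odot> e) (\<iota> i \<odot> (\<phi> \<odot> e))"
    using plus_comp[OF e finite_sums_hom[OF S hom_obj(2)[OF e] plus.hyps(1)] comp_hom[OF plus.hyps(3) \<iota>]]
      comp_assoc[OF e plus.hyps(3) \<iota>] by simp
  then show ?case using finite_sums.plus[OF plus.IH plus.hyps(2) comp_hom[OF e plus.hyps(3)]] by simp
qed

lemma finite_sums_reindex:
  assumes u: "u \<in> finite_sums C P J (M \<circ> \<sigma>) S (\<iota> \<circ> \<sigma>)" and \<sigma>: "\<sigma> ` J \<subseteq> I"
  shows "u \<in> finite_sums C P I M S \<iota>"
  using u
proof induction
  case zero show ?case by (rule finite_sums.zero)
next
  case (plus u j \<phi>)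
  then show ?case using finite_sums.plus[of u C P I M S \<iota> "\<sigma> j" \<phi>] \<sigma> by auto
qed

lemma finite_sums_cong:
  assumes u: "u \<in> finite_sums C P I M S \<iota>" and M: "\<And>i. i \<in> I \<Longrightarrow> M i = M' i"
  shows "u \<in> finite_sums C P I M' S \<iota>"
  using u
proof induction
  case zero show ?case by (rule finite_sums.zero)
next
  case (plus u i \<phi>)
  then show ?case using finite_sums.plus[of u C P I M' S \<iota> i \<phi>] M by simp
qed

lemma finitary_reindex:
  assumes fin: "finitary C U J P" and \<sigma>: "bij_betw \<sigma> J I"
  shows "finitary C U I P"
  unfolding finitary_def
proof (intro allI impI subsetI)
  fix M S \<iota> u assume *: "(\<forall>i\<in>I. M i \<in> U) \<and> is_coproduct C I M S \<iota>" and u: "u \<in> Hom C P S"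
  have "u \<in> finite_sums C P J (M \<circ> \<sigma>) S (\<iota> \<circ> \<sigma>)"
    by (rule finitaryD[OF fin _ _ u]) (use * coproduct_reindex[OF \<sigma>] \<sigma> in \<open>auto simp: bij_betw_def\<close>)
  then show "u \<in> finite_sums C P I M S \<iota>"
    by (rule finite_sums_reindex) (use \<sigma> in \<open>auto simp: bij_betw_def\<close>)
qed

subsection \<open>The comparison map\<close>

lemma carrier_sum_hom_group:
  assumes S: "is_coproduct C I M S \<iota>" and P: "P \<in> Obj C"
  shows "carrier (sum_group I (\<lambda>i. hom_group C P (M i)))
    = {\<phi> \<in> \<Pi>\<^sub>E i\<in>I. Hom C P (M i). finite {i \<in> I. \<phi> i \<noteq> Zero C P (M i)}}"
  using carrier_sum_group[of I "\<lambda>i. hom_group C P (M i)"]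
    comm_group.axioms(2)[OF hom_comm_group[OF P coproduct_summand_obj[OF S]]] by simp

text \<open>A projection composed with a finite sum through the summands picks out one component.
  This is the computation behind the injectivity of the comparison map.\<close>

lemma finprod_projection:
  assumes S: "is_coproduct C I M S \<iota>" and P: "P \<in> Obj C"
    and \<phi>: "\<And>i. i \<in> I \<Longrightarrow> \<phi> i \<in> Hom C P (M i)" and j: "j \<in> I"
    and \<pi>: "p \<in> Hom C S (M j)" "p \<odot> \<iota> j = Ident C (M j)"
      "\<And>i. i \<in> I \<Longrightarrow> i \<noteq> j \<Longrightarrow> p \<odot> \<iota> i = Zero C (M i) (M j)"
    and A: "finite A" "A \<subseteq> I"
  shows "p \<odot> finprod (hom_group C P S) (\<lambda>i. \<iota> i \<odot> \<phi> i) A = (if j \<in> A then \<phi> j else Zero C P (M j))"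
proof -
  interpret G: comm_group "hom_group C P S"
    by (rule hom_comm_group[OF P coproduct_obj[OF S]])
  have h: "\<iota> i \<odot> \<phi> i \<in> Hom C P S" if "i \<in> I" for i
    by (rule comp_hom[OF \<phi>[OF that] coproduct_inj[OF S that]])
  have Mj: "M j \<in> Obj C" by (rule hom_obj[OF \<pi>(1)])
  show ?thesis
    using A
  proof (induction A)
    case empty then show ?case using comp_zero[OF \<pi>(1) P] by simp
  next
    case (insert i A)
    let ?F = "finprod (hom_group C P S) (\<lambda>i. \<iota> i \<odot> \<phi> i)"
    have i: "i \<in> I" and FA: "?F A \<in> Hom C P S"
      using insert.prems G.finprod_closed[of "\<lambda>i. \<iota> i \<odot> \<phi> i" A] h by auto
    have "?F (insert i A) = Plus C (\<iota> i \<odot> \<phi> i) (?F A)"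
      using G.finprod_insert[of A i "\<lambda>i. \<iota> i \<odot> \<phi> i"] insert.hyps insert.prems h
      by (simp add: Pi_def subset_iff)
    then have "p \<odot> ?F (insert i A) = Plus C (p \<odot> (\<iota> i \<odot> \<phi> i)) (p \<odot> ?F A)"
      using comp_plus[OF h[OF i] FA \<pi>(1)] by simp
    also have "p \<odot> (\<iota> i \<odot> \<phi> i) = (if i = j then \<phi> j else Zero C P (M j))"
      using comp_assoc[OF \<phi>[OF i] coproduct_inj[OF S i] \<pi>(1)] \<pi>(2) \<pi>(3)[OF i]
        ident_comp[OF \<phi>[OF j]] zero_comp[OF \<phi>[OF i] Mj] by auto
    also have "p \<odot> ?F A = (if j \<in> A then \<phi> j else Zero C P (M j))"
      using insert by simp
    finally show ?case
      using insert.hyps zero_plus[OF \<phi>[OF j]] plus_zero[OF \<phi>[OF j]] zero_plus[OF zero_hom[OF P Mj]]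
      by (auto split: if_splits)
  qed
qed

lemma comparison_projection:
  assumes S: "is_coproduct C I M S \<iota>" and P: "P \<in> Obj C"
    and \<phi>: "\<phi> \<in> carrier (sum_group I (\<lambda>i. hom_group C P (M i)))" and j: "j \<in> I"
    and \<pi>: "p \<in> Hom C S (M j)" "p \<odot> \<iota> j = Ident C (M j)"
      "\<And>i. i \<in> I \<Longrightarrow> i \<noteq> j \<Longrightarrow> p \<odot> \<iota> i = Zero C (M i) (M j)"
  shows "p \<odot> coproduct_comparison C P I S \<iota> \<phi> = \<phi> j"
proof -
  have \<phi>i: "\<phi> i \<in> Hom C P (M i)" if "i \<in> I" for i
    using \<phi> that by (auto simp: carrier_sum_hom_group[OF S P])
  let ?A = "{i \<in> I. \<iota> i \<odot> \<phi> i \<noteq> Zero C P S}"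
  have "?A \<subseteq> {i \<in> I. \<phi> i \<noteq> Zero C P (M i)}"
    using comp_zero[OF coproduct_inj[OF S] P] by auto
  then have fin: "finite ?A"
    using \<phi> finite_subset by (auto simp: carrier_sum_hom_group[OF S P])
  then have "p \<odot> coproduct_comparison C P I S \<iota> \<phi> = (if j \<in> ?A then \<phi> j else Zero C P (M j))"
    using finprod_projection[OF S P \<phi>i j \<pi> fin]
    by (simp add: coproduct_comparison_def gfinprod_def)
  moreover have "\<phi> j = Zero C P (M j)" if "j \<notin> ?A"
    using that j comp_assoc[OF \<phi>i[OF j] coproduct_inj[OF S j] \<pi>(1)] \<pi>(2) ident_comp[OF \<phi>i[OF j]]
      comp_zero[OF \<pi>(1) P] by simp
  ultimately show ?thesis by auto
qed

text \<open>The projections of a coproduct, which exist because there are zero morphisms, recover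
  all components of a family from its image. So compactness is only a question of
  surjectivity.\<close>

lemma comparison_inj:
  assumes S: "is_coproduct C I M S \<iota>" and P: "P \<in> Obj C"
  shows "inj_on (coproduct_comparison C P I S \<iota>) (carrier (sum_group I (\<lambda>i. hom_group C P (M i))))"
proof (rule inj_onI)
  fix \<phi> \<psi> assume \<phi>: "\<phi> \<in> carrier (sum_group I (\<lambda>i. hom_group C P (M i)))"
    and \<psi>: "\<psi> \<in> carrier (sum_group I (\<lambda>i. hom_group C P (M i)))"
    and eq: "coproduct_comparison C P I S \<iota> \<phi> = coproduct_comparison C P I S \<iota> \<psi>"
  obtain \<pi> where \<pi>: "\<And>j. j \<in> I \<Longrightarrow> \<pi> j \<in> Hom C S (M j)"
    "\<And>j. j \<in> I \<Longrightarrow> \<pi> j \<odot> \<iota> j = Ident C (M j)"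
    "\<And>i j. i \<in> I \<Longrightarrow> j \<in> I \<Longrightarrow> i \<noteq> j \<Longrightarrow> \<pi> j \<odot> \<iota> i = Zero C (M i) (M j)"
    using coproduct_projections[OF S] by blast
  have "\<phi> j = \<psi> j" if j: "j \<in> I" for j
    using comparison_projection[OF S P \<phi> j \<pi>(1,2)[OF j] \<pi>(3)[OF _ j]]
      comparison_projection[OF S P \<psi> j \<pi>(1,2)[OF j] \<pi>(3)[OF _ j]] eq by simp
  moreover have "\<phi> \<in> extensional I" "\<psi> \<in> extensional I"
    using \<phi> \<psi> by (auto simp: carrier_sum_hom_group[OF S P] PiE_def)
  ultimately show "\<phi> = \<psi>" by (rule extensionalityI[rotated 2])
qed

lemma comparison_image:
  assumes S: "is_coproduct C I M S \<iota>" and P: "P \<in> Obj C"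
  shows "coproduct_comparison C P I S \<iota> ` carrier (sum_group I (\<lambda>i. hom_group C P (M i)))
    = finite_sums C P I M S \<iota>" (is "?c ` ?X = ?F")
proof
  interpret G: comm_group "hom_group C P S"
    by (rule hom_comm_group[OF P coproduct_obj[OF S]])
  have grp: "group (hom_group C P (M i))" if "i \<in> I" for i
    using comm_group.axioms(2)[OF hom_comm_group[OF P coproduct_summand_obj[OF S that]]] .
  show "?c ` ?X \<subseteq> ?F"
  proof clarify
    fix \<phi> assume \<phi>: "\<phi> \<in> ?X"
    have \<phi>i: "\<phi> i \<in> Hom C P (M i)" if "i \<in> I" for i
      using \<phi> that by (auto simp: carrier_sum_hom_group[OF S P])
    have h: "\<iota> i \<odot> \<phi> i \<in> Hom C P S" if "i \<in> I" for i
      by (rule comp_hom[OF \<phi>i[OF that] coproduct_inj[OF S that]])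
    have "finprod (hom_group C P S) (\<lambda>i. \<iota> i \<odot> \<phi> i) A \<in> ?F" if "finite A" "A \<subseteq> I" for A
      using that
    proof (induction A)
      case empty show ?case using finite_sums.zero[of C P S I M \<iota>] by simp
    next
      case (insert i A)
      then have "finprod (hom_group C P S) (\<lambda>i. \<iota> i \<odot> \<phi> i) (insert i A)
        = Plus C (\<iota> i \<odot> \<phi> i) (finprod (hom_group C P S) (\<lambda>i. \<iota> i \<odot> \<phi> i) A)"
        using G.finprod_insert[of A i "\<lambda>i. \<iota> i \<odot> \<phi> i"] h by (simp add: Pi_def subset_iff)
      then show ?case
        using finite_sums_plus[OF S P finite_sums_inj[OF S _ \<phi>i]] insert by simp
    qed
    then show "?c \<phi> \<in> ?F"
      using finite_sums.zero[of C P S I M \<iota>] by (simp add: coproduct_comparison_def gfinprod_def)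
  qed
  have hom: "?c \<in> hom (sum_group I (\<lambda>i. hom_group C P (M i))) (hom_group C P S)"
    unfolding coproduct_comparison_def
  proof (rule G.hom_group_sum)
    fix i assume i: "i \<in> I"
    show "(\<odot>) (\<iota> i) \<in> hom (hom_group C P (M i)) (hom_group C P S)"
      using comp_hom[OF _ coproduct_inj[OF S i]] comp_plus[OF _ _ coproduct_inj[OF S i]]
      by (auto simp: hom_def)
  qed (rule grp)
  have grpX: "group (sum_group I (\<lambda>i. hom_group C P (M i)))" using grp by simp
  have single: "\<iota> i \<odot> \<psi> \<in> ?c ` ?X" if i: "i \<in> I" and \<psi>: "\<psi> \<in> Hom C P (M i)" for i \<psi>
  proof -
    let ?d = "\<lambda>k\<in>I. if k = i then \<psi> else Zero C P (M k)"
    have "?d \<in> ?X"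
      using \<psi> zero_hom[OF P coproduct_summand_obj[OF S]]
      by (auto simp: carrier_sum_hom_group[OF S P] intro: finite_subset[of _ "{i}"])
    moreover have "?c ?d = \<iota> i \<odot> \<psi>"
    proof -
      have h: "\<iota> i \<odot> \<psi> \<in> Hom C P S" by (rule comp_hom[OF \<psi> coproduct_inj[OF S i]])
      have "?c ?d = gfinprod (hom_group C P S) (\<lambda>k. \<iota> k \<odot> ?d k) {i}"
        unfolding coproduct_comparison_def
        by (rule G.gfinprod_mono_neutral_cong_right)
          (use i \<psi> comp_zero[OF coproduct_inj[OF S] P] zero_hom[OF P coproduct_obj[OF S]] h in auto)
      also have "\<dots> = finprod (hom_group C P S) (\<lambda>k. \<iota> k \<odot> ?d k) {i}"
        using i h by (intro G.gfinprod_eq_finprod) auto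
      also have "\<dots> = \<iota> i \<odot> \<psi>"
        using G.finprod_insert[of "{}" i "\<lambda>k. \<iota> k \<odot> ?d k"] i h plus_zero[OF h] by simp
      finally show ?thesis .
    qed
    ultimately show ?thesis by (intro image_eqI) simp_all
  qed
  show "?F \<subseteq> ?c ` ?X"
  proof
    fix u assume "u \<in> ?F" then show "u \<in> ?c ` ?X"
    proof induction
      case zero
      show ?case
        by (rule image_eqI[OF _ monoid.one_closed[OF group.is_monoid[OF grpX]]])
          (use hom_one[OF hom grpX G.is_group] in \<open>simp only: one_sum_group hom_group_simps\<close>)
    next
      case (plus u i \<phi>)
      then obtain \<alpha> \<beta> where "\<alpha> \<in> ?X" "u = ?c \<alpha>" "\<beta> \<in> ?X" "\<iota> i \<odot> \<phi> = ?c \<beta>"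
        using single[OF plus.hyps(2,3)] by auto
      then show ?case
        using hom_mult[OF hom, of \<alpha> \<beta>] monoid.m_closed[OF group.is_monoid[OF grpX], of \<alpha> \<beta>]
        by (intro image_eqI[of _ _ "\<lambda>i\<in>I. Plus C (\<alpha> i) (\<beta> i)"])
          (simp_all only: hom_group_simps mult_sum_group)
    qed
  qed
qed

lemma bij_betw_comparison_iff:
  assumes S: "is_coproduct C I M S \<iota>" and P: "P \<in> Obj C"
  shows "bij_betw (coproduct_comparison C P I S \<iota>)
      (carrier (sum_group I (\<lambda>i. hom_group C P (M i)))) (Hom C P S)
    \<longleftrightarrow> Hom C P S \<subseteq> finite_sums C P I M S \<iota>"
  using comparison_inj[OF S P] comparison_image[OF S P] finite_sums_hom[OF S P]
  by (auto simp: bij_betw_def)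

lemma finite_sums_eq_zero:
  assumes S: "is_coproduct C I M S \<iota>" and P: "P \<in> Obj C" and u: "u \<in> finite_sums C P I M S \<iota>"
    and \<pi>: "\<And>j. j \<in> I \<Longrightarrow> \<pi> j \<in> Hom C S (M j)" "\<And>j. j \<in> I \<Longrightarrow> \<pi> j \<odot> \<iota> j = Ident C (M j)"
      "\<And>i j. i \<in> I \<Longrightarrow> j \<in> I \<Longrightarrow> i \<noteq> j \<Longrightarrow> \<pi> j \<odot> \<iota> i = Zero C (M i) (M j)"
    and 0: "\<And>j. j \<in> I \<Longrightarrow> \<pi> j \<odot> u = Zero C P (M j)"
  shows "u = Zero C P S"
proof -
  obtain \<phi> where \<phi>: "\<phi> \<in> carrier (sum_group I (\<lambda>i. hom_group C P (M i)))"
    "u = coproduct_comparison C P I S \<iota> \<phi>"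
    using u comparison_image[OF S P] by auto
  interpret G: comm_group "hom_group C P S"
    by (rule hom_comm_group[OF P coproduct_obj[OF S]])
  have "\<phi> j = Zero C P (M j)" if j: "j \<in> I" for j
    using comparison_projection[OF S P \<phi>(1) j \<pi>(1,2)[OF j] \<pi>(3)[OF _ j]] \<phi>(2) 0[OF j] by simp
  then have "{i \<in> I. \<iota> i \<odot> \<phi> i \<noteq> one (hom_group C P S)} = {}"
    using comp_zero[OF coproduct_inj[OF S] P] by auto
  then show ?thesis
    unfolding \<phi>(2) coproduct_comparison_def gfinprod_def by (simp only:) simp
qed

lemma compact_object_iff_finitary:
  "compact_object (\<kappa> :: 'k rel) C P
    \<longleftrightarrow> P \<in> Obj C \<and> (\<forall>I :: 'k set. small \<kappa> I \<longrightarrow> finitary C (Obj C) I P)"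
proof -
  have "(\<forall>M S \<iota>. small \<kappa> I \<and> is_coproduct C I M S \<iota> \<longrightarrow>
       bij_betw (coproduct_comparison C P I S \<iota>)
         (carrier (sum_group I (\<lambda>i. hom_group C P (M i)))) (Hom C P S))
     \<longleftrightarrow> (small \<kappa> I \<longrightarrow> finitary C (Obj C) I P)" if "P \<in> Obj C" for I :: "'k set"
    unfolding finitary_def using bij_betw_comparison_iff[OF _ that] coproduct_summand_obj by metis
  then show ?thesis unfolding compact_object_def by blast
qed

end

section \<open>Full subcategories\<close>

lemma full_subcategory_simps [simp]:
  "Obj (full_subcategory C U) = U"
  "Ident (full_subcategory C U) = Ident C"
  "Comp (full_subcategory C U) = Comp C"
  "Zero (full_subcategory C U) = Zero C"
  "Plus (full_subcategory C U) = Plus C"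
  "Hom (full_subcategory C U) X Y = (if X \<in> U \<and> Y \<in> U then Hom C X Y else {})"
  by (auto simp: full_subcategory_def Hom_def)

lemma hom_group_full:
  "X \<in> U \<Longrightarrow> Y \<in> U \<Longrightarrow> hom_group (full_subcategory C U) X Y = hom_group C X Y"
  by (simp add: hom_group_def)

lemma finite_sums_full:
  assumes "P \<in> U" "\<forall>i\<in>I. M i \<in> U"
  shows "finite_sums (full_subcategory C U) P I M S \<iota> = finite_sums C P I M S \<iota>"
proof (intro equalityI subsetI)
  fix u assume "u \<in> finite_sums (full_subcategory C U) P I M S \<iota>"
  then show "u \<in> finite_sums C P I M S \<iota>"
    by induction (use assms in \<open>auto intro: finite_sums.intros\<close>)
next
  fix u assume "u \<in> finite_sums C P I M S \<iota>"
  then show "u \<in> finite_sums (full_subcategory C U) P I M S \<iota>"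
  proof induction
    case zero
    show ?case using finite_sums.zero[of "full_subcategory C U" P S I M \<iota>] by simp
  next
    case (plus u i \<phi>)
    then show ?case
      using finite_sums.plus[of u "full_subcategory C U" P I M S \<iota> i \<phi>] assms by simp
  qed
qed

context preadditive_category
begin

lemma preadditive_full:
  assumes U: "U \<subseteq> Obj C"
  shows "preadditive_category (full_subcategory C U)"
proof (rule preadditive_category.intro, goal_cases)
  case (1 f) then show ?case by (auto simp: full_subcategory_def)
next
  case (7 X Y) then show ?case using hom_comm_group U by (auto simp: hom_group_full)
qed (use U in \<open>auto simp: ident_hom comp_hom comp_ident ident_comp comp_assoc comp_plus plus_comp
      split: if_splits\<close>)

lemma coproduct_full:
  assumes U: "U \<subseteq> Obj C" and S: "is_coproduct C I M S \<iota>" and "S \<in> U" "\<And>i. i \<in> I \<Longrightarrow> M i \<in> U"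
  shows "is_coproduct (full_subcategory C U) I M S \<iota>"
  unfolding is_coproduct_def
proof (intro conjI ballI allI impI)
  fix X \<phi> assume X: "X \<in> Obj (full_subcategory C U)"
    and \<phi>: "\<forall>i\<in>I. \<phi> i \<in> Hom (full_subcategory C U) (M i) X"
  have "X \<in> Obj C" "\<forall>i\<in>I. \<phi> i \<in> Hom C (M i) X"
    using X U \<phi> by (auto split: if_splits)
  then have "\<exists>!h. h \<in> Hom C S X \<and> (\<forall>i\<in>I. h \<odot> \<iota> i = \<phi> i)"
    using S by (simp add: is_coproduct_def)
  then show "\<exists>!h. h \<in> Hom (full_subcategory C U) S X
      \<and> (\<forall>i\<in>I. h \<odot>\<^bsub>full_subcategory C U\<^esub> \<iota> i = \<phi> i)"
    using X assms(3) by simp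
qed (use assms coproduct_inj[OF S] in auto)

text \<open>A coproduct in the ambient category whose vertex lies in the subcategory is a
  coproduct there too, and coproducts are unique up to isomorphism. So the subcategory cannot have
  other coproducts.\<close>

lemma coproduct_of_full:
  assumes U: "U \<subseteq> Obj C" and S: "is_coproduct (full_subcategory C U) I M S \<iota>"
    and S': "is_coproduct C I M S' \<iota>'" and "S' \<in> U"
  shows "is_coproduct C I M S \<iota>"
proof -
  interpret F: preadditive_category "full_subcategory C U" by (rule preadditive_full[OF U])
  have "\<And>i. i \<in> I \<Longrightarrow> M i \<in> U" "S \<in> U"
    using F.coproduct_summand_obj[OF S] F.coproduct_obj[OF S] by simp_all
  then have "is_coproduct (full_subcategory C U) I M S' \<iota>'"
    using coproduct_full[OF U S' assms(4)] by blast
  then obtain b where b: "isomorphism (full_subcategory C U) b S' S"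
    "\<And>i. i \<in> I \<Longrightarrow> b \<odot> \<iota>' i = \<iota> i"
    by (rule F.coproduct_unique[OF _ S]) auto
  have "isomorphism C b S' S"
    using b(1) U by (auto simp: isomorphism_def split: if_splits)
  from coproduct_change_vertex[OF S' this] show ?thesis
    by (rule coproduct_cong) (simp_all add: b(2))
qed

text \<open>As the class is closed under small coproducts, coproducts in the full subcategory
  agree with those in the ambient category, and so do the comparison maps.\<close>

lemma compact_object_full_iff_finitary:
  assumes C: "has_small_coproducts (\<kappa> :: 'k rel) C" and U: "U \<subseteq> Obj C"
    and cl: "closed_under_small_coproducts \<kappa> C U"
  shows "compact_object \<kappa> (full_subcategory C U) P
    \<longleftrightarrow> P \<in> U \<and> (\<forall>I :: 'k set. small \<kappa> I \<longrightarrow> finitary C U I P)"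
proof -
  interpret F: preadditive_category "full_subcategory C U" by (rule preadditive_full[OF U])
  have cop: "is_coproduct (full_subcategory C U) I M S \<iota>
      \<longleftrightarrow> is_coproduct C I M S \<iota> \<and> (\<forall>i\<in>I. M i \<in> U)" (is "?L \<longleftrightarrow> ?R")
    if I: "small \<kappa> I" for I :: "'k set" and M S \<iota>
  proof
    assume L: ?L
    then have M: "\<forall>i\<in>I. M i \<in> U" using F.coproduct_summand_obj[OF L] by simp
    then obtain S' \<iota>' where S': "is_coproduct C I M S' \<iota>'"
      using C I U unfolding has_small_coproducts_def by (meson subsetD)
    then have "S' \<in> U" using cl I M unfolding closed_under_small_coproducts_def by blast
    then show ?R using coproduct_of_full[OF U L S'] M by simp
  next
    assume R: ?R
    then have S: "S \<in> U" using cl I unfolding closed_under_small_coproducts_def by blast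
    show ?L using coproduct_full[OF U _ S] R by blast
  qed
  have "finitary (full_subcategory C U) U I P \<longleftrightarrow> finitary C U I P"
    if P: "P \<in> U" and I: "small \<kappa> I" for I :: "'k set"
  proof -
    have "Hom (full_subcategory C U) P S \<subseteq> finite_sums (full_subcategory C U) P I M S \<iota>
        \<longleftrightarrow> Hom C P S \<subseteq> finite_sums C P I M S \<iota>"
      if "\<forall>i\<in>I. M i \<in> U" "is_coproduct (full_subcategory C U) I M S \<iota>" for M S \<iota>
      using that P F.coproduct_obj[OF that(2)] by (simp add: finite_sums_full)
    then show ?thesis unfolding finitary_def using cop[OF I] by blast
  qed
  then show ?thesis unfolding F.compact_object_iff_finitary by auto
qed

end

section \<open>Smallness\<close>

text \<open>This is where the regularity of the cardinal enters.\<close>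

lemma small_Sigma:
  assumes \<kappa>: "universe_cardinal \<kappa>" and A: "small \<kappa> A" and B: "\<And>a. a \<in> A \<Longrightarrow> small \<kappa> (B a)"
  shows "small \<kappa> (Sigma A B)"
proof -
  have "Card_order \<kappa>" "regularCard \<kappa>" "natLeq <o \<kappa>"
    using \<kappa> by (auto simp: universe_cardinal_def)
  moreover from this have "infinite (Field \<kappa>)"
    using natLeq_Card_order Cinfinite_cong cinfinite_mono ordLess_imp_ordLeq natLeq_cinfinite
    by (metis cinfinite_def)
  ultimately have "stable \<kappa>" using regularCard_stable by blast
  then show ?thesis using stable_elim[of \<kappa> A B] A B by (simp add: small_def)
qed

lemma small_mono: "small \<kappa> B \<Longrightarrow> A \<subseteq> B \<Longrightarrow> small \<kappa> A"
  unfolding small_def using card_of_mono1 ordLeq_ordLess_trans by blast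

lemma small_image: "small \<kappa> A \<Longrightarrow> small \<kappa> (f ` A)"
  unfolding small_def using card_of_image ordLeq_ordLess_trans by blast

lemma small_nat: "universe_cardinal \<kappa> \<Longrightarrow> small \<kappa> (A :: nat set)"
proof (rule small_mono[of _ UNIV])
  assume "universe_cardinal \<kappa>"
  then show "small \<kappa> (UNIV :: nat set)"
    unfolding small_def universe_cardinal_def using card_of_nat ordIso_ordLess_trans by blast
qed simp

lemma small_reindex:
  assumes "small (\<kappa> :: 'k rel) A"
  obtains J :: "'k set" and \<sigma> where "small \<kappa> J" "bij_betw \<sigma> J A"
proof -
  obtain J where J: "J \<subseteq> Field \<kappa>" "|A| =o |J|" "|J| <o \<kappa>"
    using internalize_card_of_ordLess[of A \<kappa>] assms by (auto simp: small_def)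
  then have "|J| =o |A|" using ordIso_symmetric by blast
  then obtain \<sigma> where "bij_betw \<sigma> J A" using card_of_ordIso by blast
  then show thesis using that J by (simp add: small_def)
qed

context preadditive_category
begin

lemma ex_small_coproduct:
  assumes C: "has_small_coproducts (\<kappa> :: 'k rel) C" and I: "small \<kappa> I" and M: "\<And>i. i \<in> I \<Longrightarrow> M i \<in> Obj C"
  obtains S \<iota> where "is_coproduct C I M S \<iota>"
proof -
  obtain J :: "'k set" and \<sigma> where J: "small \<kappa> J" and \<sigma>: "bij_betw \<sigma> J I"
    using small_reindex[OF I] .
  let ?\<tau> = "inv_into J \<sigma>"
  have \<tau>: "bij_betw ?\<tau> I J" by (rule bij_betw_inv_into[OF \<sigma>])
  have "\<forall>j\<in>J. (M \<circ> \<sigma>) j \<in> Obj C" using M \<sigma> by (auto simp: bij_betw_def)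
  then obtain S \<iota> where "is_coproduct C J (M \<circ> \<sigma>) S \<iota>"
    using C J unfolding has_small_coproducts_def by blast
  then have S: "is_coproduct C I (M \<circ> \<sigma> \<circ> ?\<tau>) S (\<iota> \<circ> ?\<tau>)"
    using coproduct_reindex[OF \<tau>, of "M \<circ> \<sigma>" S \<iota>] by simp
  show thesis
    by (rule that, rule coproduct_cong[OF S])
      (use bij_betw_inv_into_right[OF \<sigma>] in auto)
qed

lemma closed_under_small_coproductsD:
  assumes U: "closed_under_small_coproducts (\<kappa> :: 'k rel) C U" and I: "small \<kappa> I"
    and S: "is_coproduct C I M S \<iota>" and M: "\<And>i. i \<in> I \<Longrightarrow> M i \<in> U"
  shows "S \<in> U"
proof -
  obtain J :: "'k set" and \<sigma> where J: "small \<kappa> J" and \<sigma>: "bij_betw \<sigma> J I"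
    using small_reindex[OF I] .
  have "is_coproduct C J (M \<circ> \<sigma>) S (\<iota> \<circ> \<sigma>)" using coproduct_reindex[OF \<sigma>] S by blast
  moreover have "\<forall>j\<in>J. (M \<circ> \<sigma>) j \<in> U" using M \<sigma> by (auto simp: bij_betw_def)
  ultimately show ?thesis using U J unfolding closed_under_small_coproducts_def by blast
qed

lemma Sum_ofI:
  assumes I: "small (\<kappa> :: 'k rel) I" and S: "is_coproduct C I M S \<iota>" and M: "\<And>i. i \<in> I \<Longrightarrow> M i \<in> Q"
  shows "S \<in> Sum_of \<kappa> C Q"
proof -
  obtain J :: "'k set" and \<sigma> where J: "small \<kappa> J" and \<sigma>: "bij_betw \<sigma> J I"
    using small_reindex[OF I] .
  have "is_coproduct C J (M \<circ> \<sigma>) S (\<iota> \<circ> \<sigma>)" using coproduct_reindex[OF \<sigma>] S by blast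
  moreover have "\<forall>j\<in>J. (M \<circ> \<sigma>) j \<in> Q" using M \<sigma> by (auto simp: bij_betw_def)
  ultimately show ?thesis using J unfolding Sum_of_def by blast
qed

lemma Sum_of_obj: "Sum_of \<kappa> C Q \<subseteq> Obj C"
  unfolding Sum_of_def using coproduct_obj by blast

lemma Sum_of_closed:
  assumes \<kappa>: "universe_cardinal (\<kappa> :: 'k rel)"
  shows "closed_under_small_coproducts \<kappa> C (Sum_of \<kappa> C Q)"
  unfolding closed_under_small_coproducts_def
proof (intro allI impI)
  fix I :: "'k set" and N S \<iota>
  assume *: "small \<kappa> I \<and> (\<forall>i\<in>I. N i \<in> Sum_of \<kappa> C Q) \<and> is_coproduct C I N S \<iota>"
  then have "\<forall>i\<in>I. \<exists>T. case T of (K :: 'k set, M, \<rho>) \<Rightarrow>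
      small \<kappa> K \<and> (\<forall>k\<in>K. M k \<in> Q) \<and> is_coproduct C K M (N i) \<rho>"
    by (auto simp: Sum_of_def)
  then obtain T where T: "\<forall>i\<in>I. case T i of (K :: 'k set, M, \<rho>) \<Rightarrow>
      small \<kappa> K \<and> (\<forall>k\<in>K. M k \<in> Q) \<and> is_coproduct C K M (N i) \<rho>"
    by (rule bchoice[THEN exE])
  define K where "K = (\<lambda>i. fst (T i))"
  define M where "M = (\<lambda>i. fst (snd (T i)))"
  define \<rho> where "\<rho> = (\<lambda>i. snd (snd (T i)))"
  have KM: "small \<kappa> (K i)" "\<And>k. k \<in> K i \<Longrightarrow> M i k \<in> Q" "is_coproduct C (K i) (M i) (N i) (\<rho> i)"
    if "i \<in> I" for i
    using T that by (auto simp: K_def M_def \<rho>_def split_beta)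
  have "is_coproduct C (Sigma I K) (\<lambda>(i, k). M i k) S (\<lambda>(i, k). \<iota> i \<odot> \<rho> i k)"
    by (rule coproduct_of_coproducts) (use * KM in auto)
  then show "S \<in> Sum_of \<kappa> C Q"
    by (rule Sum_ofI[rotated]) (use * KM in \<open>auto intro!: small_Sigma[OF \<kappa>]\<close>)
qed

lemma Sum_of_superset:
  assumes \<kappa>: "universe_cardinal \<kappa>" and Q: "Q \<subseteq> Obj C"
  shows "Q \<subseteq> Sum_of \<kappa> C Q"
proof
  fix X assume X: "X \<in> Q"
  show "X \<in> Sum_of \<kappa> C Q"
    by (rule Sum_ofI[OF small_nat[OF \<kappa>] coproduct_singleton[of X 0]]) (use X Q in auto)
qed

lemma finitary_small:
  assumes P: "\<And>J :: 'k set. small (\<kappa> :: 'k rel) J \<Longrightarrow> finitary C U J P" and I: "small \<kappa> I"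
  shows "finitary C U I P"
proof -
  obtain J :: "'k set" and \<sigma> where "small \<kappa> J" "bij_betw \<sigma> J I"
    using small_reindex[OF I] .
  then show ?thesis using finitary_reindex[OF P] by blast
qed

end

section \<open>The shift\<close>

text \<open>The properties that pass from one object to all of its shifts in both directions:
  negative shifts, determined only up to isomorphism, are reached by the equivalence in the last
  clause.\<close>

definition shift_closed :: "('o, 'm, 'z) tri_data_scheme \<Rightarrow> 'o set \<Rightarrow> bool"
  where "shift_closed D U \<longleftrightarrow> U \<subseteq> Obj D \<and> (\<forall>X Y. isomorphic D X Y \<and> X \<in> U \<longrightarrow> Y \<in> U) \<and>
    (\<forall>X\<in>Obj D. ShO D X \<in> U \<longleftrightarrow> X \<in> U)"

lemma triangulated_imp_shift_closed: "triangulated_subcategory D U \<Longrightarrow> shift_closed D U"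
  unfolding triangulated_subcategory_def shift_closed_def by (elim conjE, intro conjI) assumption+

context preadditive_category
begin

lemma zero_object_iff: "zero_object C Z \<longleftrightarrow> Z \<in> Obj C \<and> Ident C Z = Zero C Z Z"
proof
  assume "zero_object C Z"
  then show "Z \<in> Obj C \<and> Ident C Z = Zero C Z Z"
    unfolding zero_object_def by (metis ident_hom zero_hom)
next
  assume Z: "Z \<in> Obj C \<and> Ident C Z = Zero C Z Z"
  have "f = Zero C Z X" if "f \<in> Hom C Z X" for f X
    using comp_ident[OF that] comp_zero[OF that] Z by simp
  moreover have "f = Zero C X Z" if "f \<in> Hom C X Z" for f X
    using ident_comp[OF that] zero_comp[OF that] Z by simp
  ultimately show "zero_object C Z"
    unfolding zero_object_def using Z zero_hom by (metis (no_types))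
qed

lemma from_zero_object: "zero_object C Z \<Longrightarrow> f \<in> Hom C Z X \<Longrightarrow> f = Zero C Z X"
  using comp_ident[of f Z X] comp_zero[of f Z X Z] by (simp add: zero_object_iff)

end

context triangulated_category
begin

lemma shift_hom: "f \<in> Hom D X Y \<Longrightarrow> ShM D f \<in> Hom D (ShO D X) (ShO D Y)"
  using bij_betwE[OF shift_fully_faithful[OF hom_obj]] by blast

lemma shift_inj: "f \<in> Hom D X Y \<Longrightarrow> f' \<in> Hom D X Y \<Longrightarrow> ShM D f = ShM D f' \<Longrightarrow> f = f'"
  using bij_betw_imp_inj_on[OF shift_fully_faithful[OF hom_obj]] by (meson inj_onD)

lemma shift_full:
  assumes "X \<in> Obj D" "Y \<in> Obj D" "g \<in> Hom D (ShO D X) (ShO D Y)"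
  obtains f where "f \<in> Hom D X Y" "ShM D f = g"
proof -
  have "g \<in> ShM D ` Hom D X Y"
    using assms(3) shift_fully_faithful[OF assms(1,2)] by (simp add: bij_betw_def)
  then show thesis using that by blast
qed

lemma shift_zero:
  assumes "X \<in> Obj D" "Y \<in> Obj D"
  shows "ShM D (Zero D X Y) = Zero D (ShO D X) (ShO D Y)"
proof -
  have z: "Zero D X Y \<in> Hom D X Y" by (rule zero_hom[OF assms])
  show ?thesis
    using plus_eq_self_imp_zero[OF shift_hom[OF z] shift_hom[OF z]] shift_plus[OF z z] zero_plus[OF z]
    by simp
qed

lemma shift_eq_zero:
  assumes "f \<in> Hom D X Y" "ShM D f = Zero D (ShO D X) (ShO D Y)"
  shows "f = Zero D X Y"
  using assms shift_inj[OF assms(1) zero_hom] shift_zero hom_obj by metis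

lemma shift_zero_object: "zero_object D Z \<Longrightarrow> zero_object D (ShO D Z)"
  using shift_zero[of Z Z] shift_ident[of Z] shift_obj[of Z] by (auto simp: zero_object_iff)

lemma shift_isomorphism:
  assumes "isomorphism D a X Y"
  shows "isomorphism D (ShM D a) (ShO D X) (ShO D Y)"
proof -
  obtain b where ab: "a \<in> Hom D X Y" "b \<in> Hom D Y X" "b \<odot> a = Ident D X" "a \<odot> b = Ident D Y"
    using assms by (rule isomorphismE)
  show ?thesis
    by (rule isomorphismI[OF shift_hom[OF ab(1)] shift_hom[OF ab(2)]])
      (use shift_comp[OF ab(1,2)] shift_comp[OF ab(2,1)] ab(3,4) shift_ident hom_obj[OF ab(1)] in auto)
qed

lemma shift_isomorphic_iff:
  assumes X: "X \<in> Obj D" and Y: "Y \<in> Obj D"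
  shows "isomorphic D (ShO D X) (ShO D Y) \<longleftrightarrow> isomorphic D X Y"
proof
  assume "isomorphic D X Y" then show "isomorphic D (ShO D X) (ShO D Y)"
    using shift_isomorphism by (auto simp: isomorphic_def)
next
  assume "isomorphic D (ShO D X) (ShO D Y)"
  then obtain a b where ab: "a \<in> Hom D (ShO D X) (ShO D Y)" "b \<in> Hom D (ShO D Y) (ShO D X)"
    "b \<odot> a = Ident D (ShO D X)" "a \<odot> b = Ident D (ShO D Y)" by (rule isomorphicE)
  obtain a' where a': "a' \<in> Hom D X Y" "ShM D a' = a" using shift_full[OF X Y ab(1)] .
  obtain b' where b': "b' \<in> Hom D Y X" "ShM D b' = b" using shift_full[OF Y X ab(2)] .
  have "b' \<odot> a' = Ident D X"
    by (rule shift_inj[OF comp_hom[OF a'(1) b'(1)] ident_hom[OF X]])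
      (use shift_comp[OF a'(1) b'(1)] a'(2) b'(2) ab(3) shift_ident[OF X] in simp)
  moreover have "a' \<odot> b' = Ident D Y"
    by (rule shift_inj[OF comp_hom[OF b'(1) a'(1)] ident_hom[OF Y]])
      (use shift_comp[OF b'(1) a'(1)] a'(2) b'(2) ab(4) shift_ident[OF Y] in simp)
  ultimately show "isomorphic D X Y" by (rule isomorphicI[OF a'(1) b'(1)])
qed

lemma shift_closed_Obj: "shift_closed D (Obj D)"
  unfolding shift_closed_def using isomorphic_obj shift_obj by blast

lemma shift_closed_iterate:
  assumes U: "shift_closed D U" and X: "X \<in> Obj D"
  shows "(ShO D ^^ n) X \<in> U \<longleftrightarrow> X \<in> U"
proof -
  have "(ShO D ^^ n) X \<in> Obj D \<and> ((ShO D ^^ n) X \<in> U \<longleftrightarrow> X \<in> U)"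
    by (induction n) (use X U shift_obj in \<open>auto simp: shift_closed_def\<close>)
  then show ?thesis by simp
qed

lemma iterate_shift_obj: "X \<in> Obj D \<Longrightarrow> (ShO D ^^ n) X \<in> Obj D"
  using shift_closed_iterate[OF shift_closed_Obj] by blast

lemma iterate_shift_isomorphic_iff:
  assumes "X \<in> Obj D" "Y \<in> Obj D"
  shows "isomorphic D ((ShO D ^^ n) X) ((ShO D ^^ n) Y) \<longleftrightarrow> isomorphic D X Y"
  using assms by (induction n) (auto simp: shift_isomorphic_iff iterate_shift_obj)

lemma shifts_subset:
  assumes U: "shift_closed D U" and P: "P \<in> U"
  shows "shifts D P \<subseteq> U"
proof
  fix Q assume "Q \<in> shifts D P"
  then obtain n where Q: "Q \<in> Obj D"
    "isomorphic D Q ((ShO D ^^ n) P) \<or> isomorphic D ((ShO D ^^ n) Q) P"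
    by (auto simp: shifts_def)
  have "P \<in> Obj D" using U P by (auto simp: shift_closed_def)
  then show "Q \<in> U"
    using Q shift_closed_iterate[OF U, of _ n] U P isomorphic_sym unfolding shift_closed_def by blast
qed

lemma shifts_refl: "P \<in> Obj D \<Longrightarrow> P \<in> shifts D P"
  unfolding shifts_def using isomorphic_refl by (auto intro: exI[of _ 0])

lemma shift_closed_shifts:
  assumes P: "P \<in> Obj D"
  shows "shift_closed D (shifts D P)"
  unfolding shift_closed_def
proof (intro conjI allI impI ballI)
  show "shifts D P \<subseteq> Obj D" by (auto simp: shifts_def)
next
  fix X Y assume *: "isomorphic D X Y \<and> X \<in> shifts D P"
  then obtain n where n: "isomorphic D X ((ShO D ^^ n) P) \<or> isomorphic D ((ShO D ^^ n) X) P"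
    by (auto simp: shifts_def)
  have Y: "isomorphic D Y X" "Y \<in> Obj D" "X \<in> Obj D" using * isomorphic_sym isomorphic_obj by auto
  then have "isomorphic D ((ShO D ^^ n) Y) ((ShO D ^^ n) X)"
    using iterate_shift_isomorphic_iff by simp
  then show "Y \<in> shifts D P"
    using n Y isomorphic_trans unfolding shifts_def by blast
next
  fix X assume X: "X \<in> Obj D"
  show "ShO D X \<in> shifts D P \<longleftrightarrow> X \<in> shifts D P"
  proof
    assume "X \<in> shifts D P"
    then obtain n where "isomorphic D X ((ShO D ^^ n) P) \<or> isomorphic D ((ShO D ^^ n) X) P"
      by (auto simp: shifts_def)
    then have "isomorphic D (ShO D X) ((ShO D ^^ Suc n) P) \<or> isomorphic D ((ShO D ^^ n) (ShO D X)) (ShO D P)"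
      using X P by (simp add: shift_isomorphic_iff iterate_shift_obj flip: funpow_swap1)
    moreover have "isomorphic D (ShO D X) ((ShO D ^^ 1) P)"
      if "isomorphic D ((ShO D ^^ n) (ShO D X)) (ShO D P)" "n = 0" using that by simp
    moreover have "isomorphic D ((ShO D ^^ m) (ShO D X)) P"
      if "isomorphic D ((ShO D ^^ n) (ShO D X)) (ShO D P)" "n = Suc m" for m
      using that X P by (simp add: shift_isomorphic_iff iterate_shift_obj shift_obj)
    ultimately show "ShO D X \<in> shifts D P"
      unfolding shifts_def using shift_obj[OF X] by (cases n) blast+
  next
    assume "ShO D X \<in> shifts D P"
    then obtain n where "isomorphic D (ShO D X) ((ShO D ^^ n) P) \<or> isomorphic D ((ShO D ^^ n) (ShO D X)) P"
      by (auto simp: shifts_def)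
    moreover have "isomorphic D X ((ShO D ^^ m) P)"
      if "isomorphic D (ShO D X) ((ShO D ^^ n) P)" "n = Suc m" for m
      using that X P by (simp add: shift_isomorphic_iff iterate_shift_obj)
    moreover have "isomorphic D ((ShO D ^^ 1) X) P"
      if "isomorphic D (ShO D X) ((ShO D ^^ n) P)" "n = 0" using that by simp
    moreover have "isomorphic D ((ShO D ^^ Suc n) X) P" if "isomorphic D ((ShO D ^^ n) (ShO D X)) P"
      using that by (simp add: funpow_swap1)
    ultimately show "X \<in> shifts D P"
      unfolding shifts_def using X by (cases n) blast+
  qed
qed

text \<open>The substitute for the inverse shift, by essential surjectivity.\<close>

lemma shift_closed_unshift:
  assumes U: "shift_closed D U" and X: "X \<in> U"
  obtains X' a where "X' \<in> U" "isomorphism D a (ShO D X') X"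
proof -
  have "X \<in> Obj D" using U X by (auto simp: shift_closed_def)
  then obtain X' a where *: "X' \<in> Obj D" "isomorphism D a (ShO D X') X"
    using shift_ess_surj[of X] unfolding isomorphic_def by blast
  then have "isomorphic D X (ShO D X')" using isomorphic_sym by (auto simp: isomorphic_def)
  then have "X' \<in> U" using U X *(1) unfolding shift_closed_def by blast
  then show thesis using that * by blast
qed

subsection \<open>Coproducts and finite sums under the shift\<close>

text \<open>Replace the target by an isomorphic shifted object; full faithfulness then turns
  families out of the shifted summands into families out of the original ones.\<close>

lemma coproduct_shift:
  assumes S: "is_coproduct D I M S \<iota>"
  shows "is_coproduct D I (\<lambda>i. ShO D (M i)) (ShO D S) (\<lambda>i. ShM D (\<iota> i))"
proof -
  note \<iota> = coproduct_inj[OF S] and SO = coproduct_obj[OF S] and MO = coproduct_summand_obj[OF S]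
  show ?thesis
  proof (rule coproductI)
    fix X \<phi> assume X: "X \<in> Obj D" and \<phi>: "\<And>i. i \<in> I \<Longrightarrow> \<phi> i \<in> Hom D (ShO D (M i)) X"
    obtain X' e where X': "X' \<in> Obj D" "isomorphism D e (ShO D X') X"
      using shift_closed_unshift[OF shift_closed_Obj X] .
    obtain e' where e: "e \<in> Hom D (ShO D X') X" "e' \<in> Hom D X (ShO D X')"
      "e' \<odot> e = Ident D (ShO D X')" "e \<odot> e' = Ident D X"
      using X'(2) by (rule isomorphismE)
    have "\<exists>\<psi>. \<psi> \<in> Hom D (M i) X' \<and> ShM D \<psi> = e' \<odot> \<phi> i" if i: "i \<in> I" for i
      using shift_full[OF MO[OF i] X'(1) comp_hom[OF \<phi>[OF i] e(2)]] by blast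
    then have "\<forall>i\<in>I. \<exists>\<psi>. \<psi> \<in> Hom D (M i) X' \<and> ShM D \<psi> = e' \<odot> \<phi> i" ..
    then obtain \<psi> where "\<forall>i\<in>I. \<psi> i \<in> Hom D (M i) X' \<and> ShM D (\<psi> i) = e' \<odot> \<phi> i"
      by (rule bchoice[THEN exE])
    then have \<psi>: "\<And>i. i \<in> I \<Longrightarrow> \<psi> i \<in> Hom D (M i) X'" "\<And>i. i \<in> I \<Longrightarrow> ShM D (\<psi> i) = e' \<odot> \<phi> i"
      by simp_all
    obtain h where h: "h \<in> Hom D S X'" "\<And>i. i \<in> I \<Longrightarrow> h \<odot> \<iota> i = \<psi> i"
      using coproduct_copair[OF S X'(1) \<psi>(1)] by blast
    have "(e \<odot> ShM D h) \<odot> ShM D (\<iota> i) = \<phi> i" if i: "i \<in> I" for i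
    proof -
      have "(e \<odot> ShM D h) \<odot> ShM D (\<iota> i) = e \<odot> ShM D (h \<odot> \<iota> i)"
        using comp_assoc[OF shift_hom[OF \<iota>[OF i]] shift_hom[OF h(1)] e(1)] shift_comp[OF \<iota>[OF i] h(1)]
        by simp
      then show ?thesis using h(2)[OF i] \<psi>(2)[OF i] cancel_left[OF \<phi>[OF i] e(2,1,4)] by simp
    qed
    then show "\<exists>h\<in>Hom D (ShO D S) X. \<forall>i\<in>I. h \<odot> ShM D (\<iota> i) = \<phi> i"
      using comp_hom[OF shift_hom[OF h(1)] e(1)] by blast
  next
    fix X h h' assume h: "h \<in> Hom D (ShO D S) X" "h' \<in> Hom D (ShO D S) X"
      and eq: "\<And>i. i \<in> I \<Longrightarrow> h \<odot> ShM D (\<iota> i) = h' \<odot> ShM D (\<iota> i)"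
    have X: "X \<in> Obj D" using hom_obj[OF h(1)] by simp
    obtain X' e where X': "X' \<in> Obj D" "isomorphism D e (ShO D X') X"
      using shift_closed_unshift[OF shift_closed_Obj X] .
    obtain e' where e: "e \<in> Hom D (ShO D X') X" "e' \<in> Hom D X (ShO D X')"
      "e' \<odot> e = Ident D (ShO D X')" "e \<odot> e' = Ident D X"
      using X'(2) by (rule isomorphismE)
    obtain k where k: "k \<in> Hom D S X'" "ShM D k = e' \<odot> h"
      using shift_full[OF SO X'(1) comp_hom[OF h(1) e(2)]] .
    obtain k' where k': "k' \<in> Hom D S X'" "ShM D k' = e' \<odot> h'"
      using shift_full[OF SO X'(1) comp_hom[OF h(2) e(2)]] .
    have "k = k'"
    proof (rule coproduct_eqI[OF S k(1) k'(1)])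
      fix i assume i: "i \<in> I"
      have "ShM D (k \<odot> \<iota> i) = ShM D (k' \<odot> \<iota> i)"
        using shift_comp[OF \<iota>[OF i] k(1)] shift_comp[OF \<iota>[OF i] k'(1)] k(2) k'(2)
          comp_assoc[OF shift_hom[OF \<iota>[OF i]] h(1) e(2)] comp_assoc[OF shift_hom[OF \<iota>[OF i]] h(2) e(2)]
          eq[OF i] by simp
      then show "k \<odot> \<iota> i = k' \<odot> \<iota> i"
        by (rule shift_inj[OF comp_hom[OF \<iota>[OF i] k(1)] comp_hom[OF \<iota>[OF i] k'(1)]])
    qed
    then show "h = h'"
      using k(2) k'(2) cancel_left[OF h(1) e(2,1,4)] cancel_left[OF h(2) e(2,1,4)] by simp
  qed (use shift_obj[OF SO] shift_hom[OF \<iota>] in auto)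
qed

lemma coproduct_unshift:
  assumes S: "is_coproduct D I (\<lambda>i. ShO D (M i)) (ShO D S) (\<lambda>i. ShM D (\<iota> i))"
    and SO: "S \<in> Obj D" and \<iota>: "\<And>i. i \<in> I \<Longrightarrow> \<iota> i \<in> Hom D (M i) S"
  shows "is_coproduct D I M S \<iota>"
proof (rule coproductI[OF SO \<iota>])
  fix X \<phi> assume X: "X \<in> Obj D" and \<phi>: "\<And>i. i \<in> I \<Longrightarrow> \<phi> i \<in> Hom D (M i) X"
  obtain h where h: "h \<in> Hom D (ShO D S) (ShO D X)" "\<And>i. i \<in> I \<Longrightarrow> h \<odot> ShM D (\<iota> i) = ShM D (\<phi> i)"
    using coproduct_copair[OF S shift_obj[OF X] shift_hom[OF \<phi>]] by blast
  obtain k where k: "k \<in> Hom D S X" "ShM D k = h" using shift_full[OF SO X h(1)] .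
  have "k \<odot> \<iota> i = \<phi> i" if i: "i \<in> I" for i
    by (rule shift_inj[OF comp_hom[OF \<iota>[OF i] k(1)] \<phi>[OF i]])
      (use shift_comp[OF \<iota>[OF i] k(1)] k(2) h(2)[OF i] in simp)
  then show "\<exists>h\<in>Hom D S X. \<forall>i\<in>I. h \<odot> \<iota> i = \<phi> i" using k(1) by blast
next
  fix X h h' assume h: "h \<in> Hom D S X" "h' \<in> Hom D S X"
    and eq: "\<And>i. i \<in> I \<Longrightarrow> h \<odot> \<iota> i = h' \<odot> \<iota> i"
  have "ShM D h = ShM D h'"
  proof (rule coproduct_eqI[OF S shift_hom[OF h(1)] shift_hom[OF h(2)]])
    fix i assume i: "i \<in> I"
    show "ShM D h \<odot> ShM D (\<iota> i) = ShM D h' \<odot> ShM D (\<iota> i)"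
      using shift_comp[OF \<iota>[OF i] h(1)] shift_comp[OF \<iota>[OF i] h(2)] eq[OF i] by simp
  qed
  then show "h = h'" by (rule shift_inj[OF h])
qed

lemma finite_sums_shift:
  assumes S: "is_coproduct D I M S \<iota>" and Q: "Q \<in> Obj D" and u: "u \<in> finite_sums D Q I M S \<iota>"
  shows "ShM D u \<in> finite_sums D (ShO D Q) I (\<lambda>i. ShO D (M i)) (ShO D S) (\<lambda>i. ShM D (\<iota> i))"
  using u
proof induction
  case zero show ?case
    using finite_sums.zero[of D "ShO D Q" "ShO D S" I "\<lambda>i. ShO D (M i)" "\<lambda>i. ShM D (\<iota> i)"]
      shift_zero[OF Q coproduct_obj[OF S]] by simp
next
  case (plus u i \<phi>)
  note \<iota> = coproduct_inj[OF S plus.hyps(2)]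
  show ?case
    using finite_sums.plus[OF plus.IH plus.hyps(2) shift_hom[OF plus.hyps(3)]]
      shift_comp[OF plus.hyps(3) \<iota>]
      shift_plus[OF finite_sums_hom[OF S Q plus.hyps(1)] comp_hom[OF plus.hyps(3) \<iota>]] by simp
qed

lemma finite_sums_unshift:
  assumes S: "is_coproduct D I M S \<iota>" and Q: "Q \<in> Obj D"
    and v: "v \<in> finite_sums D (ShO D Q) I (\<lambda>i. ShO D (M i)) (ShO D S) (\<lambda>i. ShM D (\<iota> i))"
  shows "\<exists>u\<in>finite_sums D Q I M S \<iota>. ShM D u = v"
  using v
proof induction
  case zero
  show ?case using finite_sums.zero shift_zero[OF Q coproduct_obj[OF S]] by (intro bexI)
next
  case (plus v i \<phi>)
  note \<iota> = coproduct_inj[OF S plus.hyps(2)]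
  obtain u where u: "u \<in> finite_sums D Q I M S \<iota>" "ShM D u = v" using plus.IH by blast
  obtain \<psi> where \<psi>: "\<psi> \<in> Hom D Q (M i)" "ShM D \<psi> = \<phi>"
    using shift_full[OF Q coproduct_summand_obj[OF S plus.hyps(2)] plus.hyps(3)] .
  have "ShM D (Plus D u (\<iota> i \<odot> \<psi>)) = Plus D v (ShM D (\<iota> i) \<odot> \<phi>)"
    using shift_plus[OF finite_sums_hom[OF S Q u(1)] comp_hom[OF \<psi>(1) \<iota>]] shift_comp[OF \<psi>(1) \<iota>] u(2) \<psi>(2)
    by simp
  then show ?case using finite_sums.plus[OF u(1) plus.hyps(2) \<psi>(1)] by (intro bexI)
qed

lemma finitary_isomorphic:
  assumes fin: "finitary D U I P" and iso: "isomorphic D P Q"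
  shows "finitary D U I Q"
  unfolding finitary_def
proof (intro allI impI subsetI)
  fix M S \<iota> v assume *: "(\<forall>i\<in>I. M i \<in> U) \<and> is_coproduct D I M S \<iota>" and v: "v \<in> Hom D Q S"
  obtain a b where ab: "a \<in> Hom D P Q" "b \<in> Hom D Q P" "b \<odot> a = Ident D P" "a \<odot> b = Ident D Q"
    using iso by (rule isomorphicE)
  have "v \<odot> a \<in> finite_sums D P I M S \<iota>"
    using finitaryD[OF fin _ _ comp_hom[OF ab(1) v]] * by blast
  then have "(v \<odot> a) \<odot> b \<in> finite_sums D Q I M S \<iota>"
    using finite_sums_comp[OF _ _ ab(2)] * by blast
  then show "v \<in> finite_sums D Q I M S \<iota>"
    using cancel_right[OF v ab(1,2,4)] by simp
qed

text \<open>One direction shifts a coproduct. For the other, the summands and the vertex of a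
  coproduct are replaced by isomorphic shifted objects, so that the whole diagram is the shift of
  a coproduct diagram.\<close>

lemma finitary_shift_iff:
  assumes U: "shift_closed D U" and Q: "Q \<in> Obj D"
  shows "finitary D U I (ShO D Q) \<longleftrightarrow> finitary D U I Q"
proof
  have UO: "U \<subseteq> Obj D" using U by (simp add: shift_closed_def)
  show "finitary D U I Q" if fin: "finitary D U I (ShO D Q)"
    unfolding finitary_def
  proof (intro allI impI subsetI)
    fix M S \<iota> u assume *: "(\<forall>i\<in>I. M i \<in> U) \<and> is_coproduct D I M S \<iota>" and u: "u \<in> Hom D Q S"
    then have S: "is_coproduct D I M S \<iota>" by simp
    have "ShO D (M i) \<in> U" if "i \<in> I" for i
      using U * that coproduct_summand_obj[OF S that] by (simp add: shift_closed_def)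
    then have "ShM D u \<in> finite_sums D (ShO D Q) I (\<lambda>i. ShO D (M i)) (ShO D S) (\<lambda>i. ShM D (\<iota> i))"
      using finitaryD[OF fin coproduct_shift[OF S] _ shift_hom[OF u]] by blast
    then obtain v where v: "v \<in> finite_sums D Q I M S \<iota>" "ShM D v = ShM D u"
      using finite_sums_unshift[OF S Q] by blast
    then have "v = u" using shift_inj[OF finite_sums_hom[OF S Q v(1)] u] by simp
    then show "u \<in> finite_sums D Q I M S \<iota>" using v(1) by simp
  qed
  show "finitary D U I (ShO D Q)" if fin: "finitary D U I Q"
    unfolding finitary_def
  proof (intro allI impI subsetI)
    fix M S \<iota> u assume *: "(\<forall>i\<in>I. M i \<in> U) \<and> is_coproduct D I M S \<iota>" and u: "u \<in> Hom D (ShO D Q) S"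
    then have S: "is_coproduct D I M S \<iota>" by simp
    note \<iota> = coproduct_inj[OF S]
    have "\<forall>i\<in>I. \<exists>T. fst T \<in> U \<and> isomorphism D (snd T) (ShO D (fst T)) (M i)"
    proof
      fix i assume "i \<in> I"
      then show "\<exists>T. fst T \<in> U \<and> isomorphism D (snd T) (ShO D (fst T)) (M i)"
        using shift_closed_unshift[OF U, of "M i"] * by (metis fst_conv snd_conv)
    qed
    then obtain T where T: "\<forall>i\<in>I. fst (T i) \<in> U \<and> isomorphism D (snd (T i)) (ShO D (fst (T i))) (M i)"
      by (rule bchoice[THEN exE])
    define N where "N = (\<lambda>i. fst (T i))"
    define a where "a = (\<lambda>i. snd (T i))"
    have N: "\<And>i. i \<in> I \<Longrightarrow> N i \<in> U" and a: "\<And>i. i \<in> I \<Longrightarrow> isomorphism D (a i) (ShO D (N i)) (M i)"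
      using T by (auto simp: N_def a_def)
    have ah: "\<And>i. i \<in> I \<Longrightarrow> a i \<in> Hom D (ShO D (N i)) (M i)"
      using a by (simp add: isomorphism_def)
    have NO: "\<And>i. i \<in> I \<Longrightarrow> N i \<in> Obj D" using N UO by blast
    obtain S' b where S': "S' \<in> Obj D" and b: "isomorphism D b (ShO D S') S"
      using shift_closed_unshift[OF shift_closed_Obj coproduct_obj[OF S]] .
    obtain c where bc: "b \<in> Hom D (ShO D S') S" "c \<in> Hom D S (ShO D S')"
      "c \<odot> b = Ident D (ShO D S')" "b \<odot> c = Ident D S" using b by (rule isomorphismE)
    have ci: "isomorphism D c S (ShO D S')" by (rule isomorphismI[OF bc(2,1,4,3)])
    have cop: "is_coproduct D I (\<lambda>i. ShO D (N i)) (ShO D S') (\<lambda>i. c \<odot> (\<iota> i \<odot> a i))"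
      by (rule coproduct_change_vertex[OF coproduct_change_summands[OF S a] ci])
    have "\<forall>i\<in>I. \<exists>j. j \<in> Hom D (N i) S' \<and> ShM D j = c \<odot> (\<iota> i \<odot> a i)"
    proof
      fix i assume i: "i \<in> I"
      show "\<exists>j. j \<in> Hom D (N i) S' \<and> ShM D j = c \<odot> (\<iota> i \<odot> a i)"
        using shift_full[OF NO[OF i] S' coproduct_inj[OF cop i]] by blast
    qed
    then obtain j where "\<forall>i\<in>I. j i \<in> Hom D (N i) S' \<and> ShM D (j i) = c \<odot> (\<iota> i \<odot> a i)"
      by (rule bchoice[THEN exE])
    then have j: "\<And>i. i \<in> I \<Longrightarrow> j i \<in> Hom D (N i) S'" "\<And>i. i \<in> I \<Longrightarrow> ShM D (j i) = c \<odot> (\<iota> i \<odot> a i)"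
      by simp_all
    have cop': "is_coproduct D I (\<lambda>i. ShO D (N i)) (ShO D S') (\<lambda>i. ShM D (j i))"
      by (rule coproduct_cong[OF cop]) (simp_all add: j(2))
    have N': "is_coproduct D I N S' j" by (rule coproduct_unshift[OF cop' S' j(1)])
    obtain w where w: "w \<in> Hom D Q S'" "ShM D w = c \<odot> u"
      using shift_full[OF Q S' comp_hom[OF u bc(2)]] .
    have w': "w \<in> finite_sums D Q I N S' j" using finitaryD[OF fin N' N w(1)] .
    have sw: "ShM D w \<in> finite_sums D (ShO D Q) I (\<lambda>i. ShO D (N i)) (ShO D S') (\<lambda>i. ShM D (j i))"
      by (rule finite_sums_shift[OF N' Q w'])
    have "b \<odot> ShM D w \<in> finite_sums D (ShO D Q) I M S \<iota>"
    proof (rule finite_sums_map[OF cop' S bc(1) _ shift_obj[OF Q] sw])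
      fix i \<phi> assume i: "i \<in> I" and \<phi>: "\<phi> \<in> Hom D (ShO D Q) (ShO D (N i))"
      have "ShM D (j i) \<odot> \<phi> = c \<odot> ((\<iota> i \<odot> a i) \<odot> \<phi>)"
        using j(2)[OF i] comp_assoc[OF \<phi> comp_hom[OF ah[OF i] \<iota>[OF i]] bc(2)] by simp
      then have "b \<odot> (ShM D (j i) \<odot> \<phi>) = \<iota> i \<odot> (a i \<odot> \<phi>)"
        using cancel_left[OF comp_hom[OF \<phi> comp_hom[OF ah[OF i] \<iota>[OF i]]] bc(2,1,4)]
          comp_assoc[OF \<phi> ah[OF i] \<iota>[OF i]] by simp
      then show "b \<odot> (ShM D (j i) \<odot> \<phi>) \<in> finite_sums D (ShO D Q) I M S \<iota>"
        using finite_sums_inj[OF S i comp_hom[OF \<phi> ah[OF i]]] by simp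
    qed
    then show "u \<in> finite_sums D (ShO D Q) I M S \<iota>"
      using w(2) cancel_left[OF u bc(2,1,4)] by simp
  qed
qed

lemma finitary_shifts:
  assumes U: "shift_closed D U" and P: "P \<in> Obj D" and fin: "finitary D U I P" and Q: "Q \<in> shifts D P"
  shows "finitary D U I Q"
proof -
  have "shift_closed D {Q \<in> Obj D. finitary D U I Q}"
    unfolding shift_closed_def
    by (auto simp: finitary_shift_iff[OF U] shift_obj finitary_isomorphic dest: isomorphic_obj)
  from shifts_subset[OF this] show ?thesis using P fin Q by blast
qed

end

section \<open>Distinguished triangles\<close>

context triangulated_category
begin

lemma distinguished_homs:
  assumes "distinguished D X Y Z f g h"
  shows "f \<in> Hom D X Y" "g \<in> Hom D Y Z" "h \<in> Hom D Z (ShO D X)"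
  using assms by (auto simp: distinguished_def candidate_triangle_def)

lemma distinguished_rotate:
  assumes "distinguished D X Y Z f g h"
  shows "distinguished D Y Z (ShO D X) g h (Minus D (ShM D f))"
  using assms tri_rotate by (auto simp: distinguished_def)

lemma ex_zero_object': obtains Z where "zero_object D Z"
  using ex_zero_object by blast

text \<open>Compare with the trivial triangle on \<open>X\<close>: the composite factors through a
  zero object.\<close>

lemma distinguished_comp:
  assumes T: "distinguished D X Y Z f g h"
  shows "g \<odot> f = Zero D X Z"
proof -
  note h = distinguished_homs[OF T]
  have X: "X \<in> Obj D" and Z: "Z \<in> Obj D" using hom_obj h by blast+
  obtain O0 where O: "zero_object D O0" by (rule ex_zero_object')
  obtain c where c: "c \<in> Hom D O0 Z" "c \<odot> Zero D X O0 = g \<odot> f"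
    using tri_fill[OF tri_ident[OF X O] T ident_hom[OF X] h(1)] by auto
  then show ?thesis using comp_zero[OF c(1) X] by simp
qed

lemma distinguished_comp':
  assumes T: "distinguished D X Y Z f g h"
  shows "h \<odot> g = Zero D Y (ShO D X)" "ShM D f \<odot> h = Zero D Z (ShO D Y)"
proof -
  note h = distinguished_homs[OF T]
  show "h \<odot> g = Zero D Y (ShO D X)" by (rule distinguished_comp[OF distinguished_rotate[OF T]])
  have "Minus D (ShM D f) \<odot> h = Zero D Z (ShO D Y)"
    by (rule distinguished_comp[OF distinguished_rotate[OF distinguished_rotate[OF T]]])
  then have "Minus D (ShM D f \<odot> h) = Zero D Z (ShO D Y)"
    using minus_comp[OF h(3) shift_hom[OF h(1)]] by simp
  then show "ShM D f \<odot> h = Zero D Z (ShO D Y)"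
    using minus_minus[OF comp_hom[OF h(3) shift_hom[OF h(1)]]] minus_zero
      hom_obj[OF comp_hom[OF h(3) shift_hom[OF h(1)]]] by metis
qed

text \<open>Fill a morphism from the triangle \<open>W \<rightarrow> 0 \<rightarrow> W[1]\<close>
  to the rotated triangle. The filler is the shift of the lift up to the signs that both rotations
  introduce, and these cancel.\<close>

lemma distinguished_lift:
  assumes T: "distinguished D X Y Z f g h" and v: "v \<in> Hom D W Y" and 0: "g \<odot> v = Zero D W Z"
  obtains w where "w \<in> Hom D W X" "f \<odot> w = v"
proof -
  note h = distinguished_homs[OF T]
  have W: "W \<in> Obj D" and X: "X \<in> Obj D" and Z: "Z \<in> Obj D" using hom_obj v h by blast+
  obtain O0 where O: "zero_object D O0" by (rule ex_zero_object')
  then have OO: "O0 \<in> Obj D" by (simp add: zero_object_iff)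
  have "Zero D O0 Z \<odot> Zero D W O0 = g \<odot> v"
    using 0 comp_zero[OF zero_hom[OF OO Z] W] by simp
  then obtain c where c: "c \<in> Hom D (ShO D W) (ShO D X)"
    "ShM D v \<odot> Minus D (ShM D (Ident D W)) = Minus D (ShM D f) \<odot> c"
    using tri_fill[OF distinguished_rotate[OF tri_ident[OF W O]] distinguished_rotate[OF T] v
        zero_hom[OF OO Z]] by auto
  obtain w where w: "w \<in> Hom D W X" "ShM D w = c" using shift_full[OF W X c(1)] .
  have "Minus D (ShM D v) = Minus D (ShM D (f \<odot> w))"
    using c(2) comp_minus[OF shift_hom[OF ident_hom[OF W]] shift_hom[OF v]] shift_comp[OF ident_hom[OF W] v]
      comp_ident[OF v] minus_comp[OF c(1) shift_hom[OF h(1)]] shift_comp[OF w(1) h(1)] w(2) by simp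
  then have "Minus D (Minus D (ShM D v)) = Minus D (Minus D (ShM D (f \<odot> w)))" by (rule arg_cong)
  then have "ShM D v = ShM D (f \<odot> w)"
    by (simp only: minus_minus[OF shift_hom[OF v]] minus_minus[OF shift_hom[OF comp_hom[OF w(1) h(1)]]])
  then have "f \<odot> w = v" using shift_inj[OF v comp_hom[OF w(1) h(1)]] by simp
  then show thesis using that w(1) by blast
qed

text \<open>The triangle \<open>0 \<rightarrow> W \<rightarrow> W\<close> that receives the map
  comes from the trivial one by rotating backwards; its third morphism needs a shifted zero
  object.\<close>

lemma distinguished_extend:
  assumes T: "distinguished D X Y Z f g h" and v: "v \<in> Hom D Y W" and 0: "v \<odot> f = Zero D X W"
  obtains w where "w \<in> Hom D Z W" "w \<odot> g = v"
proof -
  note h = distinguished_homs[OF T]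
  have W: "W \<in> Obj D" and X: "X \<in> Obj D" using hom_obj v h by blast+
  obtain O0 where O: "zero_object D O0" by (rule ex_zero_object')
  then have OO: "O0 \<in> Obj D" and SO: "zero_object D (ShO D O0)"
    using shift_zero_object by (auto simp: zero_object_iff)
  have "distinguished D W W (ShO D O0) (Ident D W) (Zero D W (ShO D O0)) (Zero D (ShO D O0) (ShO D W))"
    by (rule tri_ident[OF W SO])
  moreover have "Zero D (ShO D O0) (ShO D W) = Minus D (ShM D (Zero D O0 W))"
    using shift_zero[OF OO W] minus_zero[OF shift_obj[OF OO] shift_obj[OF W]] by simp
  ultimately have T0: "distinguished D O0 W W (Zero D O0 W) (Ident D W) (Zero D W (ShO D O0))"
    using tri_rotate[of O0 W W "Zero D O0 W" "Ident D W" "Zero D W (ShO D O0)"]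
      zero_hom[OF OO W] ident_hom[OF W] zero_hom[OF W shift_obj[OF OO]]
    by (simp add: candidate_triangle_def)
  have "v \<odot> f = Zero D O0 W \<odot> Zero D X O0"
    using 0 comp_zero[OF zero_hom[OF OO W] X] by simp
  then obtain c where "c \<in> Hom D Z W" "c \<odot> g = Ident D W \<odot> v"
    using tri_fill[OF T T0 zero_hom[OF X OO] v] by auto
  then show thesis using that ident_comp[OF v] by simp
qed

text \<open>The canonical maps of the triangles into the triangle on a cone of
  \<open>\<Coprod> a\<^sub>i\<close> are completed by morphisms out of the objects
  \<open>C i\<close>. They induce a morphism out of \<open>\<Coprod> C\<^sub>i\<close> through
  which the map to the cone factors, so whatever \<open>\<Coprod> b\<^sub>i\<close> kills also
  dies in the cone, and the morphism lifts along \<open>\<Coprod> a\<^sub>i\<close>.\<close>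

lemma coproduct_of_triangles_lift:
  assumes T: "\<And>i. i \<in> I \<Longrightarrow> distinguished D (A i) (B i) (C i) (a i) (b i) (c i)"
    and A: "is_coproduct D I A SA \<alpha>" and B: "is_coproduct D I B SB \<beta>" and C: "is_coproduct D I C SC \<gamma>"
    and a: "sa \<in> Hom D SA SB" "\<And>i. i \<in> I \<Longrightarrow> sa \<odot> \<alpha> i = \<beta> i \<odot> a i"
    and b: "sb \<in> Hom D SB SC" "\<And>i. i \<in> I \<Longrightarrow> sb \<odot> \<beta> i = \<gamma> i \<odot> b i"
    and v: "v \<in> Hom D W SB" and 0: "sb \<odot> v = Zero D W SC"
  obtains w where "w \<in> Hom D W SA" "sa \<odot> w = v"
proof -
  obtain Z g h where Z: "distinguished D SA SB Z sa g h" using tri_cone[OF a(1)] by blast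
  note gh = distinguished_homs[OF Z]
  have ZO: "Z \<in> Obj D" using hom_obj[OF gh(2)] by simp
  have "\<forall>i\<in>I. \<exists>k. k \<in> Hom D (C i) Z \<and> k \<odot> b i = g \<odot> \<beta> i"
  proof
    fix i assume i: "i \<in> I"
    show "\<exists>k. k \<in> Hom D (C i) Z \<and> k \<odot> b i = g \<odot> \<beta> i"
      using tri_fill[OF T[OF i] Z coproduct_inj[OF A i] coproduct_inj[OF B i]] a(2)[OF i] by auto
  qed
  then obtain k where "\<forall>i\<in>I. k i \<in> Hom D (C i) Z \<and> k i \<odot> b i = g \<odot> \<beta> i"
    by (rule bchoice[THEN exE])
  then have k: "\<And>i. i \<in> I \<Longrightarrow> k i \<in> Hom D (C i) Z" "\<And>i. i \<in> I \<Longrightarrow> k i \<odot> b i = g \<odot> \<beta> i"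
    by simp_all
  obtain sk where sk: "sk \<in> Hom D SC Z" "\<And>i. i \<in> I \<Longrightarrow> sk \<odot> \<gamma> i = k i"
    using coproduct_copair[OF C ZO k(1)] by blast
  have "sk \<odot> sb = g"
  proof (rule coproduct_eqI[OF B comp_hom[OF b(1) sk(1)] gh(2)])
    fix i assume i: "i \<in> I"
    have "(sk \<odot> sb) \<odot> \<beta> i = sk \<odot> (\<gamma> i \<odot> b i)"
      using comp_assoc[OF coproduct_inj[OF B i] b(1) sk(1)] b(2)[OF i] by simp
    also have "\<dots> = g \<odot> \<beta> i"
      using comp_assoc[OF distinguished_homs(2)[OF T[OF i]] coproduct_inj[OF C i] sk(1)] sk(2)[OF i] k(2)[OF i]
      by simp
    finally show "(sk \<odot> sb) \<odot> \<beta> i = g \<odot> \<beta> i" .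
  qed
  then have "g \<odot> v = Zero D W Z"
    using comp_assoc[OF v b(1) sk(1)] 0 comp_zero[OF sk(1) hom_obj(1)[OF v]] by simp
  then show thesis using distinguished_lift[OF Z v] that by blast
qed

text \<open>The obstruction to a lift is a morphism from \<open>Q\<close> to \<open>X[1]\<close>
  that \<open>f[1]\<close> kills. Writing \<open>Q\<close> as a shift inside the class, it is the
  shift of a morphism that \<open>f\<close> kills.\<close>

lemma cone_lift:
  assumes T: "distinguished D X Y Z f g h" and U: "shift_closed D U"
    and inj: "\<And>Q x. Q \<in> U \<Longrightarrow> x \<in> Hom D Q X \<Longrightarrow> f \<odot> x = Zero D Q Y \<Longrightarrow> x = Zero D Q X"
    and Q: "Q \<in> U" and v: "v \<in> Hom D Q Z"
  obtains w where "w \<in> Hom D Q Y" "g \<odot> w = v"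
proof -
  note h = distinguished_homs[OF T]
  obtain Q' e where Q': "Q' \<in> U" and e: "isomorphism D e (ShO D Q') Q"
    using shift_closed_unshift[OF U Q] .
  obtain e' where e: "e \<in> Hom D (ShO D Q') Q" "e' \<in> Hom D Q (ShO D Q')"
    "e' \<odot> e = Ident D (ShO D Q')" "e \<odot> e' = Ident D Q" using e by (rule isomorphismE)
  have QO: "Q' \<in> Obj D" using U Q' by (auto simp: shift_closed_def)
  have X: "X \<in> Obj D" and Y: "Y \<in> Obj D" using hom_obj[OF h(1)] by auto
  have hv: "h \<odot> v \<in> Hom D Q (ShO D X)" by (rule comp_hom[OF v h(3)])
  obtain x where x: "x \<in> Hom D Q' X" "ShM D x = (h \<odot> v) \<odot> e"
    using shift_full[OF QO X comp_hom[OF e(1) hv]] .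
  have "ShM D f \<odot> ((h \<odot> v) \<odot> e) = (ShM D f \<odot> h) \<odot> (v \<odot> e)"
    using comp_assoc[OF e(1) v h(3)] comp_assoc[OF comp_hom[OF e(1) v] h(3) shift_hom[OF h(1)]] by simp
  also have "\<dots> = Zero D (ShO D Q') (ShO D Y)"
    using distinguished_comp'(2)[OF T] zero_comp[OF comp_hom[OF e(1) v] shift_obj[OF Y]] by simp
  finally have "ShM D (f \<odot> x) = Zero D (ShO D Q') (ShO D Y)"
    using shift_comp[OF x(1) h(1)] x(2) by simp
  then have "f \<odot> x = Zero D Q' Y" by (rule shift_eq_zero[OF comp_hom[OF x(1) h(1)]])
  then have "x = Zero D Q' X" by (rule inj[OF Q' x(1)])
  then have "(h \<odot> v) \<odot> e = Zero D (ShO D Q') (ShO D X)"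
    using x(2) shift_zero[OF QO X] by simp
  then have "h \<odot> v = Zero D Q (ShO D X)"
    using cancel_right[OF hv e(1,2,4)] zero_comp[OF e(2) shift_obj[OF X]] by simp
  then show thesis using distinguished_lift[OF distinguished_rotate[OF T] v] that by blast
qed

text \<open>A morphism to the cone lifts to \<open>Y\<close> by injectivity and from there to
  \<open>X\<close> by surjectivity, and two consecutive morphisms of a triangle compose to
  zero.\<close>

lemma cone_orthogonal:
  assumes T: "distinguished D X Y Z f g h" and U: "shift_closed D U"
    and inj: "\<And>Q x. Q \<in> U \<Longrightarrow> x \<in> Hom D Q X \<Longrightarrow> f \<odot> x = Zero D Q Y \<Longrightarrow> x = Zero D Q X"
    and surj: "\<And>Q y. Q \<in> U \<Longrightarrow> y \<in> Hom D Q Y \<Longrightarrow> \<exists>x\<in>Hom D Q X. f \<odot> x = y"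
    and Q: "Q \<in> U" and v: "v \<in> Hom D Q Z"
  shows "v = Zero D Q Z"
proof -
  note h = distinguished_homs[OF T]
  obtain y where y: "y \<in> Hom D Q Y" "g \<odot> y = v" using cone_lift[OF T U inj Q v] by blast
  obtain x where x: "x \<in> Hom D Q X" "f \<odot> x = y" using surj[OF Q y(1)] by blast
  have "v = (g \<odot> f) \<odot> x" using comp_assoc[OF x(1) h(1,2)] x(2) y(2) by simp
  then show ?thesis using distinguished_comp[OF T] zero_comp[OF x(1) hom_obj(2)[OF h(2)]] by simp
qed

end

section \<open>The subcategory generated by an object and its orthogonal\<close>

context triangulated_category
begin

lemma Hom_eq_zero_iff:
  "X \<in> Obj D \<Longrightarrow> Y \<in> Obj D \<Longrightarrow> Hom D X Y = {Zero D X Y} \<longleftrightarrow> (\<forall>u\<in>Hom D X Y. u = Zero D X Y)"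
  using zero_hom by blast

lemma Hom_eq_zero_shift_iff:
  assumes X: "X \<in> Obj D" and Y: "Y \<in> Obj D"
  shows "Hom D (ShO D X) (ShO D Y) = {Zero D (ShO D X) (ShO D Y)} \<longleftrightarrow> Hom D X Y = {Zero D X Y}"
proof -
  have im: "Hom D (ShO D X) (ShO D Y) = ShM D ` Hom D X Y"
    using shift_fully_faithful[OF X Y] by (simp add: bij_betw_def)
  have "Hom D (ShO D X) (ShO D Y) = {Zero D (ShO D X) (ShO D Y)}
      \<longleftrightarrow> (\<forall>u\<in>Hom D (ShO D X) (ShO D Y). u = Zero D (ShO D X) (ShO D Y))"
    by (rule Hom_eq_zero_iff[OF shift_obj[OF X] shift_obj[OF Y]])
  also have "\<dots> \<longleftrightarrow> (\<forall>u\<in>Hom D X Y. ShM D u = Zero D (ShO D X) (ShO D Y))"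
    unfolding im by blast
  also have "\<dots> \<longleftrightarrow> (\<forall>u\<in>Hom D X Y. u = Zero D X Y)"
    using shift_eq_zero[of _ X Y] shift_zero[OF X Y] by metis
  also have "\<dots> \<longleftrightarrow> Hom D X Y = {Zero D X Y}"
    by (rule Hom_eq_zero_iff[OF X Y, symmetric])
  finally show ?thesis .
qed

lemma Hom_eq_zero_isomorphic:
  assumes XX: "isomorphic D X X'" and YY: "isomorphic D Y Y'" and 0: "Hom D X Y = {Zero D X Y}"
  shows "Hom D X' Y' = {Zero D X' Y'}"
proof -
  obtain a a' where a: "a \<in> Hom D X X'" "a' \<in> Hom D X' X" "a' \<odot> a = Ident D X" "a \<odot> a' = Ident D X'"
    using XX by (rule isomorphicE)
  obtain b b' where b: "b \<in> Hom D Y Y'" "b' \<in> Hom D Y' Y" "b' \<odot> b = Ident D Y" "b \<odot> b' = Ident D Y'"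
    using YY by (rule isomorphicE)
  have "u = Zero D X' Y'" if u: "u \<in> Hom D X' Y'" for u
  proof -
    have "b' \<odot> (u \<odot> a) = Zero D X Y" using comp_hom[OF comp_hom[OF a(1) u] b(2)] 0 by simp
    then have "u \<odot> a = Zero D X Y'"
      using cancel_left[OF comp_hom[OF a(1) u] b(2,1,4)] comp_zero[OF b(1) hom_obj(1)[OF a(1)]] by simp
    then show ?thesis
      using cancel_right[OF u a(1,2,4)] zero_comp[OF a(2) hom_obj(2)[OF u]] by simp
  qed
  then show ?thesis using isomorphic_obj[OF XX] isomorphic_obj[OF YY] Hom_eq_zero_iff by blast
qed

lemma triangulated_subcategory_Obj: "triangulated_subcategory D (Obj D)"
  unfolding triangulated_subcategory_def
  by (auto simp: zero_object_iff shift_obj dest: isomorphic_obj distinguished_homs(2) hom_obj(2))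

lemma triangulated_subcategory_Inter:
  assumes ne: "\<U> \<noteq> {}" and t: "\<And>U. U \<in> \<U> \<Longrightarrow> triangulated_subcategory D U"
  shows "triangulated_subcategory D (\<Inter>\<U>)"
proof -
  have *: "U \<subseteq> Obj D" "\<And>Z. zero_object D Z \<Longrightarrow> Z \<in> U"
    "\<And>X Y. isomorphic D X Y \<Longrightarrow> X \<in> U \<Longrightarrow> Y \<in> U"
    "\<And>X. X \<in> Obj D \<Longrightarrow> ShO D X \<in> U \<longleftrightarrow> X \<in> U"
    "\<And>X Y Z f g h. distinguished D X Y Z f g h \<Longrightarrow> X \<in> U \<Longrightarrow> Y \<in> U \<Longrightarrow> Z \<in> U"
    if "U \<in> \<U>" for U
    using t[OF that] unfolding triangulated_subcategory_def by blast+
  show ?thesis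
    unfolding triangulated_subcategory_def
  proof (intro conjI allI impI ballI)
    show "\<Inter>\<U> \<subseteq> Obj D" using ne *(1) by blast
  next
    fix Z assume "zero_object D Z" then show "Z \<in> \<Inter>\<U>" using *(2) by blast
  next
    fix X Y assume "isomorphic D X Y \<and> X \<in> \<Inter>\<U>" then show "Y \<in> \<Inter>\<U>" using *(3)[of _ X Y] by blast
  next
    fix X assume "X \<in> Obj D" then show "ShO D X \<in> \<Inter>\<U> \<longleftrightarrow> X \<in> \<Inter>\<U>" using *(4)[of _ X] by blast
  next
    fix X Y Z f g h assume "distinguished D X Y Z f g h \<and> X \<in> \<Inter>\<U> \<and> Y \<in> \<Inter>\<U>"
    then show "Z \<in> \<Inter>\<U>" using *(5)[of _ X Y Z f g h] by blast
  qed
qed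

lemma Tria_triangulated:
  assumes P: "P \<in> Obj D"
  shows "triangulated_subcategory D (Tria \<kappa> D P)"
  unfolding Tria_def
proof (rule triangulated_subcategory_Inter)
  have "closed_under_small_coproducts \<kappa> D (Obj D)"
    unfolding closed_under_small_coproducts_def using coproduct_obj by blast
  then show "{U. triangulated_subcategory D U \<and> closed_under_small_coproducts \<kappa> D U \<and> P \<in> U} \<noteq> {}"
    using triangulated_subcategory_Obj P by blast
qed simp

lemma Tria_closed: "closed_under_small_coproducts (\<kappa> :: 'k rel) D (Tria \<kappa> D P)"
  unfolding closed_under_small_coproducts_def
proof (intro allI impI)
  fix I :: "'k set" and M S \<iota>
  assume *: "small \<kappa> I \<and> (\<forall>i\<in>I. M i \<in> Tria \<kappa> D P) \<and> is_coproduct D I M S \<iota>"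
  show "S \<in> Tria \<kappa> D P"
    unfolding Tria_def
  proof (rule InterI)
    fix U assume U: "U \<in> {U. triangulated_subcategory D U \<and> closed_under_small_coproducts \<kappa> D U \<and> P \<in> U}"
    then have "\<forall>i\<in>I. M i \<in> U" using * by (auto simp: Tria_def)
    then show "S \<in> U" using U * unfolding closed_under_small_coproducts_def by blast
  qed
qed

lemma Tria_self: "P \<in> Tria \<kappa> D P"
  by (simp add: Tria_def)

lemma Tria_least:
  "triangulated_subcategory D U \<Longrightarrow> closed_under_small_coproducts \<kappa> D U \<Longrightarrow> P \<in> U
    \<Longrightarrow> Tria \<kappa> D P \<subseteq> U"
  by (auto simp: Tria_def)

lemma shifts_subset_Tria: "P \<in> Obj D \<Longrightarrow> shifts D P \<subseteq> Tria \<kappa> D P"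
  by (rule shifts_subset[OF triangulated_imp_shift_closed[OF Tria_triangulated] Tria_self])

text \<open>A morphism from the third object of a triangle vanishes on the second, hence comes
  from \<open>X[1]\<close>; as the class is closed under shifts in both directions, such morphisms
  are zero as well.\<close>

lemma left_orthogonal_triangulated:
  assumes W: "shift_closed D W"
  shows "triangulated_subcategory D {X \<in> Obj D. \<forall>M\<in>W. Hom D X M = {Zero D X M}}"
    (is "triangulated_subcategory D ?U")
proof -
  have WO: "W \<subseteq> Obj D" using W by (simp add: shift_closed_def)
  have shift: "ShO D X \<in> ?U \<longleftrightarrow> X \<in> ?U" if X: "X \<in> Obj D" for X
  proof -
    have "Hom D X M = {Zero D X M}" if XU: "ShO D X \<in> ?U" and M: "M \<in> W" for M
    proof -
      have MO: "M \<in> Obj D" using M WO by blast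
      have "ShO D M \<in> W" using W M MO by (simp add: shift_closed_def)
      then show ?thesis using XU Hom_eq_zero_shift_iff[OF X MO] by simp
    qed
    moreover have "Hom D (ShO D X) M = {Zero D (ShO D X) M}" if XU: "X \<in> ?U" and M: "M \<in> W" for M
    proof -
      obtain M' a where M': "M' \<in> W" "isomorphism D a (ShO D M') M"
        using shift_closed_unshift[OF W M] .
      have "M' \<in> Obj D" using M' WO by blast
      then have "Hom D (ShO D X) (ShO D M') = {Zero D (ShO D X) (ShO D M')}"
        using XU M'(1) Hom_eq_zero_shift_iff[OF X] by simp
      moreover have "isomorphic D (ShO D M') M" using M'(2) by (auto simp: isomorphic_def)
      ultimately show ?thesis
        using Hom_eq_zero_isomorphic[OF isomorphic_refl[OF shift_obj[OF X]]] by blast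
    qed
    ultimately show ?thesis using X shift_obj[OF X] by (simp only: mem_Collect_eq) blast
  qed
  show ?thesis
    unfolding triangulated_subcategory_def
  proof (intro conjI allI impI ballI)
    show "?U \<subseteq> Obj D" by blast
  next
    fix X assume X: "X \<in> Obj D"
    show "ShO D X \<in> ?U \<longleftrightarrow> X \<in> ?U" by (rule shift[OF X])
  next
    fix Z assume Z: "zero_object D Z"
    have "Hom D Z M = {Zero D Z M}" if "M \<in> W" for M
      using from_zero_object[OF Z, of _ M] Hom_eq_zero_iff[of Z M] Z that WO
      by (auto simp: zero_object_iff simp del: singletonI)
    then show "Z \<in> ?U" using Z by (simp add: zero_object_iff)
  next
    fix X Y assume *: "isomorphic D X Y \<and> X \<in> ?U"
    have "Hom D Y M = {Zero D Y M}" if M: "M \<in> W" for M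
      by (rule Hom_eq_zero_isomorphic[of X Y M M]) (use * M WO isomorphic_refl in auto)
    then show "Y \<in> ?U" using * isomorphic_obj by blast
  next
    fix X Y Z f g h assume *: "distinguished D X Y Z f g h \<and> X \<in> ?U \<and> Y \<in> ?U"
    then have T: "distinguished D X Y Z f g h" and X: "X \<in> Obj D" by auto
    note h = distinguished_homs[OF T]
    have Z: "Z \<in> Obj D" using hom_obj[OF h(2)] by simp
    have "v = Zero D Z M" if M: "M \<in> W" and v: "v \<in> Hom D Z M" for M v
    proof -
      have MO: "M \<in> Obj D" using M WO by blast
      have "Hom D Y M = {Zero D Y M}" using * M by blast
      then have "v \<odot> g = Zero D Y M" using comp_hom[OF h(2) v] by simp
      then obtain w where w: "w \<in> Hom D (ShO D X) M" "w \<odot> h = v"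
        using distinguished_extend[OF distinguished_rotate[OF T] v] by blast
      have "Hom D (ShO D X) M = {Zero D (ShO D X) M}" using shift[OF X] * M by blast
      then have "w = Zero D (ShO D X) M" using w(1) by simp
      then show ?thesis using w(2) zero_comp[OF h(3) MO] by simp
    qed
    then have "Hom D Z M = {Zero D Z M}" if "M \<in> W" for M
      using that Z WO Hom_eq_zero_iff[of Z M] by blast
    then show "Z \<in> ?U" using Z by simp
  qed
qed

lemma left_orthogonal_closed_coproducts:
  assumes W: "W \<subseteq> Obj D"
  shows "closed_under_small_coproducts \<kappa> D {X \<in> Obj D. \<forall>M\<in>W. Hom D X M = {Zero D X M}}"
  unfolding closed_under_small_coproducts_def
proof (intro allI impI)
  fix I M S \<iota>
  assume *: "small \<kappa> I \<and> (\<forall>i\<in>I. M i \<in> {X \<in> Obj D. \<forall>M\<in>W. Hom D X M = {Zero D X M}})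
    \<and> is_coproduct D I M S \<iota>"
  then have S: "is_coproduct D I M S \<iota>" by simp
  have SO: "S \<in> Obj D" by (rule coproduct_obj[OF S])
  have "u = Zero D S N" if N: "N \<in> W" and u: "u \<in> Hom D S N" for N u
  proof (rule coproduct_eqI[OF S u])
    show "Zero D S N \<in> Hom D S N" using zero_hom SO N W by blast
    fix i assume i: "i \<in> I"
    have "Hom D (M i) N = {Zero D (M i) N}" using * i N by blast
    then have "u \<odot> \<iota> i = Zero D (M i) N" using comp_hom[OF coproduct_inj[OF S i] u] by simp
    then show "u \<odot> \<iota> i = Zero D S N \<odot> \<iota> i"
      using zero_comp[OF coproduct_inj[OF S i]] N W by auto
  qed
  then have "Hom D S N = {Zero D S N}" if "N \<in> W" for N
    using that SO W Hom_eq_zero_iff[of S N] by blast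
  then show "S \<in> {X \<in> Obj D. \<forall>M\<in>W. Hom D X M = {Zero D X M}}"
    using SO by simp
qed

text \<open>A shift of \<open>M\<close> can be moved to an opposite shift of
  \<open>Q\<close>.\<close>

lemma orthogonal_shifts_swap:
  assumes P: "P \<in> Obj D" and M: "M \<in> Obj D"
    and 0: "\<And>Q. Q \<in> shifts D P \<Longrightarrow> Hom D Q M = {Zero D Q M}"
    and M': "M' \<in> shifts D M" and Q: "Q \<in> shifts D P"
  shows "Hom D Q M' = {Zero D Q M'}"
proof -
  note sc = shift_closed_shifts[OF P]
  have PO: "shifts D P \<subseteq> Obj D" using sc by (simp add: shift_closed_def)
  let ?V = "{N \<in> Obj D. \<forall>Q\<in>shifts D P. Hom D Q N = {Zero D Q N}}"
  have "shift_closed D ?V"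
    unfolding shift_closed_def
  proof (intro conjI allI impI ballI)
    fix X Y assume *: "isomorphic D X Y \<and> X \<in> ?V"
    have "Hom D Q Y = {Zero D Q Y}" if Q: "Q \<in> shifts D P" for Q
      by (rule Hom_eq_zero_isomorphic[of Q Q X Y]) (use * Q PO isomorphic_refl in auto)
    then show "Y \<in> ?V" using * isomorphic_obj by blast
  next
    fix X assume X: "X \<in> Obj D"
    have "Hom D Q X = {Zero D Q X}" if XV: "ShO D X \<in> ?V" and Q: "Q \<in> shifts D P" for Q
    proof -
      have QO: "Q \<in> Obj D" using Q PO by blast
      then have "ShO D Q \<in> shifts D P" using sc Q by (simp add: shift_closed_def)
      then show ?thesis using XV Hom_eq_zero_shift_iff[OF QO X] by simp
    qed
    moreover have "Hom D Q (ShO D X) = {Zero D Q (ShO D X)}" if XV: "X \<in> ?V" and Q: "Q \<in> shifts D P" for Q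
    proof -
      obtain Q' a where Q': "Q' \<in> shifts D P" "isomorphism D a (ShO D Q') Q"
        using shift_closed_unshift[OF sc Q] .
      have "Q' \<in> Obj D" using Q' PO by blast
      then have "Hom D (ShO D Q') (ShO D X) = {Zero D (ShO D Q') (ShO D X)}"
        using XV Q'(1) Hom_eq_zero_shift_iff[OF _ X] by simp
      moreover have "isomorphic D (ShO D Q') Q" using Q'(2) by (auto simp: isomorphic_def)
      ultimately show ?thesis
        using Hom_eq_zero_isomorphic[OF _ isomorphic_refl[OF shift_obj[OF X]]] by blast
    qed
    ultimately show "ShO D X \<in> ?V \<longleftrightarrow> X \<in> ?V" using X shift_obj[OF X] by (simp only: mem_Collect_eq) blast
  qed blast
  then have "shifts D M \<subseteq> ?V" by (rule shifts_subset) (use M 0 in blast)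
  then show ?thesis using M' Q by blast
qed

text \<open>The objects without nonzero morphisms to shifts of \<open>M\<close> form a
  triangulated subcategory closed under coproducts; when it contains \<open>P\<close>, it contains
  everything that \<open>P\<close> generates. So orthogonality to the generated subcategory is
  tested on the shifts of \<open>P\<close>.\<close>

lemma perp_Tria:
  assumes P: "P \<in> Obj D"
  shows "perp D (Tria \<kappa> D P) = {M \<in> Obj D. \<forall>Q\<in>shifts D P. Hom D Q M = {Zero D Q M}}"
proof (intro equalityI subsetI)
  fix M assume "M \<in> perp D (Tria \<kappa> D P)"
  then show "M \<in> {M \<in> Obj D. \<forall>Q\<in>shifts D P. Hom D Q M = {Zero D Q M}}"
    using shifts_subset_Tria[OF P] unfolding perp_def by blast
next
  fix M assume "M \<in> {M \<in> Obj D. \<forall>Q\<in>shifts D P. Hom D Q M = {Zero D Q M}}"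
  then have M: "M \<in> Obj D" and 0: "\<And>Q. Q \<in> shifts D P \<Longrightarrow> Hom D Q M = {Zero D Q M}" by auto
  let ?U = "{X \<in> Obj D. \<forall>N\<in>shifts D M. Hom D X N = {Zero D X N}}"
  have "Tria \<kappa> D P \<subseteq> ?U"
  proof (rule Tria_least)
    show "triangulated_subcategory D ?U"
      by (rule left_orthogonal_triangulated[OF shift_closed_shifts[OF M]])
    show "closed_under_small_coproducts \<kappa> D ?U"
      by (rule left_orthogonal_closed_coproducts) (auto simp: shifts_def)
    show "P \<in> ?U" using P orthogonal_shifts_swap[OF P M 0 _ shifts_refl[OF P]] by blast
  qed
  then show "M \<in> perp D (Tria \<kappa> D P)" unfolding perp_def using M shifts_refl[OF M] by blast
qed

end

section \<open>Sequential telescopes\<close>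

context preadditive_category
begin

lemma finite_sums_zero:
  assumes S: "is_coproduct C I M S \<iota>" and P: "P \<in> Obj C" and g: "g \<in> Hom C S X"
    and 0: "\<And>i \<phi>. i \<in> I \<Longrightarrow> \<phi> \<in> Hom C P (M i) \<Longrightarrow> g \<odot> (\<iota> i \<odot> \<phi>) = Zero C P X"
    and u: "u \<in> finite_sums C P I M S \<iota>"
  shows "g \<odot> u = Zero C P X"
  using u
proof induction
  case zero show ?case by (rule comp_zero[OF g P])
next
  case (plus u i \<phi>)
  then show ?case
    using comp_plus[OF finite_sums_hom[OF S P plus.hyps(1)] comp_hom[OF plus.hyps(3) coproduct_inj[OF S plus.hyps(2)]] g]
      0[OF plus.hyps(2,3)] zero_plus[OF zero_hom[OF P hom_obj(2)[OF g]]] by simp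
qed

lemma finite_sums_induced:
  assumes S: "is_coproduct C I M S \<iota>" and S': "is_coproduct C I N S' \<iota>'"
    and f: "\<And>i. i \<in> I \<Longrightarrow> f i \<in> Hom C (M i) (N i)"
    and h: "h \<in> Hom C S S'" "\<And>i. i \<in> I \<Longrightarrow> h \<odot> \<iota> i = \<iota>' i \<odot> f i"
    and P: "P \<in> Obj C" and u: "u \<in> finite_sums C P I M S \<iota>"
  shows "h \<odot> u \<in> finite_sums C P I N S' \<iota>'"
proof (rule finite_sums_map[OF S S' h(1) _ P u])
  fix i \<phi> assume i: "i \<in> I" and \<phi>: "\<phi> \<in> Hom C P (M i)"
  have "h \<odot> (\<iota> i \<odot> \<phi>) = \<iota>' i \<odot> (f i \<odot> \<phi>)"
    using comp_assoc[OF \<phi> coproduct_inj[OF S i] h(1)] comp_assoc[OF \<phi> f[OF i] coproduct_inj[OF S' i]]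
      h(2)[OF i] by simp
  then show "h \<odot> (\<iota> i \<odot> \<phi>) \<in> finite_sums C P I N S' \<iota>'"
    using finite_sums_inj[OF S' i comp_hom[OF \<phi> f[OF i]]] by simp
qed

lemma coproduct_induced:
  assumes S: "is_coproduct C I M S \<iota>" and S': "is_coproduct C I N S' \<iota>'"
    and f: "\<And>i. i \<in> I \<Longrightarrow> f i \<in> Hom C (M i) (N i)"
  obtains h where "h \<in> Hom C S S'" "\<And>i. i \<in> I \<Longrightarrow> h \<odot> \<iota> i = \<iota>' i \<odot> f i"
  using coproduct_copair[OF S coproduct_obj[OF S'], of "\<lambda>i. \<iota>' i \<odot> f i"]
    comp_hom[OF f coproduct_inj[OF S']] by blast

lemma finite_sums_bounded:
  assumes N: "is_coproduct C (UNIV :: nat set) X N \<iota>" and P: "P \<in> Obj C"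
    and \<pi>: "\<And>j. j \<in> UNIV \<Longrightarrow> \<pi> j \<in> Hom C N (X j)" "\<And>j. j \<in> UNIV \<Longrightarrow> \<pi> j \<odot> \<iota> j = Ident C (X j)"
      "\<And>i j. i \<in> UNIV \<Longrightarrow> j \<in> UNIV \<Longrightarrow> i \<noteq> j \<Longrightarrow> \<pi> j \<odot> \<iota> i = Zero C (X i) (X j)"
    and u: "u \<in> finite_sums C P UNIV X N \<iota>"
  shows "\<exists>K. \<forall>k\<ge>K. \<pi> k \<odot> u = Zero C P (X k)"
  using u
proof induction
  case zero show ?case using comp_zero[OF \<pi>(1) P] by simp
next
  case (plus u i \<phi>)
  then obtain K where K: "\<forall>k\<ge>K. \<pi> k \<odot> u = Zero C P (X k)" by blast
  have "\<pi> k \<odot> Plus C u (\<iota> i \<odot> \<phi>) = Zero C P (X k)" if k: "k \<ge> max K (Suc i)" for k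
  proof -
    have XO: "X k \<in> Obj C" using hom_obj[OF \<pi>(1)[of k]] by simp
    have "\<pi> k \<odot> (\<iota> i \<odot> \<phi>) = Zero C P (X k)"
      using comp_assoc[OF plus.hyps(3) coproduct_inj[OF N] \<pi>(1), of k] \<pi>(3)[of i k] k
        zero_comp[OF plus.hyps(3) XO] by simp
    then show ?thesis
      using comp_plus[OF finite_sums_hom[OF N P plus.hyps(1)] comp_hom[OF plus.hyps(3) coproduct_inj[OF N]] \<pi>(1), of k]
        K k zero_plus[OF zero_hom[OF P XO]] by simp
  qed
  then show ?case by blast
qed

lemma ex_telescope_shift:
  assumes N: "is_coproduct C (UNIV :: nat set) X N \<iota>"
    and m: "\<And>k. m k \<in> Hom C (X k) (X (Suc k))"
  obtains s where "s \<in> Hom C N N" "\<And>k. s \<odot> \<iota> k = \<iota> (Suc k) \<odot> m k"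
proof -
  have "\<iota> (Suc k) \<odot> m k \<in> Hom C (X k) N" for k
    using comp_hom[OF m coproduct_inj[OF N UNIV_I]] .
  then show thesis
    by (rule coproduct_copair[OF N coproduct_obj[OF N], of "\<lambda>k. \<iota> (Suc k) \<odot> m k"]) (rule that, simp_all)
qed

text \<open>Here \<open>s\<close> moves each stage of the telescope to the next, so that the
  homotopy colimit of the sequence is the cone of \<open>1 - s\<close>.\<close>

lemma telescope_projection:
  assumes N: "is_coproduct C (UNIV :: nat set) X N \<iota>"
    and m: "\<And>k. m k \<in> Hom C (X k) (X (Suc k))"
    and s: "s \<in> Hom C N N" "\<And>k. s \<odot> \<iota> k = \<iota> (Suc k) \<odot> m k"
    and \<pi>: "\<And>j. j \<in> UNIV \<Longrightarrow> \<pi> j \<in> Hom C N (X j)" "\<And>j. j \<in> UNIV \<Longrightarrow> \<pi> j \<odot> \<iota> j = Ident C (X j)"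
      "\<And>i j. i \<in> UNIV \<Longrightarrow> j \<in> UNIV \<Longrightarrow> i \<noteq> j \<Longrightarrow> \<pi> j \<odot> \<iota> i = Zero C (X i) (X j)"
  shows "\<pi> 0 \<odot> s = Zero C N (X 0)" "\<pi> (Suc k) \<odot> s = m k \<odot> \<pi> k"
proof -
  have \<iota>: "\<iota> k \<in> Hom C (X k) N" for k using coproduct_inj[OF N] by simp
  have \<pi>h: "\<pi> k \<in> Hom C N (X k)" for k using \<pi>(1) by simp
  have XO: "X k \<in> Obj C" for k using hom_obj[OF \<iota>] by simp
  have NO: "N \<in> Obj C" by (rule coproduct_obj[OF N])
  have \<pi>s: "(\<pi> j \<odot> s) \<odot> \<iota> l = (\<pi> j \<odot> \<iota> (Suc l)) \<odot> m l" for j l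
    using comp_assoc[OF \<iota> s(1) \<pi>h] comp_assoc[OF m \<iota> \<pi>h] s(2) by simp
  show "\<pi> 0 \<odot> s = Zero C N (X 0)"
  proof (rule coproduct_eqI[OF N comp_hom[OF s(1) \<pi>h] zero_hom[OF NO XO]])
    fix l :: nat
    show "(\<pi> 0 \<odot> s) \<odot> \<iota> l = Zero C N (X 0) \<odot> \<iota> l"
      using \<pi>s[of 0 l] \<pi>(3)[of "Suc l" 0] zero_comp[OF m XO] zero_comp[OF \<iota> XO] by simp
  qed
  show "\<pi> (Suc k) \<odot> s = m k \<odot> \<pi> k"
  proof (rule coproduct_eqI[OF N comp_hom[OF s(1) \<pi>h] comp_hom[OF \<pi>h m]])
    fix l :: nat
    have "(m k \<odot> \<pi> k) \<odot> \<iota> l = m k \<odot> (\<pi> k \<odot> \<iota> l)" by (rule comp_assoc[OF \<iota> \<pi>h m])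
    then show "(\<pi> (Suc k) \<odot> s) \<odot> \<iota> l = (m k \<odot> \<pi> k) \<odot> \<iota> l"
      using \<pi>s[of "Suc k" l] \<pi>(2)[of "Suc k"] \<pi>(3)[of "Suc l" "Suc k"] \<pi>(2)[of k] \<pi>(3)[of l k]
        ident_comp[OF m] comp_ident[OF m] zero_comp[OF m XO] comp_zero[OF m XO]
      by (cases "l = k") simp_all
  qed
qed

text \<open>A morphism fixed by \<open>s\<close> has component zero at the first stage, and each
  further component is the image of the preceding one. So all components vanish, and a finite sum
  is determined by them.\<close>

lemma telescope_inj:
  assumes N: "is_coproduct C (UNIV :: nat set) X N \<iota>"
    and m: "\<And>k. m k \<in> Hom C (X k) (X (Suc k))"
    and s: "s \<in> Hom C N N" "\<And>k. s \<odot> \<iota> k = \<iota> (Suc k) \<odot> m k"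
    and P: "P \<in> Obj C" and v: "v \<in> finite_sums C P UNIV X N \<iota>"
    and 0: "Plus C (Ident C N) (Minus C s) \<odot> v = Zero C P N"
  shows "v = Zero C P N"
proof -
  obtain \<pi> where \<pi>: "\<And>j. j \<in> UNIV \<Longrightarrow> \<pi> j \<in> Hom C N (X j)" "\<And>j. j \<in> UNIV \<Longrightarrow> \<pi> j \<odot> \<iota> j = Ident C (X j)"
      "\<And>i j. i \<in> UNIV \<Longrightarrow> j \<in> UNIV \<Longrightarrow> i \<noteq> j \<Longrightarrow> \<pi> j \<odot> \<iota> i = Zero C (X i) (X j)"
    using coproduct_projections[OF N] by blast
  have vh: "v \<in> Hom C P N" by (rule finite_sums_hom[OF N P v])
  have \<pi>h: "\<pi> k \<in> Hom C N (X k)" for k using \<pi>(1) by simp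
  have XO: "X k \<in> Obj C" for k using hom_obj[OF \<pi>h] by simp
  have vs: "v = s \<odot> v"
    using 0 sub_comp[OF vh ident_hom[OF coproduct_obj[OF N]] s(1)] ident_comp[OF vh]
    by (intro eq_if_plus_minus_zero[OF vh comp_hom[OF vh s(1)]]) simp
  note t = telescope_projection[OF N m s \<pi>]
  have "\<pi> k \<odot> v = Zero C P (X k)" for k
  proof (induction k)
    case 0
    have "\<pi> 0 \<odot> (s \<odot> v) = Zero C P (X 0)"
      using comp_assoc[OF vh s(1) \<pi>h[of 0]] t(1) zero_comp[OF vh XO[of 0]] by metis
    then show ?case using vs by simp
  next
    case (Suc k)
    have "\<pi> (Suc k) \<odot> (s \<odot> v) = m k \<odot> (\<pi> k \<odot> v)"
      using comp_assoc[OF vh s(1) \<pi>h[of "Suc k"]] t(2)[of k] comp_assoc[OF vh \<pi>h m, of k] by metis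
    then show ?case using vs Suc comp_zero[OF m P] by simp
  qed
  then show ?thesis by (intro finite_sums_eq_zero[OF N P v \<pi>]) auto
qed

end

section \<open>Covers by coproducts of shifts\<close>

locale small_coproduct_triangulated = triangulated_category D
  for D :: "('o, 'm, 'z) tri_data_scheme" (structure) +
  fixes \<kappa> :: "'k rel" and P :: 'o
  assumes cardinal: "universe_cardinal \<kappa>"
    and loc_small: "locally_small \<kappa> D"
    and coproducts: "has_small_coproducts \<kappa> D"
    and P: "P \<in> Obj D"
begin

abbreviation Sums :: "'o set"
  where "Sums \<equiv> Sum_of \<kappa> D (shifts D P)"

abbreviation Perp :: "'o set"
  where "Perp \<equiv> perp D (Tria \<kappa> D P)"

lemma shifts_obj: "Q \<in> shifts D P \<Longrightarrow> Q \<in> Obj D"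
  by (simp add: shifts_def)

text \<open>Negative shifts are known only up to isomorphism. Choosing one object \<open>Q\<close>
  with \<open>Q[m] \<cong> P[n]\<close> for each pair \<open>(m, n)\<close> covers the positive
  and the negative shifts with a single choice.\<close>

lemma shifts_representatives:
  obtains R where "small \<kappa> R" "R \<subseteq> shifts D P" "\<And>Q. Q \<in> shifts D P \<Longrightarrow> \<exists>X\<in>R. isomorphic D Q X"
proof -
  let ?is = "\<lambda>(m, n) Q. Q \<in> Obj D \<and> isomorphic D ((ShO D ^^ m) Q) ((ShO D ^^ n) P)"
  define g where "g = (\<lambda>p. SOME Q. ?is p Q)"
  define R where "R = g ` {p. \<exists>Q. ?is p Q}"
  have g: "?is p (g p)" if "\<exists>Q. ?is p Q" for p
    unfolding g_def by (rule someI_ex[OF that])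
  have "small \<kappa> (UNIV \<times> UNIV :: (nat \<times> nat) set)"
    by (rule small_Sigma[OF cardinal small_nat[OF cardinal] small_nat[OF cardinal]])
  then have 1: "small \<kappa> R" unfolding R_def by (intro small_image) (auto intro: small_mono)
  note sc = shift_closed_shifts[OF P]
  have 2: "R \<subseteq> shifts D P"
  proof
    fix X assume "X \<in> R"
    then obtain p where "\<exists>Q. ?is p Q" "X = g p" unfolding R_def by (elim imageE CollectE)
    then have "?is p X" using g by simp
    then obtain m n where "?is (m, n) X" by (cases p) auto
    then have X: "X \<in> Obj D" and iso: "isomorphic D ((ShO D ^^ m) X) ((ShO D ^^ n) P)" by simp_all
    have "(ShO D ^^ n) P \<in> shifts D P"
      using shift_closed_iterate[OF sc P] shifts_refl[OF P] by simp
    then have "(ShO D ^^ m) X \<in> shifts D P"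
      using sc isomorphic_sym[OF iso] unfolding shift_closed_def by blast
    then show "X \<in> shifts D P" using shift_closed_iterate[OF sc X] by simp
  qed
  have "\<exists>X\<in>R. isomorphic D Q X" if Q: "Q \<in> shifts D P" for Q
  proof -
    obtain n where n: "isomorphic D Q ((ShO D ^^ n) P) \<or> isomorphic D ((ShO D ^^ n) Q) P"
      using Q by (auto simp: shifts_def)
    have "\<exists>m n. isomorphic D ((ShO D ^^ m) Q) ((ShO D ^^ n) P)"
    proof (cases "isomorphic D Q ((ShO D ^^ n) P)")
      case True then show ?thesis by (intro exI[of _ 0] exI[of _ n]) simp
    next
      case False then show ?thesis using n by (intro exI[of _ n] exI[of _ 0]) simp
    qed
    then obtain m n where mn: "isomorphic D ((ShO D ^^ m) Q) ((ShO D ^^ n) P)" by blast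
    then have ex: "\<exists>Q. ?is (m, n) Q" using shifts_obj[OF Q] by auto
    then have "isomorphic D ((ShO D ^^ m) Q) ((ShO D ^^ m) (g (m, n)))" "g (m, n) \<in> Obj D"
      using g[OF ex] isomorphic_trans[OF mn] isomorphic_sym by auto
    then have "isomorphic D Q (g (m, n))"
      using iterate_shift_isomorphic_iff shifts_obj[OF Q] by simp
    then show ?thesis using ex unfolding R_def by blast
  qed
  then show thesis using that 1 2 by blast
qed

text \<open>The object \<open>T\<close> is the coproduct of the sources of all morphisms
  \<open>\<phi> : Q \<rightarrow> M\<close> with \<open>f \<odot> \<phi> = 0\<close>, where
  \<open>Q\<close> runs through representatives of the shifts. It is a small coproduct because the
  category is locally small.\<close>

lemma ex_kernel_cover:
  assumes f: "f \<in> Hom D M W"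
  obtains T t where "T \<in> Sums" "t \<in> Hom D T M" "f \<odot> t = Zero D T W"
    "\<And>Q \<phi>. Q \<in> shifts D P \<Longrightarrow> \<phi> \<in> Hom D Q M \<Longrightarrow> f \<odot> \<phi> = Zero D Q W \<Longrightarrow> \<exists>\<psi>\<in>Hom D Q T. t \<odot> \<psi> = \<phi>"
proof -
  have M: "M \<in> Obj D" and W: "W \<in> Obj D" using hom_obj[OF f] by auto
  obtain R where R: "small \<kappa> R" "R \<subseteq> shifts D P" "\<And>Q. Q \<in> shifts D P \<Longrightarrow> \<exists>X\<in>R. isomorphic D Q X"
    using shifts_representatives by blast
  have RO: "X \<in> Obj D" if "X \<in> R" for X using that R(2) shifts_obj by blast
  define I where "I = (SIGMA X:R. {\<phi> \<in> Hom D X M. f \<odot> \<phi> = Zero D X W})"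
  have "small \<kappa> (Hom D X M)" if "X \<in> R" for X
    using loc_small RO[OF that] M by (simp add: locally_small_def)
  then have "small \<kappa> {\<phi> \<in> Hom D X M. f \<odot> \<phi> = Zero D X W}" if "X \<in> R" for X
    by (rule small_mono) (use that in auto)
  then have I: "small \<kappa> I"
    unfolding I_def by (rule small_Sigma[OF cardinal R(1)])
  have "fst i \<in> Obj D" if "i \<in> I" for i using that RO by (auto simp: I_def)
  then obtain T \<tau> where T: "is_coproduct D I fst T \<tau>"
    using ex_small_coproduct[OF coproducts I] by blast
  have "snd i \<in> Hom D (fst i) M" if "i \<in> I" for i using that by (auto simp: I_def)
  then obtain t where t: "t \<in> Hom D T M" "\<And>i. i \<in> I \<Longrightarrow> t \<odot> \<tau> i = snd i"
    using coproduct_copair[OF T M, of snd] by blast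
  show thesis
  proof (rule that)
    show "T \<in> Sums" by (rule Sum_ofI[OF I T]) (use R(2) in \<open>auto simp: I_def\<close>)
    show "t \<in> Hom D T M" by (rule t(1))
    show "f \<odot> t = Zero D T W"
    proof (rule coproduct_eqI[OF T comp_hom[OF t(1) f] zero_hom[OF coproduct_obj[OF T] W]])
      fix i assume i: "i \<in> I"
      show "(f \<odot> t) \<odot> \<tau> i = Zero D T W \<odot> \<tau> i"
        using comp_assoc[OF coproduct_inj[OF T i] t(1) f] t(2)[OF i] zero_comp[OF coproduct_inj[OF T i] W] i
        by (auto simp: I_def)
    qed
    fix Q \<phi> assume Q: "Q \<in> shifts D P" and \<phi>: "\<phi> \<in> Hom D Q M" and 0: "f \<odot> \<phi> = Zero D Q W"
    obtain X where X: "X \<in> R" "isomorphic D Q X" using R(3)[OF Q] by blast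
    obtain a b where ab: "a \<in> Hom D Q X" "b \<in> Hom D X Q" "b \<odot> a = Ident D Q" "a \<odot> b = Ident D X"
      using X(2) by (rule isomorphicE)
    have "f \<odot> (\<phi> \<odot> b) = Zero D X W"
      using comp_assoc[OF ab(2) \<phi> f] 0 zero_comp[OF ab(2) W] by simp
    then have i: "(X, \<phi> \<odot> b) \<in> I" using X(1) comp_hom[OF ab(2) \<phi>] by (simp add: I_def)
    have \<tau>: "\<tau> (X, \<phi> \<odot> b) \<in> Hom D X T" using coproduct_inj[OF T i] by simp
    have "t \<odot> (\<tau> (X, \<phi> \<odot> b) \<odot> a) = \<phi>"
      using comp_assoc[OF ab(1) \<tau> t(1)] t(2)[OF i] cancel_right[OF \<phi> ab(2,1,3)] by simp
    then show "\<exists>\<psi>\<in>Hom D Q T. t \<odot> \<psi> = \<phi>" using comp_hom[OF ab(1) \<tau>] by blast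
  qed
qed

lemma ex_cover:
  assumes M: "M \<in> Obj D"
  obtains T t where "T \<in> Sums" "t \<in> Hom D T M"
    "\<And>Q \<phi>. Q \<in> shifts D P \<Longrightarrow> \<phi> \<in> Hom D Q M \<Longrightarrow> \<exists>\<psi>\<in>Hom D Q T. t \<odot> \<psi> = \<phi>"
proof -
  obtain T t where T: "T \<in> Sums" "t \<in> Hom D T M"
    "\<And>Q \<phi>. Q \<in> shifts D P \<Longrightarrow> \<phi> \<in> Hom D Q M \<Longrightarrow> Zero D M M \<odot> \<phi> = Zero D Q M \<Longrightarrow> \<exists>\<psi>\<in>Hom D Q T. t \<odot> \<psi> = \<phi>"
    using ex_kernel_cover[OF zero_hom[OF M M]] by metis
  show thesis using that[OF T(1,2)] T(3) zero_comp[OF _ M] by blast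
qed

lemma Sums_subset_Tria: "Sums \<subseteq> Tria \<kappa> D P"
proof
  fix S assume "S \<in> Sums"
  then obtain I :: "'k set" and M \<iota> where "small \<kappa> I" "\<forall>i\<in>I. M i \<in> shifts D P" "is_coproduct D I M S \<iota>"
    by (auto simp: Sum_of_def)
  then show "S \<in> Tria \<kappa> D P"
    using closed_under_small_coproductsD[OF Tria_closed] shifts_subset_Tria[OF P] by blast
qed

lemma Tria_obj: "Tria \<kappa> D P \<subseteq> Obj D"
  using Tria_triangulated[OF P, of \<kappa>] unfolding triangulated_subcategory_def by (rule conjunct1)

lemma Tria_cone: "distinguished D X Y Z f g h \<Longrightarrow> X \<in> Tria \<kappa> D P \<Longrightarrow> Y \<in> Tria \<kappa> D P \<Longrightarrow> Z \<in> Tria \<kappa> D P"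
  using Tria_triangulated[OF P] unfolding triangulated_subcategory_def by blast

lemma PerpI:
  assumes "M \<in> Obj D" "\<And>Q v. Q \<in> shifts D P \<Longrightarrow> v \<in> Hom D Q M \<Longrightarrow> v = Zero D Q M"
  shows "M \<in> Perp"
  unfolding perp_Tria[OF P] using assms Hom_eq_zero_iff[OF shifts_obj assms(1)] by auto

lemma PerpD: "M \<in> Perp \<Longrightarrow> v \<in> Hom D P M \<Longrightarrow> v = Zero D P M"
  unfolding perp_Tria[OF P] using shifts_refl[OF P] by blast

section \<open>Compactness, perfectness and the orthogonal\<close>

text \<open>A finite sum of morphisms through the summands can be lifted summand by
  summand.\<close>

lemma finitary_imp_preserves_surjections:
  assumes fin: "finitary D (Obj D) I P"
  shows "preserves_coproduct_surjections D P I"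
  unfolding preserves_coproduct_surjections_def
proof (intro allI impI, elim conjE)
  fix M N f S \<iota> S' \<iota>' h
  assume f: "\<forall>i\<in>I. f i \<in> Hom D (M i) (N i)" and S: "is_coproduct D I M S \<iota>" and S': "is_coproduct D I N S' \<iota>'"
    and h: "h \<in> Hom D S S'" "\<forall>i\<in>I. h \<odot> \<iota> i = \<iota>' i \<odot> f i"
    and surj: "\<forall>i\<in>I. (\<odot>) (f i) ` Hom D P (M i) = Hom D P (N i)"
  show "(\<odot>) h ` Hom D P S = Hom D P S'"
  proof (intro equalityI subsetI)
    fix u assume "u \<in> (\<odot>) h ` Hom D P S" then show "u \<in> Hom D P S'" using comp_hom[OF _ h(1)] by auto
  next
    fix u assume u: "u \<in> Hom D P S'"
    have "u \<in> finite_sums D P I N S' \<iota>'"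
      by (rule finitaryD[OF fin S' coproduct_summand_obj[OF S'] u])
    then show "u \<in> (\<odot>) h ` Hom D P S"
    proof induction
      case zero
      show ?case
        by (rule image_eqI[OF _ zero_hom[OF P coproduct_obj[OF S]]]) (simp add: comp_zero[OF h(1) P])
    next
      case (plus u i \<phi>)
      obtain w where w: "w \<in> Hom D P S" "h \<odot> w = u" using plus.IH by auto
      have "\<phi> \<in> (\<odot>) (f i) ` Hom D P (M i)" using surj plus.hyps(2,3) by simp
      then obtain \<psi> where \<psi>: "\<psi> \<in> Hom D P (M i)" "f i \<odot> \<psi> = \<phi>" by auto
      note \<iota> = coproduct_inj[OF S plus.hyps(2)]
      have "h \<odot> (\<iota> i \<odot> \<psi>) = \<iota>' i \<odot> \<phi>"
        using comp_assoc[OF \<psi>(1) \<iota> h(1)] comp_assoc[OF \<psi>(1) _ coproduct_inj[OF S' plus.hyps(2)]] f h(2)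
          plus.hyps(2) \<psi>(2) by auto
      then have "h \<odot> Plus D w (\<iota> i \<odot> \<psi>) = Plus D u (\<iota>' i \<odot> \<phi>)"
        using comp_plus[OF w(1) comp_hom[OF \<psi>(1) \<iota>] h(1)] w(2) by simp
      then show ?case by (intro image_eqI[OF _ plus_hom[OF w(1) comp_hom[OF \<psi>(1) \<iota>]]]) simp
    qed
  qed
qed

text \<open>Cover each summand by a coproduct of shifts. The induced morphism of coproducts is
  surjective on \<open>D(P, ?)\<close>, and a lift to the coproduct of the covers is a finite sum.
  Used with \<open>I\<close> countable for perfect objects, and with \<open>I\<close> small for
  superperfect ones.\<close>

lemma preserves_surjections_imp_finitary:
  assumes pres: "preserves_coproduct_surjections D P I" and I: "small \<kappa> I"
    and fin: "finitary D Sums I P"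
  shows "finitary D (Obj D) I P"
  unfolding finitary_def
proof (intro allI impI subsetI)
  fix M S \<iota> u assume *: "(\<forall>i\<in>I. M i \<in> Obj D) \<and> is_coproduct D I M S \<iota>" and u: "u \<in> Hom D P S"
  then have S: "is_coproduct D I M S \<iota>" by simp
  have "\<forall>i\<in>I. \<exists>T t. T \<in> Sums \<and> t \<in> Hom D T (M i) \<and> (\<forall>\<phi>\<in>Hom D P (M i). \<exists>\<psi>\<in>Hom D P T. t \<odot> \<psi> = \<phi>)"
  proof
    fix i assume i: "i \<in> I"
    show "\<exists>T t. T \<in> Sums \<and> t \<in> Hom D T (M i) \<and> (\<forall>\<phi>\<in>Hom D P (M i). \<exists>\<psi>\<in>Hom D P T. t \<odot> \<psi> = \<phi>)"
      by (rule ex_cover[OF coproduct_summand_obj[OF S i]]) (use shifts_refl[OF P] in blast)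
  qed
  then obtain T t where T': "\<forall>i\<in>I. T i \<in> Sums \<and> t i \<in> Hom D (T i) (M i)
      \<and> (\<forall>\<phi>\<in>Hom D P (M i). \<exists>\<psi>\<in>Hom D P (T i). t i \<odot> \<psi> = \<phi>)"
    unfolding bchoice_iff by blast
  then have T: "\<And>i. i \<in> I \<Longrightarrow> T i \<in> Sums" "\<And>i. i \<in> I \<Longrightarrow> t i \<in> Hom D (T i) (M i)" by auto
  obtain ST \<tau> where ST: "is_coproduct D I T ST \<tau>"
    using ex_small_coproduct[OF coproducts I] T(1) Sum_of_obj by blast
  obtain h where h: "h \<in> Hom D ST S" "\<And>i. i \<in> I \<Longrightarrow> h \<odot> \<tau> i = \<iota> i \<odot> t i"
    using coproduct_induced[OF ST S T(2)] by blast
  have surj: "(\<odot>) (t i) ` Hom D P (T i) = Hom D P (M i)" if i: "i \<in> I" for i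
  proof
    show "(\<odot>) (t i) ` Hom D P (T i) \<subseteq> Hom D P (M i)" using comp_hom[OF _ T(2)[OF i]] by auto
    have "\<forall>\<phi>\<in>Hom D P (M i). \<exists>\<psi>\<in>Hom D P (T i). t i \<odot> \<psi> = \<phi>" using T' i by blast
    then show "Hom D P (M i) \<subseteq> (\<odot>) (t i) ` Hom D P (T i)" by (blast intro: sym)
  qed
  note pres' = pres[unfolded preserves_coproduct_surjections_def, THEN spec[of _ T], THEN spec[of _ M],
      THEN spec[of _ t], THEN spec[of _ ST], THEN spec[of _ \<tau>], THEN spec[of _ S], THEN spec[of _ \<iota>],
      THEN spec[of _ h]]
  have "(\<odot>) h ` Hom D P ST = Hom D P S"
    by (rule pres'[THEN mp], intro conjI ballI) (fact T(2) ST S h surj)+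
  then have "u \<in> (\<odot>) h ` Hom D P ST" using u by simp
  then obtain w where w: "w \<in> Hom D P ST" "h \<odot> w = u" by auto
  have "w \<in> finite_sums D P I T ST \<tau>" by (rule finitaryD[OF fin ST T(1) w(1)])
  then show "u \<in> finite_sums D P I M S \<iota>"
    using finite_sums_induced[OF ST S T(2) h P] w(2) by blast
qed

text \<open>All shifts of a compact object are compact, and a finite sum through orthogonal
  summands is zero.\<close>

lemma finitary_imp_Perp_closed:
  assumes fin: "\<And>I :: 'k set. small \<kappa> I \<Longrightarrow> finitary D (Obj D) I P"
  shows "closed_under_small_coproducts \<kappa> D Perp"
  unfolding closed_under_small_coproducts_def
proof (intro allI impI)
  fix I :: "'k set" and M S \<iota> assume *: "small \<kappa> I \<and> (\<forall>i\<in>I. M i \<in> Perp) \<and> is_coproduct D I M S \<iota>"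
  then have S: "is_coproduct D I M S \<iota>" and I: "small \<kappa> I" by auto
  show "S \<in> Perp"
  proof (rule PerpI[OF coproduct_obj[OF S]])
    fix Q v assume Q: "Q \<in> shifts D P" and v: "v \<in> Hom D Q S"
    have QO: "Q \<in> Obj D" by (rule shifts_obj[OF Q])
    note SO = coproduct_obj[OF S]
    have vf: "v \<in> finite_sums D Q I M S \<iota>"
      using finitaryD[OF finitary_shifts[OF shift_closed_Obj P fin[OF I] Q] S coproduct_summand_obj[OF S] v] .
    have "Ident D S \<odot> v = Zero D Q S"
    proof (rule finite_sums_zero[OF S QO ident_hom[OF SO] _ vf])
      fix i \<phi> assume i: "i \<in> I" and \<phi>: "\<phi> \<in> Hom D Q (M i)"
      have "Hom D Q (M i) = {Zero D Q (M i)}" using * i Q unfolding perp_Tria[OF P] by blast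
      then have "\<phi> = Zero D Q (M i)" using \<phi> by simp
      then show "Ident D S \<odot> (\<iota> i \<odot> \<phi>) = Zero D Q S"
        using comp_zero[OF coproduct_inj[OF S i] QO] comp_zero[OF ident_hom[OF SO] QO] by simp
    qed
    then show "v = Zero D Q S" using ident_comp[OF v] by simp
  qed
qed

section \<open>Approximation from inside the generated subcategory\<close>

text \<open>Start with a cover of \<open>M\<close>, and pass from \<open>X k\<close> to the cone
  of a cover of the kernel of \<open>f k\<close> on morphisms from shifts. The morphism
  \<open>f k\<close> extends to the cone because it kills the cover.\<close>

lemma ex_approximating_sequence:
  assumes M: "M \<in> Obj D"
  obtains X f x where "\<And>k. X k \<in> Tria \<kappa> D P" "\<And>k. f k \<in> Hom D (X k) M"
    "\<And>k. x k \<in> Hom D (X k) (X (Suc k))" "\<And>k. f (Suc k) \<odot> x k = f k"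
    "\<And>Q \<phi>. Q \<in> shifts D P \<Longrightarrow> \<phi> \<in> Hom D Q M \<Longrightarrow> \<exists>\<psi>\<in>Hom D Q (X 0). f 0 \<odot> \<psi> = \<phi>"
    "\<And>k Q \<phi>. Q \<in> shifts D P \<Longrightarrow> \<phi> \<in> Hom D Q (X k) \<Longrightarrow> f k \<odot> \<phi> = Zero D Q M
      \<Longrightarrow> x k \<odot> \<phi> = Zero D Q (X (Suc k))"
proof -
  \<comment> \<open>Surjectivity on morphisms from shifts is demanded of the first stage only;
    it is inherited, as later stages factor the first.\<close>
  define good where "good = (\<lambda>(k :: nat) (X, f). X \<in> Tria \<kappa> D P \<and> f \<in> Hom D X M \<and>
    (k = 0 \<longrightarrow> (\<forall>Q\<in>shifts D P. \<forall>\<phi>\<in>Hom D Q M. \<exists>\<psi>\<in>Hom D Q X. f \<odot> \<psi> = \<phi>)))"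
  define step where "step = (\<lambda>(k :: nat) (X, f) (X', f'). \<exists>x\<in>Hom D X X'. f' \<odot> x = f \<and>
    (\<forall>Q\<in>shifts D P. \<forall>\<phi>\<in>Hom D Q X. f \<odot> \<phi> = Zero D Q M \<longrightarrow> x \<odot> \<phi> = Zero D Q X'))"
  have "\<exists>s. \<forall>k. good k (s k) \<and> step k (s k) (s (Suc k))"
  proof (rule dependent_nat_choice)
    obtain T t where "T \<in> Sums" "t \<in> Hom D T M"
      "\<And>Q \<phi>. Q \<in> shifts D P \<Longrightarrow> \<phi> \<in> Hom D Q M \<Longrightarrow> \<exists>\<psi>\<in>Hom D Q T. t \<odot> \<psi> = \<phi>"
      using ex_cover[OF M] by blast
    then have "good 0 (T, t)" unfolding good_def using Sums_subset_Tria by auto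
    then show "\<exists>s. good 0 s" ..
  next
    fix k s assume s: "good k s"
    obtain X f where Xf: "s = (X, f)" by (cases s)
    have X: "X \<in> Tria \<kappa> D P" and f: "f \<in> Hom D X M" using s by (auto simp: good_def Xf)
    obtain T t where T: "T \<in> Sums" "t \<in> Hom D T X" "f \<odot> t = Zero D T M"
      and cover: "\<And>Q \<phi>. Q \<in> shifts D P \<Longrightarrow> \<phi> \<in> Hom D Q X \<Longrightarrow> f \<odot> \<phi> = Zero D Q M
        \<Longrightarrow> \<exists>\<psi>\<in>Hom D Q T. t \<odot> \<psi> = \<phi>"
      using ex_kernel_cover[OF f] by blast
    obtain X' x c where C: "distinguished D T X X' t x c" using tri_cone[OF T(2)] by blast
    note x = distinguished_homs(2)[OF C]
    obtain f' where f': "f' \<in> Hom D X' M" "f' \<odot> x = f" using distinguished_extend[OF C f T(3)] .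
    have "x \<odot> \<phi> = Zero D Q X'" if Q: "Q \<in> shifts D P" and \<phi>: "\<phi> \<in> Hom D Q X" "f \<odot> \<phi> = Zero D Q M" for Q \<phi>
    proof -
      obtain \<psi> where \<psi>: "\<psi> \<in> Hom D Q T" "t \<odot> \<psi> = \<phi>" using cover[OF Q \<phi>] by blast
      have "x \<odot> (t \<odot> \<psi>) = (x \<odot> t) \<odot> \<psi>" by (rule comp_assoc[OF \<psi>(1) T(2) x, symmetric])
      also have "\<dots> = Zero D Q X'"
        using distinguished_comp[OF C] zero_comp[OF \<psi>(1) hom_obj(2)[OF x]] by simp
      finally show ?thesis using \<psi>(2) by simp
    qed
    then have "step k s (X', f')" unfolding step_def Xf using x f'(2) by auto
    moreover have "good (Suc k) (X', f')"
      unfolding good_def using Tria_cone[OF C _ X] T(1) Sums_subset_Tria f'(1) by auto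
    ultimately show "\<exists>s'. good (Suc k) s' \<and> step k s s'" by blast
  qed
  then obtain s where s: "\<And>k. good k (s k)" "\<And>k. step k (s k) (s (Suc k))" by blast
  define X where "X = (\<lambda>k. fst (s k))"
  define f where "f = (\<lambda>k. snd (s k))"
  have good: "X k \<in> Tria \<kappa> D P" "f k \<in> Hom D (X k) M"
    "k = 0 \<longrightarrow> (\<forall>Q\<in>shifts D P. \<forall>\<phi>\<in>Hom D Q M. \<exists>\<psi>\<in>Hom D Q (X k). f k \<odot> \<psi> = \<phi>)" for k
    using s(1)[of k] by (simp_all add: good_def X_def f_def split_beta)
  have "\<forall>k. \<exists>x. x \<in> Hom D (X k) (X (Suc k)) \<and> f (Suc k) \<odot> x = f k \<and>
    (\<forall>Q\<in>shifts D P. \<forall>\<phi>\<in>Hom D Q (X k). f k \<odot> \<phi> = Zero D Q M \<longrightarrow> x \<odot> \<phi> = Zero D Q (X (Suc k)))"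
    using s(2) by (simp add: step_def X_def f_def split_beta Bex_def)
  then obtain x where x: "\<forall>k. x k \<in> Hom D (X k) (X (Suc k)) \<and> f (Suc k) \<odot> x k = f k \<and>
    (\<forall>Q\<in>shifts D P. \<forall>\<phi>\<in>Hom D Q (X k). f k \<odot> \<phi> = Zero D Q M \<longrightarrow> x k \<odot> \<phi> = Zero D Q (X (Suc k)))"
    by (rule choice[THEN exE])
  show thesis
    by (rule that[of X f x]) (use good x in auto)
qed

text \<open>For the homotopy colimit \<open>H\<close> of an approximating sequence,
  \<open>H \<rightarrow> M\<close> is bijective on morphisms from shifts of \<open>P\<close>: the
  first stage gives surjectivity, and since a morphism to \<open>H\<close> comes from a finite
  stage, whatever becomes zero in \<open>M\<close> is already zero one stage later. Compactness
  enters through countable coproducts inside the generated subcategory, where all stages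
  lie.\<close>

lemma approximation_triangle:
  assumes fin: "finitary D (Tria \<kappa> D P) (UNIV :: nat set) P" and M: "M \<in> Obj D"
  obtains X Y f g h where "distinguished D X M Y f g h" "X \<in> Tria \<kappa> D P" "Y \<in> Perp"
proof -
  note sc = triangulated_imp_shift_closed[OF Tria_triangulated[OF P]]
  note scP = shift_closed_shifts[OF P]
  obtain X f x where X: "\<And>k. X k \<in> Tria \<kappa> D P" and f: "\<And>k. f k \<in> Hom D (X k) M"
    and x: "\<And>k. x k \<in> Hom D (X k) (X (Suc k))" and fx: "\<And>k. f (Suc k) \<odot> x k = f k"
    and surj0: "\<And>Q \<phi>. Q \<in> shifts D P \<Longrightarrow> \<phi> \<in> Hom D Q M \<Longrightarrow> \<exists>\<psi>\<in>Hom D Q (X 0). f 0 \<odot> \<psi> = \<phi>"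
    and kill: "\<And>k Q \<phi>. Q \<in> shifts D P \<Longrightarrow> \<phi> \<in> Hom D Q (X k) \<Longrightarrow> f k \<odot> \<phi> = Zero D Q M
      \<Longrightarrow> x k \<odot> \<phi> = Zero D Q (X (Suc k))"
    using ex_approximating_sequence[OF M] by blast
  obtain N \<iota> where N: "is_coproduct D (UNIV :: nat set) X N \<iota>"
    using ex_small_coproduct[OF coproducts small_nat[OF cardinal]] X Tria_obj by blast
  have \<iota>: "\<iota> k \<in> Hom D (X k) N" for k using coproduct_inj[OF N] by simp
  have NO: "N \<in> Obj D" by (rule coproduct_obj[OF N])
  obtain s where s: "s \<in> Hom D N N" "\<And>k. s \<odot> \<iota> k = \<iota> (Suc k) \<odot> x k"
    using ex_telescope_shift[OF N x] by (metis (no_types))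
  define e where "e = Plus D (Ident D N) (Minus D s)"
  have e: "e \<in> Hom D N N" unfolding e_def by (rule plus_hom[OF ident_hom[OF NO] minus_hom[OF s(1)]])
  obtain H z h where H: "distinguished D N N H e z h" using tri_cone[OF e] by blast
  note z = distinguished_homs(2)[OF H]
  have HO: "H \<in> Obj D" using hom_obj[OF z] by simp
  have NT: "N \<in> Tria \<kappa> D P"
    by (rule closed_under_small_coproductsD[OF Tria_closed small_nat[OF cardinal] N X])
  have HT: "H \<in> Tria \<kappa> D P" by (rule Tria_cone[OF H NT NT])
  \<comment> \<open>The morphisms \<open>f k\<close> are compatible, so they induce
    \<open>G\<close> on the homotopy colimit \<open>H\<close>.\<close>
  obtain F where F: "F \<in> Hom D N M" "\<And>k. F \<odot> \<iota> k = f k"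
    using coproduct_copair[OF N M, of f] f by (metis UNIV_I)
  have "F \<odot> s = F"
  proof (rule coproduct_eqI[OF N comp_hom[OF s(1) F(1)] F(1)])
    fix k :: nat
    have "(F \<odot> s) \<odot> \<iota> k = (F \<odot> \<iota> (Suc k)) \<odot> x k"
      using comp_assoc[OF \<iota> s(1) F(1), of k] s(2)[of k] comp_assoc[OF x \<iota> F(1), of k] by simp
    then show "(F \<odot> s) \<odot> \<iota> k = F \<odot> \<iota> k" using F(2) fx by simp
  qed
  then have "F \<odot> e = Zero D N M"
    unfolding e_def using comp_sub[OF ident_hom[OF NO] s(1) F(1)] comp_ident[OF F(1)] plus_minus[OF F(1)]
    by simp
  then obtain G where G: "G \<in> Hom D H M" "G \<odot> z = F" using distinguished_extend[OF H F(1)] by blast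
  have Gz: "G \<odot> (z \<odot> (\<iota> k \<odot> \<phi>)) = f k \<odot> \<phi>" if \<phi>: "\<phi> \<in> Hom D Q (X k)" for k Q \<phi>
    using comp_assoc[OF comp_hom[OF \<phi> \<iota>] z G(1)] G(2) comp_assoc[OF \<phi> \<iota> F(1)] F(2) by simp
  have "z \<odot> s = z"
  proof -
    have "Plus D z (Minus D (z \<odot> s)) = Zero D N H"
      using distinguished_comp[OF H] comp_sub[OF ident_hom[OF NO] s(1) z] comp_ident[OF z] unfolding e_def by simp
    then show ?thesis using eq_if_plus_minus_zero[OF z comp_hom[OF s(1) z]] by simp
  qed
  have advance: "z \<odot> (\<iota> k \<odot> \<phi>) = z \<odot> (\<iota> (Suc k) \<odot> (x k \<odot> \<phi>))" if \<phi>: "\<phi> \<in> Hom D Q (X k)" for k Q \<phi>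
  proof -
    have "z \<odot> (\<iota> k \<odot> \<phi>) = z \<odot> (s \<odot> (\<iota> k \<odot> \<phi>))"
      using comp_assoc[OF comp_hom[OF \<phi> \<iota>] s(1) z] \<open>z \<odot> s = z\<close> by simp
    also have "s \<odot> (\<iota> k \<odot> \<phi>) = \<iota> (Suc k) \<odot> (x k \<odot> \<phi>)"
      using comp_assoc[OF \<phi> \<iota> s(1)] s(2) comp_assoc[OF \<phi> x \<iota>] by simp
    finally show ?thesis .
  qed
  have finQ: "w \<in> finite_sums D Q UNIV X N \<iota>" if Q: "Q \<in> shifts D P" and w: "w \<in> Hom D Q N" for Q w
    by (rule finitaryD[OF finitary_shifts[OF sc P fin Q] N X w])
  have inj_e: "w = Zero D Q N" if Q: "Q \<in> shifts D P" and w: "w \<in> Hom D Q N" and 0: "e \<odot> w = Zero D Q N" for Q w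
    by (rule telescope_inj[OF N x s shifts_obj[OF Q] finQ[OF Q w] 0[unfolded e_def]])
  \<comment> \<open>Every morphism from a shift to \<open>H\<close> comes from a single stage:
    the finitely many stages of a lift to the telescope are moved up to a common one.\<close>
  have stage: "\<exists>k. \<exists>\<phi>\<in>Hom D Q (X k). v = z \<odot> (\<iota> k \<odot> \<phi>)" if Q: "Q \<in> shifts D P" and v: "v \<in> Hom D Q H" for Q v
  proof -
    have QO: "Q \<in> Obj D" by (rule shifts_obj[OF Q])
    have raise: "\<exists>\<psi>\<in>Hom D Q (X (k + j)). z \<odot> (\<iota> k \<odot> \<phi>) = z \<odot> (\<iota> (k + j) \<odot> \<psi>)"
      if \<phi>: "\<phi> \<in> Hom D Q (X k)" for k j \<phi>
    proof (induction j)
      case 0 then show ?case using \<phi> by auto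
    next
      case (Suc j)
      then obtain \<psi> where "\<psi> \<in> Hom D Q (X (k + j))" "z \<odot> (\<iota> k \<odot> \<phi>) = z \<odot> (\<iota> (k + j) \<odot> \<psi>)" by blast
      then show ?case using advance[of \<psi> Q "k + j"] comp_hom[OF _ x[of "k + j"]] by auto
    qed
    obtain w where w: "w \<in> Hom D Q N" "z \<odot> w = v" using cone_lift[OF H scP inj_e Q v] by blast
    have "\<exists>k. \<exists>\<phi>\<in>Hom D Q (X k). z \<odot> w = z \<odot> (\<iota> k \<odot> \<phi>)"
      using finQ[OF Q w(1)]
    proof induction
      case zero
      show ?case
        using comp_zero[OF \<iota>[of 0] QO] zero_hom[OF QO hom_obj(1)[OF \<iota>[of 0]]] by (intro exI[of _ 0]) force
    next
      case (plus u i \<phi>)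
      obtain k \<psi> where \<psi>: "\<psi> \<in> Hom D Q (X k)" "z \<odot> u = z \<odot> (\<iota> k \<odot> \<psi>)" using plus.IH by blast
      obtain \<psi>' where \<psi>': "\<psi>' \<in> Hom D Q (X (k + i))" "z \<odot> (\<iota> k \<odot> \<psi>) = z \<odot> (\<iota> (k + i) \<odot> \<psi>')"
        using raise[OF \<psi>(1)] by blast
      obtain \<phi>' where \<phi>': "\<phi>' \<in> Hom D Q (X (i + k))" "z \<odot> (\<iota> i \<odot> \<phi>) = z \<odot> (\<iota> (i + k) \<odot> \<phi>')"
        using raise[OF plus.hyps(3)] by blast
      then have \<phi>': "\<phi>' \<in> Hom D Q (X (k + i))" "z \<odot> (\<iota> i \<odot> \<phi>) = z \<odot> (\<iota> (k + i) \<odot> \<phi>')"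
        by (simp_all add: add.commute)
      have "z \<odot> Plus D u (\<iota> i \<odot> \<phi>) = Plus D (z \<odot> u) (z \<odot> (\<iota> i \<odot> \<phi>))"
        by (rule comp_plus[OF finite_sums_hom[OF N QO plus.hyps(1)] comp_hom[OF plus.hyps(3) \<iota>] z])
      also have "\<dots> = z \<odot> Plus D (\<iota> (k + i) \<odot> \<psi>') (\<iota> (k + i) \<odot> \<phi>')"
        using comp_plus[OF comp_hom[OF \<psi>'(1) \<iota>] comp_hom[OF \<phi>'(1) \<iota>] z] \<psi>(2) \<psi>'(2) \<phi>'(2) by simp
      also have "\<dots> = z \<odot> (\<iota> (k + i) \<odot> Plus D \<psi>' \<phi>')"
        using comp_plus[OF \<psi>'(1) \<phi>'(1) \<iota>] by simp
      finally show ?case using plus_hom[OF \<psi>'(1) \<phi>'(1)] by blast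
    qed
    then show ?thesis using w(2) by simp
  qed
  have inj: "v = Zero D Q H" if Q: "Q \<in> shifts D P" and v: "v \<in> Hom D Q H" and 0: "G \<odot> v = Zero D Q M" for Q v
  proof -
    obtain k \<phi> where \<phi>: "\<phi> \<in> Hom D Q (X k)" "v = z \<odot> (\<iota> k \<odot> \<phi>)" using stage[OF Q v] by blast
    have "x k \<odot> \<phi> = Zero D Q (X (Suc k))" using kill[OF Q \<phi>(1)] Gz[OF \<phi>(1)] 0 \<phi>(2) by simp
    then show ?thesis
      using advance[OF \<phi>(1)] \<phi>(2) comp_zero[OF \<iota> shifts_obj[OF Q]] comp_zero[OF z shifts_obj[OF Q]] by simp
  qed
  have surj: "\<exists>v\<in>Hom D Q H. G \<odot> v = y" if Q: "Q \<in> shifts D P" and y: "y \<in> Hom D Q M" for Q y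
  proof -
    obtain \<psi> where "\<psi> \<in> Hom D Q (X 0)" "f 0 \<odot> \<psi> = y" using surj0[OF Q y] by blast
    then show ?thesis using Gz comp_hom[OF comp_hom[OF _ \<iota>] z] by blast
  qed
  obtain Y g h' where Y: "distinguished D H M Y G g h'" using tri_cone[OF G(1)] by blast
  have "Y \<in> Perp"
    by (rule PerpI[OF hom_obj(2)[OF distinguished_homs(2)[OF Y]]]) (rule cone_orthogonal[OF Y scP inj surj])
  then show thesis using that Y HT by blast
qed

text \<open>In a coproduct of approximation triangles the third term is orthogonal to
  \<open>P\<close>, so morphisms from \<open>P\<close> lift to a coproduct of objects of the
  generated subcategory.\<close>

lemma finitary_Tria_imp_finitary:
  assumes fin: "\<And>I :: 'k set. small \<kappa> I \<Longrightarrow> finitary D (Tria \<kappa> D P) I P"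
    and cl: "closed_under_small_coproducts \<kappa> D Perp"
    and I: "small \<kappa> (I :: 'k set)"
  shows "finitary D (Obj D) I P"
  unfolding finitary_def
proof (intro allI impI subsetI)
  fix M S \<iota> u assume *: "(\<forall>i\<in>I. M i \<in> Obj D) \<and> is_coproduct D I M S \<iota>" and u: "u \<in> Hom D P S"
  then have S: "is_coproduct D I M S \<iota>" by simp
  have "finitary D (Tria \<kappa> D P) (UNIV :: nat set) P"
    by (rule finitary_small[OF fin small_nat[OF cardinal]])
  then have "\<forall>i\<in>I. \<exists>X Y f g h. distinguished D X (M i) Y f g h \<and> X \<in> Tria \<kappa> D P \<and> Y \<in> Perp"
    using approximation_triangle coproduct_summand_obj[OF S] by metis
  then obtain X Y f g h where
    "\<forall>i\<in>I. distinguished D (X i) (M i) (Y i) (f i) (g i) (h i) \<and> X i \<in> Tria \<kappa> D P \<and> Y i \<in> Perp"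
    unfolding bchoice_iff by blast
  then have T: "\<And>i. i \<in> I \<Longrightarrow> distinguished D (X i) (M i) (Y i) (f i) (g i) (h i)"
    and X: "\<And>i. i \<in> I \<Longrightarrow> X i \<in> Tria \<kappa> D P" and Y: "\<And>i. i \<in> I \<Longrightarrow> Y i \<in> Perp" by auto
  obtain SX \<xi> where SX: "is_coproduct D I X SX \<xi>"
    using ex_small_coproduct[OF coproducts I] X Tria_obj by blast
  obtain SY \<eta> where SY: "is_coproduct D I Y SY \<eta>"
    using ex_small_coproduct[OF coproducts I, of Y] hom_obj(2)[OF distinguished_homs(2)[OF T]] by blast
  obtain a where a: "a \<in> Hom D SX S" "\<And>i. i \<in> I \<Longrightarrow> a \<odot> \<xi> i = \<iota> i \<odot> f i"
    using coproduct_induced[OF SX S distinguished_homs(1)[OF T]] by blast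
  obtain b where b: "b \<in> Hom D S SY" "\<And>i. i \<in> I \<Longrightarrow> b \<odot> \<iota> i = \<eta> i \<odot> g i"
    using coproduct_induced[OF S SY distinguished_homs(2)[OF T]] by blast
  have "SY \<in> Perp" by (rule closed_under_small_coproductsD[OF cl I SY Y])
  then have "b \<odot> u = Zero D P SY" by (rule PerpD[OF _ comp_hom[OF u b(1)]])
  then obtain w where w: "w \<in> Hom D P SX" "a \<odot> w = u"
    using coproduct_of_triangles_lift[OF T SX S SY a b u] by blast
  have "w \<in> finite_sums D P I X SX \<xi>" by (rule finitaryD[OF fin[OF I] SX X w(1)])
  then show "u \<in> finite_sums D P I M S \<iota>"
    using finite_sums_induced[OF SX S distinguished_homs(1)[OF T] a P] w(2) by blast
qed

section \<open>From countable to small coproducts\<close>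

text \<open>The morphisms \<open>t k\<close> are covers of the stages; their surjectivity is
  recorded through its consequence that the next morphism kills everything from shifts of
  \<open>P\<close>.\<close>

definition killing_tower ::
    "'o \<Rightarrow> (nat \<Rightarrow> 'o) \<Rightarrow> (nat \<Rightarrow> 'o) \<Rightarrow> (nat \<Rightarrow> 'm) \<Rightarrow> (nat \<Rightarrow> 'm) \<Rightarrow> (nat \<Rightarrow> 'm) \<Rightarrow> bool"
  where "killing_tower M X T t m c \<longleftrightarrow> X 0 = M \<and> (\<forall>k. T k \<in> Sums \<and>
    distinguished D (T k) (X k) (X (Suc k)) (t k) (m k) (c k) \<and>
    (\<forall>Q\<in>shifts D P. \<forall>\<phi>\<in>Hom D Q (X k). m k \<odot> \<phi> = Zero D Q (X (Suc k))))"

lemma ex_killing_tower: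
  assumes M: "M \<in> Obj D"
  shows "\<exists>X T t m c. killing_tower M X T t m c"
proof -
  define step where "step = (\<lambda>X X' T t m c. T \<in> Sums \<and> distinguished D T X X' t m c \<and>
    (\<forall>Q\<in>shifts D P. \<forall>\<phi>\<in>Hom D Q X. m \<odot> \<phi> = Zero D Q X'))"
  have "\<exists>X. \<forall>k. (X k \<in> Obj D \<and> (k = 0 \<longrightarrow> X k = M)) \<and> (\<exists>T t m c. step (X k) (X (Suc k)) T t m c)"
  proof (rule dependent_nat_choice)
    show "\<exists>X. X \<in> Obj D \<and> (0 = (0 :: nat) \<longrightarrow> X = M)" using M by blast
  next
    fix k :: nat and X assume "X \<in> Obj D \<and> (k = 0 \<longrightarrow> X = M)"
    then have "X \<in> Obj D" ..
    then obtain T t where T: "T \<in> Sums" "t \<in> Hom D T X"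
      and cover: "\<And>Q \<phi>. Q \<in> shifts D P \<Longrightarrow> \<phi> \<in> Hom D Q X \<Longrightarrow> \<exists>\<psi>\<in>Hom D Q T. t \<odot> \<psi> = \<phi>"
      using ex_cover by blast
    obtain X' m c where C: "distinguished D T X X' t m c" using tri_cone[OF T(2)] by blast
    note m = distinguished_homs(2)[OF C]
    have "m \<odot> \<phi> = Zero D Q X'" if Q: "Q \<in> shifts D P" and \<phi>: "\<phi> \<in> Hom D Q X" for Q \<phi>
    proof -
      obtain \<psi> where \<psi>: "\<psi> \<in> Hom D Q T" "t \<odot> \<psi> = \<phi>" using cover[OF Q \<phi>] by blast
      have "m \<odot> (t \<odot> \<psi>) = (m \<odot> t) \<odot> \<psi>" by (rule comp_assoc[OF \<psi>(1) T(2) m, symmetric])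
      also have "\<dots> = Zero D Q X'"
        using distinguished_comp[OF C] zero_comp[OF \<psi>(1) hom_obj(2)[OF m]] by simp
      finally show ?thesis using \<psi>(2) by simp
    qed
    then have "step X X' T t m c" unfolding step_def using T(1) C by blast
    then show "\<exists>Y. (Y \<in> Obj D \<and> (Suc k = 0 \<longrightarrow> Y = M)) \<and> (\<exists>T t m c. step X Y T t m c)"
      using hom_obj(2)[OF m] by blast
  qed
  then obtain X where "\<forall>k. (X k \<in> Obj D \<and> (k = 0 \<longrightarrow> X k = M)) \<and> (\<exists>T t m c. step (X k) (X (Suc k)) T t m c)" ..
  then have X: "X 0 = M" "\<forall>k. \<exists>T t m c. step (X k) (X (Suc k)) T t m c" by simp_all
  from X(2) obtain T t m c where "\<forall>k. step (X k) (X (Suc k)) (T k) (t k) (m k) (c k)"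
    unfolding choice_iff by blast
  then show ?thesis using X(1) unfolding killing_tower_def step_def by blast
qed

text \<open>A morphism from a shift of \<open>P\<close> to the telescope is a finite sum through
  the stages, so \<open>s\<close> kills it and \<open>1 - s\<close> acts as the identity. Hence
  the cone of \<open>1 - s\<close> is orthogonal.\<close>

lemma killing_tower_hocolim:
  assumes fin: "finitary D (Obj D) (UNIV :: nat set) P" and K: "killing_tower M X T t m c"
  shows "\<exists>N \<iota> s Y z h. is_coproduct D UNIV X N \<iota> \<and> s \<in> Hom D N N \<and> (\<forall>k. s \<odot> \<iota> k = \<iota> (Suc k) \<odot> m k)
    \<and> distinguished D N N Y (Plus D (Ident D N) (Minus D s)) z h \<and> Y \<in> Perp"
proof -
  have m: "m k \<in> Hom D (X k) (X (Suc k))" for k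
    using K distinguished_homs(2) unfolding killing_tower_def by blast
  obtain N \<iota> where N: "is_coproduct D (UNIV :: nat set) X N \<iota>"
    using ex_small_coproduct[OF coproducts small_nat[OF cardinal], of UNIV X] hom_obj(1)[OF m] .
  have \<iota>: "\<iota> k \<in> Hom D (X k) N" for k using coproduct_inj[OF N] by simp
  have NO: "N \<in> Obj D" by (rule coproduct_obj[OF N])
  obtain s where s: "s \<in> Hom D N N" "\<And>k. s \<odot> \<iota> k = \<iota> (Suc k) \<odot> m k"
    using ex_telescope_shift[OF N m] by (metis (no_types))
  let ?e = "Plus D (Ident D N) (Minus D s)"
  have e: "?e \<in> Hom D N N" by (rule plus_hom[OF ident_hom[OF NO] minus_hom[OF s(1)]])
  obtain Y z h where Y: "distinguished D N N Y ?e z h" using tri_cone[OF e] by blast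
  have id: "?e \<odot> v = v" if Q: "Q \<in> shifts D P" and v: "v \<in> Hom D Q N" for Q v
  proof -
    have QO: "Q \<in> Obj D" by (rule shifts_obj[OF Q])
    have vf: "v \<in> finite_sums D Q UNIV X N \<iota>"
      by (rule finitaryD[OF finitary_shifts[OF shift_closed_Obj P fin Q] N hom_obj(1)[OF m] v])
    have "s \<odot> v = Zero D Q N"
    proof (rule finite_sums_zero[OF N QO s(1) _ vf])
      fix k \<phi> assume \<phi>: "\<phi> \<in> Hom D Q (X k)"
      have "m k \<odot> \<phi> = Zero D Q (X (Suc k))" using K Q \<phi> unfolding killing_tower_def by blast
      moreover have "s \<odot> (\<iota> k \<odot> \<phi>) = \<iota> (Suc k) \<odot> (m k \<odot> \<phi>)"
        using comp_assoc[OF \<phi> \<iota> s(1)] s(2) comp_assoc[OF \<phi> m \<iota>] by simp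
      ultimately show "s \<odot> (\<iota> k \<odot> \<phi>) = Zero D Q N" using comp_zero[OF \<iota> QO] by simp
    qed
    then show ?thesis
      using sub_comp[OF v ident_hom[OF NO] s(1)] ident_comp[OF v] sub_zero[OF v] by simp
  qed
  have "Y \<in> Perp"
  proof (rule PerpI)
    show "Y \<in> Obj D" using hom_obj[OF distinguished_homs(2)[OF Y]] by simp
    fix Q v assume Q: "Q \<in> shifts D P" and v: "v \<in> Hom D Q Y"
    show "v = Zero D Q Y"
      by (rule cone_orthogonal[OF Y shift_closed_shifts[OF P] _ _ Q v]) (use id in \<open>simp, blast\<close>)
  qed
  then show ?thesis using N s Y by blast
qed

text \<open>Let \<open>u : P \<rightarrow> \<Coprod>\<^sub>i M\<^sub>i\<close>, and build a
  killing tower on every \<open>M\<^sub>i\<close>. The coproduct over \<open>i\<close> of the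
  homotopy colimits is again orthogonal, so \<open>u\<close>, placed at stage zero, equals
  \<open>(1 - s) w\<close> on the telescope of the coproducts \<open>L\<^sub>k\<close> of the
  \<open>k\<close>-th stages. Then \<open>w\<close> has component \<open>u\<close> at stage zero,
  and its components are the successive images of \<open>u\<close>; as only finitely many are
  nonzero, \<open>u\<close> becomes zero at some stage. A morphism that becomes zero in
  \<open>L\<^sub>k\<^sub>+\<^sub>1\<close> lifts to a coproduct of coproducts of shifts, where it
  is a finite sum. Descending through the stages, \<open>u\<close> itself is a finite sum.\<close>

lemma countably_finitary_imp_finitary:
  assumes fin: "finitary D (Obj D) (UNIV :: nat set) P"
    and finS: "\<And>I :: 'k set. small \<kappa> I \<Longrightarrow> finitary D Sums I P"
    and cl: "closed_under_small_coproducts \<kappa> D Perp"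
    and I: "small \<kappa> (I :: 'k set)"
  shows "finitary D (Obj D) I P"
  unfolding finitary_def
proof (intro allI impI subsetI)
  fix M S \<iota> u assume *: "(\<forall>i\<in>I. M i \<in> Obj D) \<and> is_coproduct D I M S \<iota>" and u: "u \<in> Hom D P S"
  then have S: "is_coproduct D I M S \<iota>" by simp
  have PP: "P \<in> shifts D P" by (rule shifts_refl[OF P])
  have "\<forall>i\<in>I. \<exists>X T t m c. killing_tower (M i) X T t m c"
    using ex_killing_tower coproduct_summand_obj[OF S] by blast
  then obtain X T t m c where K: "\<forall>i\<in>I. killing_tower (M i) (X i) (T i) (t i) (m i) (c i)"
    unfolding bchoice_iff by blast
  then have "\<forall>i\<in>I. \<exists>N \<rho> s Y z h. is_coproduct D UNIV (X i) N \<rho> \<and> s \<in> Hom D N N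
    \<and> (\<forall>k. s \<odot> \<rho> k = \<rho> (Suc k) \<odot> m i k)
    \<and> distinguished D N N Y (Plus D (Ident D N) (Minus D s)) z h \<and> Y \<in> Perp"
    using killing_tower_hocolim[OF fin] by blast
  then obtain N \<rho> s Y z h where H: "\<forall>i\<in>I. is_coproduct D UNIV (X i) (N i) (\<rho> i) \<and> s i \<in> Hom D (N i) (N i)
    \<and> (\<forall>k. s i \<odot> \<rho> i k = \<rho> i (Suc k) \<odot> m i k)
    \<and> distinguished D (N i) (N i) (Y i) (Plus D (Ident D (N i)) (Minus D (s i))) (z i) (h i) \<and> Y i \<in> Perp"
    unfolding bchoice_iff by blast
  define e where "e = (\<lambda>i. Plus D (Ident D (N i)) (Minus D (s i)))"
  have X0: "X i 0 = M i" and TS: "T i k \<in> Sums"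
    and tri: "distinguished D (T i k) (X i k) (X i (Suc k)) (t i k) (m i k) (c i k)"
    and kill: "\<And>\<phi>. \<phi> \<in> Hom D P (X i k) \<Longrightarrow> m i k \<odot> \<phi> = Zero D P (X i (Suc k))"
    and N: "is_coproduct D UNIV (X i) (N i) (\<rho> i)" and s: "s i \<in> Hom D (N i) (N i)"
    and s\<rho>: "s i \<odot> \<rho> i k = \<rho> i (Suc k) \<odot> m i k"
    and Ytri: "distinguished D (N i) (N i) (Y i) (e i) (z i) (h i)" and Y: "Y i \<in> Perp"
    if "i \<in> I" for i k
    using K H that PP unfolding killing_tower_def e_def by blast+
  note m = distinguished_homs(2)[OF tri]
  have XO: "X i k \<in> Obj D" if "i \<in> I" for i k using hom_obj(1)[OF m[OF that]] .
  have \<rho>: "\<rho> i k \<in> Hom D (X i k) (N i)" if "i \<in> I" for i k using coproduct_inj[OF N[OF that]] by simp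
  have eh: "e i \<in> Hom D (N i) (N i)" if "i \<in> I" for i by (rule distinguished_homs(1)[OF Ytri[OF that]])
  obtain SN \<nu> where SN: "is_coproduct D I N SN \<nu>"
    using ex_small_coproduct[OF coproducts I, of N] coproduct_obj[OF N] by blast
  note \<nu> = coproduct_inj[OF SN]
  obtain SY \<eta> where SY: "is_coproduct D I Y SY \<eta>"
    using ex_small_coproduct[OF coproducts I, of Y] hom_obj(2)[OF distinguished_homs(2)[OF Ytri]] by blast
  \<comment> \<open>At stage zero the given coproduct itself is taken, so that \<open>u\<close>
    is a morphism to \<open>L 0\<close>.\<close>
  have "\<forall>k. \<exists>L \<mu>. is_coproduct D I (\<lambda>i. X i k) L \<mu> \<and> (k = 0 \<longrightarrow> L = S \<and> \<mu> = \<iota>)"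
  proof
    fix k
    show "\<exists>L \<mu>. is_coproduct D I (\<lambda>i. X i k) L \<mu> \<and> (k = 0 \<longrightarrow> L = S \<and> \<mu> = \<iota>)"
    proof (cases "k = 0")
      case True
      then show ?thesis using coproduct_cong[OF S, of "\<lambda>i. X i 0" \<iota>] X0 by simp
    next
      case False
      obtain L \<mu> where "is_coproduct D I (\<lambda>i. X i k) L \<mu>"
        using ex_small_coproduct[OF coproducts I, of "\<lambda>i. X i k"] XO by blast
      then show ?thesis using False by blast
    qed
  qed
  then obtain L \<mu> where L': "\<forall>k. is_coproduct D I (\<lambda>i. X i k) (L k) (\<mu> k) \<and> (k = 0 \<longrightarrow> L k = S \<and> \<mu> k = \<iota>)"
    unfolding choice_iff by blast
  then have L: "is_coproduct D I (\<lambda>i. X i k) (L k) (\<mu> k)" for k by blast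
  have L0: "L 0 = S" "\<mu> 0 = \<iota>" using L' by auto
  have LO: "L k \<in> Obj D" for k by (rule coproduct_obj[OF L])
  \<comment> \<open>Exchanging the two coproducts makes \<open>SN\<close> the coproduct of the
    stages, so that countable families apply to it.\<close>
  obtain j where j: "is_coproduct D (UNIV :: nat set) L SN j"
    and j\<mu>: "\<And>i k. i \<in> I \<Longrightarrow> j k \<odot> \<mu> k i = \<nu> i \<odot> \<rho> i k"
    using coproduct_exchange[OF SN N, of L \<mu>] L by (metis UNIV_I)
  have jh: "j k \<in> Hom D (L k) SN" for k using coproduct_inj[OF j] by simp
  have SNO: "SN \<in> Obj D" by (rule coproduct_obj[OF SN])
  have "\<forall>k. \<exists>g. g \<in> Hom D (L k) (L (Suc k)) \<and> (\<forall>i\<in>I. g \<odot> \<mu> k i = \<mu> (Suc k) i \<odot> m i k)"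
  proof
    fix k
    show "\<exists>g. g \<in> Hom D (L k) (L (Suc k)) \<and> (\<forall>i\<in>I. g \<odot> \<mu> k i = \<mu> (Suc k) i \<odot> m i k)"
      by (rule coproduct_induced[OF L[of k] L[of "Suc k"], of "\<lambda>i. m i k"]) (use m in auto)
  qed
  then obtain mm where "\<forall>k. mm k \<in> Hom D (L k) (L (Suc k)) \<and> (\<forall>i\<in>I. mm k \<odot> \<mu> k i = \<mu> (Suc k) i \<odot> m i k)"
    by (rule choice[THEN exE])
  then have mm: "\<And>k. mm k \<in> Hom D (L k) (L (Suc k))"
    and mm\<mu>: "\<And>i k. i \<in> I \<Longrightarrow> mm k \<odot> \<mu> k i = \<mu> (Suc k) i \<odot> m i k" by auto
  obtain se where se: "se \<in> Hom D SN SN" "\<And>i. i \<in> I \<Longrightarrow> se \<odot> \<nu> i = \<nu> i \<odot> e i"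
    using coproduct_induced[OF SN SN eh] by blast
  obtain sz where sz: "sz \<in> Hom D SN SY" "\<And>i. i \<in> I \<Longrightarrow> sz \<odot> \<nu> i = \<eta> i \<odot> z i"
    using coproduct_induced[OF SN SY distinguished_homs(2)[OF Ytri]] by blast
  obtain ss where ss: "ss \<in> Hom D SN SN" "\<And>k. ss \<odot> j k = j (Suc k) \<odot> mm k"
    using ex_telescope_shift[OF j mm] by (metis (no_types))
  \<comment> \<open>The coproduct over \<open>i\<close> of the maps \<open>1 - s i\<close> is
    \<open>1 - ss\<close>, where \<open>ss\<close> moves each stage \<open>L k\<close> to the
    next.\<close>
  have se_ss: "se = Plus D (Ident D SN) (Minus D ss)"
  proof (rule coproduct_eqI[OF SN se(1) plus_hom[OF ident_hom[OF SNO] minus_hom[OF ss(1)]]])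
    fix i assume i: "i \<in> I"
    have ss\<nu>: "ss \<odot> \<nu> i = \<nu> i \<odot> s i"
    proof (rule coproduct_eqI[OF N[OF i] comp_hom[OF \<nu>[OF i] ss(1)] comp_hom[OF s[OF i] \<nu>[OF i]]])
      fix k :: nat
      note \<mu>h = coproduct_inj[OF L i]
      have "(ss \<odot> \<nu> i) \<odot> \<rho> i k = ss \<odot> (j k \<odot> \<mu> k i)"
        using comp_assoc[OF \<rho>[OF i] \<nu>[OF i] ss(1)] j\<mu>[OF i] by simp
      also have "\<dots> = (j (Suc k) \<odot> mm k) \<odot> \<mu> k i"
        using comp_assoc[OF \<mu>h jh ss(1), of k] ss(2)[of k] by simp
      also have "\<dots> = j (Suc k) \<odot> (\<mu> (Suc k) i \<odot> m i k)"
        using comp_assoc[OF \<mu>h mm jh, of k] mm\<mu>[OF i, of k] by simp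
      also have "\<dots> = (\<nu> i \<odot> \<rho> i (Suc k)) \<odot> m i k"
        using comp_assoc[OF m[OF i] \<mu>h jh, of k] j\<mu>[OF i, of "Suc k"] by simp
      also have "\<dots> = \<nu> i \<odot> (s i \<odot> \<rho> i k)"
        using comp_assoc[OF m[OF i] \<rho>[OF i] \<nu>[OF i], of k] s\<rho>[OF i, of k] by simp
      also have "\<dots> = (\<nu> i \<odot> s i) \<odot> \<rho> i k"
        by (rule comp_assoc[OF \<rho>[OF i] s[OF i] \<nu>[OF i], symmetric])
      finally show "(ss \<odot> \<nu> i) \<odot> \<rho> i k = (\<nu> i \<odot> s i) \<odot> \<rho> i k" .
    qed
    have "se \<odot> \<nu> i = Plus D (\<nu> i) (Minus D (\<nu> i \<odot> s i))"
      using se(2)[OF i] comp_sub[OF ident_hom[OF coproduct_obj[OF N[OF i]]] s[OF i] \<nu>[OF i]] comp_ident[OF \<nu>[OF i]]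
      by (simp add: e_def)
    also have "\<dots> = Plus D (Ident D SN) (Minus D ss) \<odot> \<nu> i"
      using sub_comp[OF \<nu>[OF i] ident_hom[OF SNO] ss(1)] ident_comp[OF \<nu>[OF i]] ss\<nu> by simp
    finally show "se \<odot> \<nu> i = Plus D (Ident D SN) (Minus D ss) \<odot> \<nu> i" .
  qed
  have uh: "u \<in> Hom D P (L 0)" using u L0 by simp
  have "SY \<in> Perp" by (rule closed_under_small_coproductsD[OF cl I SY Y])
  then have "sz \<odot> (j 0 \<odot> u) = Zero D P SY"
    by (rule PerpD[OF _ comp_hom[OF comp_hom[OF uh jh] sz(1)]])
  then obtain w where w: "w \<in> Hom D P SN" "se \<odot> w = j 0 \<odot> u"
    using coproduct_of_triangles_lift[OF Ytri SN SN SY se sz comp_hom[OF uh jh]] by blast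
  obtain \<pi> where \<pi>: "\<And>j. j \<in> UNIV \<Longrightarrow> \<pi> j \<in> Hom D SN (L j)" "\<And>k. k \<in> UNIV \<Longrightarrow> \<pi> k \<odot> j k = Ident D (L k)"
      "\<And>i k. i \<in> UNIV \<Longrightarrow> k \<in> UNIV \<Longrightarrow> i \<noteq> k \<Longrightarrow> \<pi> k \<odot> j i = Zero D (L i) (L k)"
    using coproduct_projections[OF j] by blast
  have \<pi>h: "\<pi> k \<in> Hom D SN (L k)" for k using \<pi>(1) by simp
  note tele = telescope_projection[OF j mm ss \<pi>]
  have sew: "se \<odot> w = Plus D w (Minus D (ss \<odot> w))"
    using sub_comp[OF w(1) ident_hom[OF SNO] ss(1)] ident_comp[OF w(1)] se_ss by simp
  have \<pi>w: "Plus D (\<pi> k \<odot> w) (Minus D ((\<pi> k \<odot> ss) \<odot> w)) = (\<pi> k \<odot> j 0) \<odot> u" for k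
    using comp_sub[OF w(1) comp_hom[OF w(1) ss(1)] \<pi>h] comp_assoc[OF w(1) ss(1) \<pi>h]
      comp_assoc[OF uh jh \<pi>h] sew w(2) by simp
  have w0: "\<pi> 0 \<odot> w = u"
    using \<pi>w[of 0] tele(1) zero_comp[OF w(1) LO] sub_zero[OF comp_hom[OF w(1) \<pi>h]] \<pi>(2)[of 0] ident_comp[OF uh]
    by simp
  have wSuc: "\<pi> (Suc k) \<odot> w = mm k \<odot> (\<pi> k \<odot> w)" for k
  proof (rule eq_if_plus_minus_zero[OF comp_hom[OF w(1) \<pi>h] comp_hom[OF comp_hom[OF w(1) \<pi>h] mm]])
    show "Plus D (\<pi> (Suc k) \<odot> w) (Minus D (mm k \<odot> (\<pi> k \<odot> w))) = Zero D P (L (Suc k))"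
      using \<pi>w[of "Suc k"] tele(2)[of k] comp_assoc[OF w(1) \<pi>h mm] \<pi>(3)[of 0 "Suc k"] zero_comp[OF uh LO] by simp
  qed
  have "w \<in> finite_sums D P UNIV L SN j" by (rule finitaryD[OF fin j LO w(1)])
  then obtain K where K0: "\<forall>k\<ge>K. \<pi> k \<odot> w = Zero D P (L k)"
    using finite_sums_bounded[OF j P \<pi>] by blast
  have descend: "\<pi> k \<odot> w \<in> finite_sums D P I (\<lambda>i. X i k) (L k) (\<mu> k)"
    if "\<pi> (Suc k) \<odot> w \<in> finite_sums D P I (\<lambda>i. X i (Suc k)) (L (Suc k)) (\<mu> (Suc k))" for k
  proof -
    have wk: "\<pi> k \<odot> w \<in> Hom D P (L k)" by (rule comp_hom[OF w(1) \<pi>h])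
    obtain q where q: "\<And>i. i \<in> I \<Longrightarrow> q i \<in> Hom D (L k) (X i k)" "\<And>i. i \<in> I \<Longrightarrow> q i \<odot> \<mu> k i = Ident D (X i k)"
      "\<And>i i'. i \<in> I \<Longrightarrow> i' \<in> I \<Longrightarrow> i \<noteq> i' \<Longrightarrow> q i' \<odot> \<mu> k i = Zero D (X i k) (X i' k)"
      using coproduct_projections[OF L] by blast
    obtain q' where q': "\<And>i. i \<in> I \<Longrightarrow> q' i \<in> Hom D (L (Suc k)) (X i (Suc k))"
      "\<And>i. i \<in> I \<Longrightarrow> q' i \<odot> \<mu> (Suc k) i = Ident D (X i (Suc k))"
      "\<And>i i'. i \<in> I \<Longrightarrow> i' \<in> I \<Longrightarrow> i \<noteq> i' \<Longrightarrow> q' i' \<odot> \<mu> (Suc k) i = Zero D (X i (Suc k)) (X i' (Suc k))"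
      using coproduct_projections[OF L] by blast
    have qm: "q' i \<odot> mm k = m i k \<odot> q i" if i: "i \<in> I" for i
    proof (rule coproduct_eqI[OF L comp_hom[OF mm q'(1)[OF i]] comp_hom[OF q(1)[OF i] m[OF i]]])
      fix i' assume i': "i' \<in> I"
      note \<mu>h = coproduct_inj[OF L i']
      have "(q' i \<odot> mm k) \<odot> \<mu> k i' = (q' i \<odot> \<mu> (Suc k) i') \<odot> m i' k"
        using comp_assoc[OF \<mu>h mm q'(1)[OF i]] mm\<mu>[OF i'] comp_assoc[OF m[OF i'] \<mu>h q'(1)[OF i]] by simp
      moreover have "(m i k \<odot> q i) \<odot> \<mu> k i' = m i k \<odot> (q i \<odot> \<mu> k i')"
        by (rule comp_assoc[OF \<mu>h q(1)[OF i] m[OF i]])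
      ultimately show "(q' i \<odot> mm k) \<odot> \<mu> k i' = (m i k \<odot> q i) \<odot> \<mu> k i'"
        using q(2)[OF i] q'(2)[OF i] q(3)[OF i' i] q'(3)[OF i' i] ident_comp[OF m[OF i], of k]
          comp_ident[OF m[OF i], of k] zero_comp[OF m[OF i'] XO[OF i]] comp_zero[OF m[OF i] XO[OF i']]
        by (cases "i' = i") simp_all
    qed
    \<comment> \<open>Its components in the summands are images under the killing maps of the
      towers; a finite sum with zero components is zero.\<close>
    have "\<pi> (Suc k) \<odot> w = Zero D P (L (Suc k))"
    proof (rule finite_sums_eq_zero[OF L P that q'])
      fix i assume i: "i \<in> I"
      have "q' i \<odot> (mm k \<odot> (\<pi> k \<odot> w)) = (q' i \<odot> mm k) \<odot> (\<pi> k \<odot> w)"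
        by (rule comp_assoc[OF wk mm q'(1)[OF i], symmetric])
      also have "\<dots> = m i k \<odot> (q i \<odot> (\<pi> k \<odot> w))"
        using qm[OF i] comp_assoc[OF wk q(1)[OF i] m[OF i]] by simp
      also have "\<dots> = Zero D P (X i (Suc k))" by (rule kill[OF i comp_hom[OF wk q(1)[OF i]]])
      finally show "q' i \<odot> (\<pi> (Suc k) \<odot> w) = Zero D P (X i (Suc k))" using wSuc by simp
    qed
    then have 0: "mm k \<odot> (\<pi> k \<odot> w) = Zero D P (L (Suc k))" using wSuc by simp
    obtain ST \<tau> where ST: "is_coproduct D I (\<lambda>i. T i k) ST \<tau>"
      using ex_small_coproduct[OF coproducts I, of "\<lambda>i. T i k"] TS Sum_of_obj by blast
    obtain a where a: "a \<in> Hom D ST (L k)" "\<And>i. i \<in> I \<Longrightarrow> a \<odot> \<tau> i = \<mu> k i \<odot> t i k"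
      using coproduct_induced[OF ST L, of "\<lambda>i. t i k"] distinguished_homs(1)[OF tri] by blast
    obtain v where v: "v \<in> Hom D P ST" "a \<odot> v = \<pi> k \<odot> w"
      using coproduct_of_triangles_lift[OF tri ST L L a mm mm\<mu> wk 0] by blast
    have "v \<in> finite_sums D P I (\<lambda>i. T i k) ST \<tau>" by (rule finitaryD[OF finS[OF I] ST TS v(1)])
    from finite_sums_induced[OF ST L distinguished_homs(1)[OF tri] a P this] show ?thesis
      using v(2) by simp
  qed
  have "\<pi> 0 \<odot> w \<in> finite_sums D P I (\<lambda>i. X i 0) (L 0) (\<mu> 0)"
  proof (rule inc_induct[of 0 K])
    show "\<pi> K \<odot> w \<in> finite_sums D P I (\<lambda>i. X i K) (L K) (\<mu> K)"
      using K0 finite_sums.zero[of D P "L K" I "\<lambda>i. X i K" "\<mu> K"] by simp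
  qed (use descend in auto)
  then have "u \<in> finite_sums D P I (\<lambda>i. X i 0) S \<iota>" using w0 L0 by simp
  then show "u \<in> finite_sums D P I M S \<iota>"
    by (rule finite_sums_cong) (rule X0)
qed

end

section \<open>The equivalence\<close>

theorem proposition4p4p16:
  fixes \<kappa> :: "'k rel" and D :: "('o, 'm) tri_data" and P :: 'o
  assumes "universe_cardinal \<kappa>"
    and "triangulated_category D"
    and "locally_small \<kappa> D"
    and "has_small_coproducts \<kappa> D"
    and "P \<in> Obj D"
  defines "cond1 \<equiv> compact_object \<kappa> D P"
    and "cond2 \<equiv> perfect D P \<and>
           compact_object \<kappa> (full_subcategory D (Sum_of \<kappa> D (shifts D P))) P \<and>
           closed_under_small_coproducts \<kappa> D (perp D (Tria \<kappa> D P))"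
    and "cond3 \<equiv> compact_object \<kappa> (full_subcategory D (Tria \<kappa> D P)) P \<and>
           closed_under_small_coproducts \<kappa> D (perp D (Tria \<kappa> D P))"
    and "cond4 \<equiv> superperfect \<kappa> D P \<and>
           compact_object \<kappa> (full_subcategory D (Sum_of \<kappa> D (shifts D P))) P"
  shows "(cond1 \<longleftrightarrow> cond2) \<and> (cond1 \<longleftrightarrow> cond3) \<and> (cond1 \<longleftrightarrow> cond4)"
proof -
  interpret triangulated_category D by fact
  interpret small_coproduct_triangulated D \<kappa> P
    by unfold_locales (fact assms)+
  let ?fin = "\<lambda>U. \<forall>I :: 'k set. small \<kappa> I \<longrightarrow> finitary D U I P"
  have c1: "cond1 \<longleftrightarrow> ?fin (Obj D)"
    unfolding cond1_def compact_object_iff_finitary using P by simp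
  have "P \<in> Sums"
    using Sum_of_superset[OF cardinal] shifts_obj shifts_refl[OF P] by blast
  then have cS: "compact_object \<kappa> (full_subcategory D Sums) P \<longleftrightarrow> ?fin Sums"
    using compact_object_full_iff_finitary[OF coproducts Sum_of_obj Sum_of_closed[OF cardinal]] by blast
  have cT: "compact_object \<kappa> (full_subcategory D (Tria \<kappa> D P)) P \<longleftrightarrow> ?fin (Tria \<kappa> D P)"
    using compact_object_full_iff_finitary[OF coproducts Tria_obj Tria_closed] Tria_self by blast
  have restrict: "?fin U" if "?fin (Obj D)" "U \<subseteq> Obj D" for U
  proof (intro allI impI)
    fix I :: "'k set" assume "small \<kappa> I"
    then show "finitary D U I P" using finitary_mono[of D "Obj D" I P U] that by simp
  qed
  have perp: "closed_under_small_coproducts \<kappa> D Perp" if "?fin (Obj D)"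
    by (rule finitary_imp_Perp_closed) (simp add: that)
  have perf: "perfect D P" if fin: "?fin (Obj D)"
    unfolding perfect_def
  proof (intro conjI allI)
    fix I :: "nat set"
    have "finitary D (Obj D) I P"
      by (rule finitary_small[OF _ small_nat[OF cardinal]]) (simp add: fin)
    then show "preserves_coproduct_surjections D P I" by (rule finitary_imp_preserves_surjections)
  qed (rule P)
  have sup: "superperfect \<kappa> D P" if fin: "?fin (Obj D)"
    unfolding superperfect_def
    using P fin by (simp add: finitary_imp_preserves_surjections)
  have from2: "?fin (Obj D)"
    if perfect: "perfect D P" and fin: "?fin Sums" and cl: "closed_under_small_coproducts \<kappa> D Perp"
  proof -
    have S: "\<And>I :: 'k set. small \<kappa> I \<Longrightarrow> finitary D Sums I P" using fin by simp
    have "finitary D Sums (UNIV :: nat set) P"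
      by (rule finitary_small[OF S small_nat[OF cardinal]])
    then have "finitary D (Obj D) (UNIV :: nat set) P"
      using perfect preserves_surjections_imp_finitary[OF _ small_nat[OF cardinal]]
      by (simp add: perfect_def)
    from countably_finitary_imp_finitary[OF this S cl] show ?thesis by simp
  qed
  have from3: "?fin (Obj D)"
    if fin: "?fin (Tria \<kappa> D P)" and cl: "closed_under_small_coproducts \<kappa> D Perp"
  proof -
    have "\<And>I :: 'k set. small \<kappa> I \<Longrightarrow> finitary D (Tria \<kappa> D P) I P" using fin by simp
    from finitary_Tria_imp_finitary[OF this cl] show ?thesis by simp
  qed
  have from4: "?fin (Obj D)" if "superperfect \<kappa> D P" "?fin Sums"
    using that by (simp add: superperfect_def preserves_surjections_imp_finitary)
  have "cond1 \<longleftrightarrow> cond2"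
    unfolding c1 cond2_def cS
  proof (rule iffI)
    assume fin: "?fin (Obj D)"
    show "perfect D P \<and> ?fin Sums \<and> closed_under_small_coproducts \<kappa> D Perp"
      by (intro conjI perf[OF fin] restrict[OF fin Sum_of_obj] perp[OF fin])
  qed (elim conjE, rule from2)
  moreover have "cond1 \<longleftrightarrow> cond3"
    unfolding c1 cond3_def cT
  proof (rule iffI)
    assume fin: "?fin (Obj D)"
    show "?fin (Tria \<kappa> D P) \<and> closed_under_small_coproducts \<kappa> D Perp"
      by (intro conjI restrict[OF fin Tria_obj] perp[OF fin])
  qed (elim conjE, rule from3)
  moreover have "cond1 \<longleftrightarrow> cond4"
    unfolding c1 cond4_def cS
  proof (rule iffI)
    assume fin: "?fin (Obj D)"
    show "superperfect \<kappa> D P \<and> ?fin Sums"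
      by (intro conjI sup[OF fin] restrict[OF fin Sum_of_obj])
  qed (elim conjE, rule from4)
  ultimately show ?thesis by simp
qed

end
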